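(* Let $k$ be a field of characteristic not $2$ or $3$. Let $\pi : \mathfrak{g} \rightarrow \mathfrak{so}_{\epsilon}(V,(\ ,\ ))$ be a finite-dimensional $\epsilon$-orthogonal representation, with $\dim V\ge 2$, of a finite-dimensional $\epsilon$-quadratic colour Lie algebra $(\mathfrak{g},B_{\mathfrak{g}})$ and let $\mu : \Lambda^2_{\epsilon}(V)\rightarrow \mathfrak{g}$ be its moment map. Let $\phi : \Lambda^2_{\epsilon}(V) \rightarrow V$ be a linear map of degree $0$ (equivalently an $\epsilon$-antisymmetric bilinear map $V\times V\to V$ of degree $0$) satisfying $$\pi(x)(\phi(v,w))=\phi(\pi(x)(v),w)+\epsilon(x,v)\phi(v,\pi(x)(w)) \quad \forall x \in \mathfrak{g},\ \forall v,w \in V,$$ $$(\phi(u,v),w)=-\epsilon(u,v)(v,\phi(u,w)) \quad \forall u,v,w \in V.$$ Let $\tilde{\mathfrak{g}}:=\mathfrak{g}\oplus V$, let $B_{\tilde{\mathfrak{g}}}:=B_{\mathfrak{g}}\perp (\ ,\ )$ and let $\{\ ,\ \}:\Lambda_{\epsilon}^2(\tilde{\mathfrak{g}})\rightarrow \tilde{\mathfrak{g}}$ be the unique map which extends the bracket of $\mathfrak{g}$ and the action of $\mathfrak{g}$ on $V$ (i.e. $\{x,v\}=\pi(x)(v)$ for $x\in\mathfrak{g}$, $v\in V$) and such that $$\{v,w\}=\mu(v,w)+\phi(v,w) \qquad \forall v,w \in V.$$ Let the cubic term $\psi \in C_{\epsilon}(V,(\ ,\ ))$ be the image, under the quantisation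 map $Q_3 :\Lambda^3_{\epsilon}(V) \rightarrow C_{\epsilon}(V,(\ ,\ ))$, of the element of $\Lambda^3_\epsilon(V)$ corresponding to the $\epsilon$-alternating trilinear map $(u,v,w)\mapsto\frac{1}{2}(u,\phi(v,w))$ under the isomorphism $\Lambda^3_{\epsilon}(V)\to\Lambda^3_{\epsilon}(V)^*$, $f\mapsto (f,\cdot)_\Lambda$. The following are equivalent: (a) $(\tilde{\mathfrak{g}},B_{\tilde{\mathfrak{g}}},\{\ ,\ \})$ is an $\epsilon$-quadratic colour Lie algebra. (b) $\pi_*(\Omega(\mathfrak{g}))+\psi^2\in k$ (as an element of $C_\epsilon(V,(\ ,\ ))$).
   Context: Graded conventions. $\Gamma$ is an abelian group (additive) and $\epsilon:\Gamma\times\Gamma\to k^{\times}$ is a commutation factor: $\epsilon(a,b)\epsilon(b,a)=1$, $\epsilon(a+b,c)=\epsilon(a,c)\epsilon(b,c)$, $\epsilon(a,b+c)=\epsilon(a,b)\epsilon(a,c)$. For homogeneous $v,w$ write $\epsilon(v,w)=\epsilon(|v|,|w|)$, $\epsilon(v)=\epsilon(|v|,|v|)$. Formulas involving degrees are for homogeneous elements and extended by linearity; bases are homogeneous; bilinear forms are of degree $0$ ($B(V_a,V_b)=0$ unless $a+b=0$). A bilinear map $B$ is $\epsilon$-symmetric if $B(v,w)=\epsilon(v,w)B(w,v)$, $\epsilon$-antisymmetric if $B(v,w)=-\epsilon(v,w)B(w,v)$. For a basis $\{e_i\}$ of a finite-dimensional space with a non-degenerate $\epsilon$-symmetric form, the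 dual basis $\{e^i\}$ is defined by $(e_i,e^j)=\delta_{ij}$. Colour Lie algebra: a $\Gamma$-graded space with bilinear bracket satisfying $\{\mathfrak{g}_a,\mathfrak{g}_b\}\subseteq\mathfrak{g}_{a+b}$, $\{x,y\}=-\epsilon(x,y)\{y,x\}$, $\epsilon(z,x)\{x,\{y,z\}\}+\epsilon(x,y)\{y,\{z,x\}\}+\epsilon(y,z)\{z,\{x,y\}\}=0$. It is $\epsilon$-quadratic if equipped with a non-degenerate $\epsilon$-symmetric form $B$ with $B(\{x,y\},z)=-\epsilon(x,y)B(y,\{x,z\})$. $\mathfrak{so}_\epsilon(V,(\ ,\ ))$ is the colour Lie algebra spanned by homogeneous $f\in\mathrm{End}(V)$ with $(f(v),w)+\epsilon(f,v)(v,f(w))=0$, with bracket $fg-\epsilon(f,g)gf$. An $\epsilon$-orthogonal representation is a $\Gamma$-graded space $V$ with a non-degenerate $\epsilon$-symmetric form and a degree $0$ morphism of colour Lie algebras $\pi:\mathfrak{g}\to\mathfrak{so}_\epsilon(V,(\ ,\ ))$. The moment map is the degree $0$, $\epsilon$-antisymmetric map $\mu$ given by $B_{\mathfrak{g}}(x,\mu(v,w))=(\pi(x)(v),w)$ for $x\in\mathfrak{g}$, $v,w\in V$. $U_\epsilon(\mathfrak{g})=T(\mathfrak{g})/\langle x\otimes y-\epsilon(x,y)y\otimes x-\{x,y\}\rangle$; Casimir element $\Omega(\mathfrak{g})=\sum_i x^ix_i$ for a basis $\{x_i\}$ of $\mathfrak{g}$ with $B_{\mathfrak{g}}$-dual basis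 $\{x^i\}$. $C_\epsilon(V,(\ ,\ ))=T(V)/\langle x\otimes y+\epsilon(x,y)y\otimes x-2(x,y)1\rangle$, $\mathbb{Z}_2\times\Gamma$-graded; $\Lambda_\epsilon(V)=T(V)/\langle x\otimes y+\epsilon(x,y)y\otimes x\rangle$. For $\sigma\in S_n$, $p(\sigma;v_1,\ldots,v_n)=sgn(\sigma)\prod_{i<j,\ \sigma^{-1}(i)>\sigma^{-1}(j)}\epsilon(v_i,v_j)$. Quantisation: $Q_n(v_1\wedge\cdots\wedge v_n)=\frac1{n!}\sum_{\sigma\in S_n}p(\sigma;v_1,\ldots,v_n)v_{\sigma(1)}\cdots v_{\sigma(n)}$. The form $(\ ,\ )_\Lambda$ on $\Lambda^n_\epsilon(V)$ is $$(u_1\wedge\cdots\wedge u_n,v_1\wedge\cdots\wedge v_n)_\Lambda=\sum_{\sigma\in S_n}p(\sigma;u_1,\ldots,u_n)\prod_{i=0}^{n-1}(u_{\sigma(n-i)},v_{1+i}).$$ Explicitly, $\psi=\frac{1}{12}\sum_{i,j,l}(e^i,\phi(e^j,e^l))\,e_le_je_i$. Map $\pi_*$: $\pi_*:\mathfrak{g}\to C_\epsilon(V,(\ ,\ ))$, $\pi_*(x)=\frac14\sum_i\pi(x)(e^i)e_i$ for a basis $\{e_i\}$ of $V$ with dual basis $\{e^i\}$; it is a morphism of colour Lie algebras for the bracket $x\cdot y-\tilde\epsilon(x,y)y\cdot x$ on $C_\epsilon(V,(\ ,\ ))$, where $\tilde\epsilon((a_1,\gamma_1),(a_2,\gamma_2))=(-1)^{a_1a_2}\epsilon(\gamma_1,\gamma_2)$,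 and it is extended to an algebra morphism $\pi_*:U_\epsilon(\mathfrak{g})\to C_\epsilon(V,(\ ,\ ))$. *)

theory Defs
  imports
    HOL.Vector_Spaces
    "HOL-Library.Poly_Mapping"
    "HOL-Library.Product_Plus"
    "HOL-Combinatorics.Permutations"
    "HOL-Algebra.QuotRing"
begin

section \<open>Graded linear algebra\<close>

text \<open>
  Vector spaces are whole types with an explicit scalar multiplication. A grading is the family
  of its homogeneous components. An identity involving degrees is stated for all members of
  components; it holds trivially for \<open>0\<close>, which lies in every component.
\<close>

locale commutation_factor =
  fixes eps :: "'c::ab_group_add \<Rightarrow> 'c \<Rightarrow> 'k::field"
  assumes eps_inverse: "eps a b * eps b a = 1"
    and eps_add_left: "eps (a + b) c = eps a c * eps b c"
    and eps_add_right: "eps a (b + c) = eps a b * eps a c"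

locale graded_vector_space = vector_space scale
  for scale :: "'k::field \<Rightarrow> 'v::ab_group_add \<Rightarrow> 'v" +
  fixes comp :: "'c::ab_group_add \<Rightarrow> 'v set"
  assumes subspace_comp: "subspace (comp a)"
    and direct_sum: "\<exists>!f. finite {a. f a \<noteq> 0} \<and> (\<forall>a. f a \<in> comp a) \<and> v = (\<Sum>a | f a \<noteq> 0. f a)"

definition bilinear_map ::
  "('k::field \<Rightarrow> 'u::ab_group_add \<Rightarrow> 'u) \<Rightarrow> ('k \<Rightarrow> 'v::ab_group_add \<Rightarrow> 'v) \<Rightarrow>
   ('k \<Rightarrow> 'w::ab_group_add \<Rightarrow> 'w) \<Rightarrow> ('u \<Rightarrow> 'v \<Rightarrow> 'w) \<Rightarrow> bool" where
  "bilinear_map s1 s2 s3 f \<longleftrightarrow>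
     (\<forall>u. Vector_Spaces.linear s2 s3 (f u)) \<and> (\<forall>v. Vector_Spaces.linear s1 s3 (\<lambda>u. f u v))"

definition degree_zero ::
  "('c::ab_group_add \<Rightarrow> 'v set) \<Rightarrow> ('c \<Rightarrow> 'w set) \<Rightarrow> ('v \<Rightarrow> 'v \<Rightarrow> 'w) \<Rightarrow> bool" where
  "degree_zero V W f \<longleftrightarrow> (\<forall>a b. \<forall>v\<in>V a. \<forall>w\<in>V b. f v w \<in> W (a + b))"

definition eps_antisymmetric ::
  "('c \<Rightarrow> 'c \<Rightarrow> 'k) \<Rightarrow> ('c \<Rightarrow> 'v set) \<Rightarrow> ('k \<Rightarrow> 'w::ab_group_add \<Rightarrow> 'w) \<Rightarrow>
   ('v \<Rightarrow> 'v \<Rightarrow> 'w) \<Rightarrow> bool" where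
  "eps_antisymmetric eps V s f \<longleftrightarrow>
     (\<forall>a b. \<forall>v\<in>V a. \<forall>w\<in>V b. f v w = - s (eps a b) (f w v))"

definition finite_dim :: "('k::field \<Rightarrow> 'v::ab_group_add \<Rightarrow> 'v) \<Rightarrow> bool" where
  "finite_dim s \<longleftrightarrow> (\<exists>B. finite B \<and> module.span s B = UNIV)"

definition homogeneous_basis ::
  "('k::field \<Rightarrow> 'v::ab_group_add \<Rightarrow> 'v) \<Rightarrow> ('c \<Rightarrow> 'v set) \<Rightarrow> 'v set \<Rightarrow> bool" where
  "homogeneous_basis s V E \<longleftrightarrow>
     \<not> module.dependent s E \<and> module.span s E = UNIV \<and> (\<forall>e\<in>E. \<exists>a. e \<in> V a)"

text \<open>The member of the dual basis of \<open>E\<close> which corresponds to \<open>e\<close>.\<close>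

definition dual_vector :: "('v \<Rightarrow> 'v \<Rightarrow> 'k::field) \<Rightarrow> 'v set \<Rightarrow> 'v \<Rightarrow> 'v" where
  "dual_vector form E e = (THE w. \<forall>e'\<in>E. form e' w = (if e' = e then 1 else 0))"

locale eps_symmetric_space = commutation_factor eps + graded_vector_space scale V
  for eps :: "'c::ab_group_add \<Rightarrow> 'c \<Rightarrow> 'k::field"
    and scale :: "'k \<Rightarrow> 'v::ab_group_add \<Rightarrow> 'v"
    and V :: "'c \<Rightarrow> 'v set" +
  fixes form :: "'v \<Rightarrow> 'v \<Rightarrow> 'k"
  assumes form_bilinear: "bilinear_map scale scale (*) form"
    and form_degree: "\<lbrakk>v \<in> V a; w \<in> V b; a + b \<noteq> 0\<rbrakk> \<Longrightarrow> form v w = 0"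
    and form_symmetric: "\<lbrakk>v \<in> V a; w \<in> V b\<rbrakk> \<Longrightarrow> form v w = eps a b * form w v"
    and form_nondegenerate_left: "(\<And>w. form v w = 0) \<Longrightarrow> v = 0"
    and form_nondegenerate_right: "(\<And>v. form v w = 0) \<Longrightarrow> w = 0"

section \<open>Colour Lie algebras and their orthogonal representations\<close>

locale colour_lie_algebra = commutation_factor eps + graded_vector_space scale G
  for eps :: "'c::ab_group_add \<Rightarrow> 'c \<Rightarrow> 'k::field"
    and scale :: "'k \<Rightarrow> 'x::ab_group_add \<Rightarrow> 'x"
    and G :: "'c \<Rightarrow> 'x set" +
  fixes br :: "'x \<Rightarrow> 'x \<Rightarrow> 'x"
  assumes br_bilinear: "bilinear_map scale scale scale br"
    and br_degree: "degree_zero G G br"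
    and br_antisymmetric: "eps_antisymmetric eps G scale br"
    and br_jacobi: "\<lbrakk>x \<in> G a; y \<in> G b; z \<in> G c\<rbrakk> \<Longrightarrow>
      scale (eps c a) (br x (br y z)) + scale (eps a b) (br y (br z x))
        + scale (eps b c) (br z (br x y)) = 0"

locale quadratic_colour_lie_algebra =
  colour_lie_algebra eps scale G br + eps_symmetric_space eps scale G B
  for eps :: "'c::ab_group_add \<Rightarrow> 'c \<Rightarrow> 'k::field"
    and scale :: "'k \<Rightarrow> 'x::ab_group_add \<Rightarrow> 'x"
    and G :: "'c \<Rightarrow> 'x set"
    and br :: "'x \<Rightarrow> 'x \<Rightarrow> 'x"
    and B :: "'x \<Rightarrow> 'x \<Rightarrow> 'k" +
  assumes B_invariant: "\<lbrakk>x \<in> G a; y \<in> G b\<rbrakk> \<Longrightarrow> B (br x y) z = - eps a b * B y (br x z)"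

text \<open>The homogeneous component of degree \<open>a\<close> of \<open>so\<^sub>\<epsilon>(V, form)\<close>.\<close>

definition so_comp ::
  "('c::ab_group_add \<Rightarrow> 'c \<Rightarrow> 'k::field) \<Rightarrow> ('k \<Rightarrow> 'v::ab_group_add \<Rightarrow> 'v) \<Rightarrow> ('c \<Rightarrow> 'v set) \<Rightarrow>
   ('v \<Rightarrow> 'v \<Rightarrow> 'k) \<Rightarrow> 'c \<Rightarrow> ('v \<Rightarrow> 'v) set" where
  "so_comp eps s V form a = {f. Vector_Spaces.linear s s f \<and>
     (\<forall>b. \<forall>v\<in>V b. f v \<in> V (a + b)) \<and>
     (\<forall>b. \<forall>v\<in>V b. \<forall>w. form (f v) w + eps a b * form v (f w) = 0)}"

locale orthogonal_representation =
  colour_lie_algebra eps sg G br + VS: eps_symmetric_space eps sv V form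
  for eps :: "'c::ab_group_add \<Rightarrow> 'c \<Rightarrow> 'k::field"
    and sg :: "'k \<Rightarrow> 'x::ab_group_add \<Rightarrow> 'x"
    and G :: "'c \<Rightarrow> 'x set"
    and br :: "'x \<Rightarrow> 'x \<Rightarrow> 'x"
    and sv :: "'k \<Rightarrow> 'v::ab_group_add \<Rightarrow> 'v"
    and V :: "'c \<Rightarrow> 'v set"
    and form :: "'v \<Rightarrow> 'v \<Rightarrow> 'k" +
  fixes rep :: "'x \<Rightarrow> 'v \<Rightarrow> 'v"
  assumes rep_linear: "Vector_Spaces.linear sg sv (\<lambda>x. rep x v)"
    and rep_so: "x \<in> G a \<Longrightarrow> rep x \<in> so_comp eps sv V form a"
    and rep_bracket: "\<lbrakk>x \<in> G a; y \<in> G b\<rbrakk> \<Longrightarrow>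
      rep (br x y) v = rep x (rep y v) - sv (eps a b) (rep y (rep x v))"

definition moment_map ::
  "('c::ab_group_add \<Rightarrow> 'c \<Rightarrow> 'k::field) \<Rightarrow> ('k \<Rightarrow> 'x::ab_group_add \<Rightarrow> 'x) \<Rightarrow> ('c \<Rightarrow> 'x set) \<Rightarrow>
   ('x \<Rightarrow> 'x \<Rightarrow> 'k) \<Rightarrow> ('k \<Rightarrow> 'v::ab_group_add \<Rightarrow> 'v) \<Rightarrow> ('c \<Rightarrow> 'v set) \<Rightarrow> ('v \<Rightarrow> 'v \<Rightarrow> 'k) \<Rightarrow>
   ('x \<Rightarrow> 'v \<Rightarrow> 'v) \<Rightarrow> ('v \<Rightarrow> 'v \<Rightarrow> 'x) \<Rightarrow> bool" where
  "moment_map eps sg G B sv V form rep mu \<longleftrightarrow>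
     bilinear_map sv sv sg mu \<and> degree_zero V G mu \<and> eps_antisymmetric eps V sg mu \<and>
     (\<forall>x v w. B x (mu v w) = form (rep x v) w)"

definition prod_scale ::
  "('k \<Rightarrow> 'x \<Rightarrow> 'x) \<Rightarrow> ('k \<Rightarrow> 'v \<Rightarrow> 'v) \<Rightarrow> 'k \<Rightarrow> 'x \<times> 'v \<Rightarrow> 'x \<times> 'v" where
  "prod_scale s1 s2 c p = (s1 c (fst p), s2 c (snd p))"

definition orthogonal_sum ::
  "('x \<Rightarrow> 'x \<Rightarrow> 'k::plus) \<Rightarrow> ('v \<Rightarrow> 'v \<Rightarrow> 'k) \<Rightarrow> 'x \<times> 'v \<Rightarrow> 'x \<times> 'v \<Rightarrow> 'k" where
  "orthogonal_sum B form p q = B (fst p) (fst q) + form (snd p) (snd q)"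

text \<open>The values on \<open>V \<times> G\<close> are determined by \<open>\<epsilon>\<close>-antisymmetry.\<close>

definition extended_bracket ::
  "('c::ab_group_add \<Rightarrow> 'c \<Rightarrow> 'k::field) \<Rightarrow> ('k \<Rightarrow> 'x::ab_group_add \<Rightarrow> 'x) \<Rightarrow> ('c \<Rightarrow> 'x set) \<Rightarrow>
   ('x \<Rightarrow> 'x \<Rightarrow> 'x) \<Rightarrow> ('k \<Rightarrow> 'v::ab_group_add \<Rightarrow> 'v) \<Rightarrow> ('c \<Rightarrow> 'v set) \<Rightarrow>
   ('x \<Rightarrow> 'v \<Rightarrow> 'v) \<Rightarrow> ('v \<Rightarrow> 'v \<Rightarrow> 'x) \<Rightarrow> ('v \<Rightarrow> 'v \<Rightarrow> 'v) \<Rightarrow>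
   ('x \<times> 'v \<Rightarrow> 'x \<times> 'v \<Rightarrow> 'x \<times> 'v) \<Rightarrow> bool" where
  "extended_bracket eps sg G br sv V rep mu phi brt \<longleftrightarrow>
     bilinear_map (prod_scale sg sv) (prod_scale sg sv) (prod_scale sg sv) brt \<and>
     eps_antisymmetric eps (\<lambda>a. G a \<times> V a) (prod_scale sg sv) brt \<and>
     (\<forall>x y. brt (x, 0) (y, 0) = (br x y, 0)) \<and>
     (\<forall>x v. brt (x, 0) (0, v) = (0, rep x v)) \<and>
     (\<forall>v w. brt (0, v) (0, w) = (mu v w, phi v w))"

section \<open>Tensor algebra and its quotients\<close>

text \<open>
  Under concatenation, lists are the free monoid, so \<open>'v list \<Rightarrow>\<^sub>0 'k\<close> is the free
  associative unital algebra on the set \<open>'v\<close>; \<open>single [v\<^sub>1, \<dots>, v\<^sub>n] c\<close> is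
  \<open>c\<close> times the word \<open>v\<^sub>1 \<dots> v\<^sub>n\<close>, and \<open>single [] c\<close> is the scalar \<open>c\<close>.
\<close>

instantiation list :: (type) monoid_add
begin

definition zero_list :: "'a list" where "zero_list = []"

definition plus_list :: "'a list \<Rightarrow> 'a list \<Rightarrow> 'a list" where "plus_list xs ys = xs @ ys"

instance by standard (simp_all add: zero_list_def plus_list_def)

end

definition free_algebra :: "('v list \<Rightarrow>\<^sub>0 'k::field) ring" where
  "free_algebra = \<lparr>carrier = UNIV, monoid.mult = (*), one = 1, zero = 0, add = (+)\<rparr>"

text \<open>The tensor algebra is obtained by making the generators depend linearly on the vector.\<close>

definition tensor_ideal :: "('k::field \<Rightarrow> 'v::ab_group_add \<Rightarrow> 'v) \<Rightarrow> ('v list \<Rightarrow>\<^sub>0 'k) set" where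
  "tensor_ideal s = Idl\<^bsub>free_algebra\<^esub>
     ({Poly_Mapping.single [v + w] 1 - Poly_Mapping.single [v] 1 - Poly_Mapping.single [w] 1 | v w. True} \<union>
      {Poly_Mapping.single [s c v] 1 - Poly_Mapping.single [v] c | c v. True})"

definition tensor_algebra ::
  "('k::field \<Rightarrow> 'v::ab_group_add \<Rightarrow> 'v) \<Rightarrow> ('v list \<Rightarrow>\<^sub>0 'k) set ring" where
  "tensor_algebra s = free_algebra Quot tensor_ideal s"

definition tensor_class ::
  "('k::field \<Rightarrow> 'v::ab_group_add \<Rightarrow> 'v) \<Rightarrow> ('v list \<Rightarrow>\<^sub>0 'k) \<Rightarrow> ('v list \<Rightarrow>\<^sub>0 'k) set" where
  "tensor_class s p = tensor_ideal s +>\<^bsub>free_algebra\<^esub> p"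

text \<open>
  The quotient of the tensor algebra by the two-sided ideal generated by (the tensors represented
  by) \<open>R\<close>, and the class in it of the element represented by \<open>p\<close>.
\<close>

definition relation_ideal ::
  "('k::field \<Rightarrow> 'v::ab_group_add \<Rightarrow> 'v) \<Rightarrow> ('v list \<Rightarrow>\<^sub>0 'k) set \<Rightarrow> ('v list \<Rightarrow>\<^sub>0 'k) set set" where
  "relation_ideal s R = Idl\<^bsub>tensor_algebra s\<^esub> (tensor_class s ` R)"

definition quotient_algebra ::
  "('k::field \<Rightarrow> 'v::ab_group_add \<Rightarrow> 'v) \<Rightarrow> ('v list \<Rightarrow>\<^sub>0 'k) set \<Rightarrow> ('v list \<Rightarrow>\<^sub>0 'k) set set ring" where
  "quotient_algebra s R = tensor_algebra s Quot relation_ideal s R"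

definition quotient_class ::
  "('k::field \<Rightarrow> 'v::ab_group_add \<Rightarrow> 'v) \<Rightarrow> ('v list \<Rightarrow>\<^sub>0 'k) set \<Rightarrow> ('v list \<Rightarrow>\<^sub>0 'k) \<Rightarrow>
   ('v list \<Rightarrow>\<^sub>0 'k) set set" where
  "quotient_class s R p = relation_ideal s R +>\<^bsub>tensor_algebra s\<^esub> tensor_class s p"

definition quotient_scale ::
  "('k::field \<Rightarrow> 'v::ab_group_add \<Rightarrow> 'v) \<Rightarrow> ('v list \<Rightarrow>\<^sub>0 'k) set \<Rightarrow> 'k \<Rightarrow>
   ('v list \<Rightarrow>\<^sub>0 'k) set set \<Rightarrow> ('v list \<Rightarrow>\<^sub>0 'k) set set" where
  "quotient_scale s R c u =
     quotient_class s R (Poly_Mapping.single [] c) \<otimes>\<^bsub>quotient_algebra s R\<^esub> u"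

definition exterior_relations ::
  "('c \<Rightarrow> 'c \<Rightarrow> 'k::field) \<Rightarrow> ('c \<Rightarrow> 'v set) \<Rightarrow> ('v list \<Rightarrow>\<^sub>0 'k) set" where
  "exterior_relations eps V =
     {Poly_Mapping.single [x, y] 1 + Poly_Mapping.single [y, x] (eps a b) | x y a b. x \<in> V a \<and> y \<in> V b}"

definition clifford_relations ::
  "('c \<Rightarrow> 'c \<Rightarrow> 'k::field) \<Rightarrow> ('c \<Rightarrow> 'v set) \<Rightarrow> ('v \<Rightarrow> 'v \<Rightarrow> 'k) \<Rightarrow> ('v list \<Rightarrow>\<^sub>0 'k) set" where
  "clifford_relations eps V form =
     {Poly_Mapping.single [x, y] 1 + Poly_Mapping.single [y, x] (eps a b)
        - Poly_Mapping.single [] (2 * form x y) | x y a b. x \<in> V a \<and> y \<in> V b}"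

definition enveloping_relations ::
  "('c \<Rightarrow> 'c \<Rightarrow> 'k::field) \<Rightarrow> ('c \<Rightarrow> 'x set) \<Rightarrow> ('x \<Rightarrow> 'x \<Rightarrow> 'x) \<Rightarrow> ('x list \<Rightarrow>\<^sub>0 'k) set" where
  "enveloping_relations eps G br =
     {Poly_Mapping.single [x, y] 1 - Poly_Mapping.single [y, x] (eps a b)
        - Poly_Mapping.single [br x y] 1 | x y a b. x \<in> G a \<and> y \<in> G b}"

abbreviation exterior_algebra where
  "exterior_algebra eps s V \<equiv> quotient_algebra s (exterior_relations eps V)"

abbreviation clifford_algebra where
  "clifford_algebra eps s V form \<equiv> quotient_algebra s (clifford_relations eps V form)"

abbreviation enveloping_algebra where
  "enveloping_algebra eps s G br \<equiv> quotient_algebra s (enveloping_relations eps G br)"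

abbreviation exterior_class where
  "exterior_class eps s V \<equiv> quotient_class s (exterior_relations eps V)"

abbreviation clifford_class where
  "clifford_class eps s V form \<equiv> quotient_class s (clifford_relations eps V form)"

abbreviation enveloping_class where
  "enveloping_class eps s G br \<equiv> quotient_class s (enveloping_relations eps G br)"

definition exterior_power ::
  "('c \<Rightarrow> 'c \<Rightarrow> 'k::field) \<Rightarrow> ('k \<Rightarrow> 'v::ab_group_add \<Rightarrow> 'v) \<Rightarrow> ('c \<Rightarrow> 'v set) \<Rightarrow> nat \<Rightarrow>
   ('v list \<Rightarrow>\<^sub>0 'k) set set set" where
  "exterior_power eps s V n =
     exterior_class eps s V ` {p. \<forall>ws\<in>Poly_Mapping.keys p. length ws = n}"

section \<open>Quantisation and the form on the exterior algebra\<close>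

text \<open>\<open>p(\<sigma>; v\<^sub>1, \<dots>, v\<^sub>n)\<close>, where \<open>d i\<close> is the degree of \<open>v\<^sub>i\<close>.\<close>

definition colour_sign ::
  "('c \<Rightarrow> 'c \<Rightarrow> 'k::field) \<Rightarrow> nat \<Rightarrow> (nat \<Rightarrow> nat) \<Rightarrow> (nat \<Rightarrow> 'c) \<Rightarrow> 'k" where
  "colour_sign eps n \<sigma> d = of_int (sign \<sigma>) *
     (\<Prod>(i, j) \<in> {(i, j). i \<in> {1..n} \<and> j \<in> {1..n} \<and> i < j \<and> inv_into UNIV \<sigma> i > inv_into UNIV \<sigma> j}.
        eps (d i) (d j))"

abbreviation word :: "nat \<Rightarrow> (nat \<Rightarrow> 'v) \<Rightarrow> 'v list" where
  "word n v \<equiv> map v [1..<Suc n]"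

definition is_quantisation_map ::
  "('c::ab_group_add \<Rightarrow> 'c \<Rightarrow> 'k::field) \<Rightarrow> ('k \<Rightarrow> 'v::ab_group_add \<Rightarrow> 'v) \<Rightarrow> ('c \<Rightarrow> 'v set) \<Rightarrow>
   ('v \<Rightarrow> 'v \<Rightarrow> 'k) \<Rightarrow> nat \<Rightarrow> (('v list \<Rightarrow>\<^sub>0 'k) set set \<Rightarrow> ('v list \<Rightarrow>\<^sub>0 'k) set set) \<Rightarrow> bool" where
  "is_quantisation_map eps s V form n Q \<longleftrightarrow>
     Q \<in> exterior_power eps s V n \<rightarrow> carrier (clifford_algebra eps s V form) \<and>
     (\<forall>u\<in>exterior_power eps s V n. \<forall>u'\<in>exterior_power eps s V n.
        Q (u \<oplus>\<^bsub>exterior_algebra eps s V\<^esub> u') = Q u \<oplus>\<^bsub>clifford_algebra eps s V form\<^esub> Q u') \<and>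
     (\<forall>c. \<forall>u\<in>exterior_power eps s V n.
        Q (quotient_scale s (exterior_relations eps V) c u) =
          quotient_scale s (clifford_relations eps V form) c (Q u)) \<and>
     (\<forall>v d. (\<forall>i\<in>{1..n}. v i \<in> V (d i)) \<longrightarrow>
        Q (exterior_class eps s V (Poly_Mapping.single (word n v) 1)) =
          clifford_class eps s V form
            (\<Sum>\<sigma> | \<sigma> permutes {1..n}.
               Poly_Mapping.single (word n (\<lambda>i. v (\<sigma> i))) (colour_sign eps n \<sigma> d / of_nat (fact n))))"

text \<open>The map is determined on the exterior power only; its values elsewhere are irrelevant.\<close>

definition quantisation ::
  "('c::ab_group_add \<Rightarrow> 'c \<Rightarrow> 'k::field) \<Rightarrow> ('k \<Rightarrow> 'v::ab_group_add \<Rightarrow> 'v) \<Rightarrow> ('c \<Rightarrow> 'v set) \<Rightarrow>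
   ('v \<Rightarrow> 'v \<Rightarrow> 'k) \<Rightarrow> nat \<Rightarrow> ('v list \<Rightarrow>\<^sub>0 'k) set set \<Rightarrow> ('v list \<Rightarrow>\<^sub>0 'k) set set" where
  "quantisation eps s V form n = (SOME Q. is_quantisation_map eps s V form n Q)"

definition is_exterior_form ::
  "('c::ab_group_add \<Rightarrow> 'c \<Rightarrow> 'k::field) \<Rightarrow> ('k \<Rightarrow> 'v::ab_group_add \<Rightarrow> 'v) \<Rightarrow> ('c \<Rightarrow> 'v set) \<Rightarrow>
   ('v \<Rightarrow> 'v \<Rightarrow> 'k) \<Rightarrow> nat \<Rightarrow> (('v list \<Rightarrow>\<^sub>0 'k) set set \<Rightarrow> ('v list \<Rightarrow>\<^sub>0 'k) set set \<Rightarrow> 'k) \<Rightarrow> bool" where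
  "is_exterior_form eps s V form n F \<longleftrightarrow>
     (\<forall>t\<in>exterior_power eps s V n. \<forall>u\<in>exterior_power eps s V n. \<forall>u'\<in>exterior_power eps s V n.
        F (u \<oplus>\<^bsub>exterior_algebra eps s V\<^esub> u') t = F u t + F u' t \<and>
        F t (u \<oplus>\<^bsub>exterior_algebra eps s V\<^esub> u') = F t u + F t u') \<and>
     (\<forall>c. \<forall>t\<in>exterior_power eps s V n. \<forall>u\<in>exterior_power eps s V n.
        F (quotient_scale s (exterior_relations eps V) c u) t = c * F u t \<and>
        F t (quotient_scale s (exterior_relations eps V) c u) = c * F t u) \<and>
     (\<forall>u v d d'. (\<forall>i\<in>{1..n}. u i \<in> V (d i)) \<longrightarrow> (\<forall>i\<in>{1..n}. v i \<in> V (d' i)) \<longrightarrow>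
        F (exterior_class eps s V (Poly_Mapping.single (word n u) 1))
          (exterior_class eps s V (Poly_Mapping.single (word n v) 1)) =
        (\<Sum>\<sigma> | \<sigma> permutes {1..n}.
           colour_sign eps n \<sigma> d * (\<Prod>i<n. form (u (\<sigma> (n - i))) (v (1 + i)))))"

definition exterior_form ::
  "('c::ab_group_add \<Rightarrow> 'c \<Rightarrow> 'k::field) \<Rightarrow> ('k \<Rightarrow> 'v::ab_group_add \<Rightarrow> 'v) \<Rightarrow> ('c \<Rightarrow> 'v set) \<Rightarrow>
   ('v \<Rightarrow> 'v \<Rightarrow> 'k) \<Rightarrow> nat \<Rightarrow> ('v list \<Rightarrow>\<^sub>0 'k) set set \<Rightarrow> ('v list \<Rightarrow>\<^sub>0 'k) set set \<Rightarrow> 'k" where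
  "exterior_form eps s V form n = (SOME F. is_exterior_form eps s V form n F)"

definition cubic_tensor ::
  "('c::ab_group_add \<Rightarrow> 'c \<Rightarrow> 'k::field) \<Rightarrow> ('k \<Rightarrow> 'v::ab_group_add \<Rightarrow> 'v) \<Rightarrow> ('c \<Rightarrow> 'v set) \<Rightarrow>
   ('v \<Rightarrow> 'v \<Rightarrow> 'k) \<Rightarrow> ('v \<Rightarrow> 'v \<Rightarrow> 'v) \<Rightarrow> ('v list \<Rightarrow>\<^sub>0 'k) set set" where
  "cubic_tensor eps s V form phi =
     (THE f. f \<in> exterior_power eps s V 3 \<and>
        (\<forall>u v w. exterior_form eps s V form 3 f
                   (exterior_class eps s V (Poly_Mapping.single [u, v, w] 1)) =
                 1 / 2 * form u (phi v w)))"

definition cubic_term ::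
  "('c::ab_group_add \<Rightarrow> 'c \<Rightarrow> 'k::field) \<Rightarrow> ('k \<Rightarrow> 'v::ab_group_add \<Rightarrow> 'v) \<Rightarrow> ('c \<Rightarrow> 'v set) \<Rightarrow>
   ('v \<Rightarrow> 'v \<Rightarrow> 'k) \<Rightarrow> ('v \<Rightarrow> 'v \<Rightarrow> 'v) \<Rightarrow> ('v list \<Rightarrow>\<^sub>0 'k) set set" where
  "cubic_term eps s V form phi = quantisation eps s V form 3 (cubic_tensor eps s V form phi)"

section \<open>The Casimir element and its image in the Clifford algebra\<close>

definition casimir ::
  "('c::ab_group_add \<Rightarrow> 'c \<Rightarrow> 'k::field) \<Rightarrow> ('k \<Rightarrow> 'x::ab_group_add \<Rightarrow> 'x) \<Rightarrow> ('c \<Rightarrow> 'x set) \<Rightarrow>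
   ('x \<Rightarrow> 'x \<Rightarrow> 'x) \<Rightarrow> ('x \<Rightarrow> 'x \<Rightarrow> 'k) \<Rightarrow> 'x set \<Rightarrow> ('x list \<Rightarrow>\<^sub>0 'k) set set" where
  "casimir eps s G br B X =
     enveloping_class eps s G br (\<Sum>x\<in>X. Poly_Mapping.single [dual_vector B X x, x] 1)"

definition pi_star_generator ::
  "('c::ab_group_add \<Rightarrow> 'c \<Rightarrow> 'k::field) \<Rightarrow> ('k \<Rightarrow> 'v::ab_group_add \<Rightarrow> 'v) \<Rightarrow> ('c \<Rightarrow> 'v set) \<Rightarrow>
   ('v \<Rightarrow> 'v \<Rightarrow> 'k) \<Rightarrow> ('x \<Rightarrow> 'v \<Rightarrow> 'v) \<Rightarrow> 'v set \<Rightarrow> 'x \<Rightarrow> ('v list \<Rightarrow>\<^sub>0 'k) set set" where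
  "pi_star_generator eps s V form rep E x =
     clifford_class eps s V form
       (\<Sum>e\<in>E. Poly_Mapping.single [rep x (dual_vector form E e), e] (1 / 4))"

text \<open>The map is determined on the carrier of the enveloping algebra, which \<open>G\<close> generates.\<close>

definition pi_star ::
  "('c::ab_group_add \<Rightarrow> 'c \<Rightarrow> 'k::field) \<Rightarrow> ('k \<Rightarrow> 'x::ab_group_add \<Rightarrow> 'x) \<Rightarrow> ('c \<Rightarrow> 'x set) \<Rightarrow>
   ('x \<Rightarrow> 'x \<Rightarrow> 'x) \<Rightarrow> ('k \<Rightarrow> 'v::ab_group_add \<Rightarrow> 'v) \<Rightarrow> ('c \<Rightarrow> 'v set) \<Rightarrow>
   ('v \<Rightarrow> 'v \<Rightarrow> 'k) \<Rightarrow> ('x \<Rightarrow> 'v \<Rightarrow> 'v) \<Rightarrow> 'v set \<Rightarrow>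
   ('x list \<Rightarrow>\<^sub>0 'k) set set \<Rightarrow> ('v list \<Rightarrow>\<^sub>0 'k) set set" where
  "pi_star eps sg G br sv V form rep E =
     (SOME h. h \<in> ring_hom (enveloping_algebra eps sg G br) (clifford_algebra eps sv V form) \<and>
        (\<forall>c. h (enveloping_class eps sg G br (Poly_Mapping.single [] c)) =
             clifford_class eps sv V form (Poly_Mapping.single [] c)) \<and>
        (\<forall>x. h (enveloping_class eps sg G br (Poly_Mapping.single [x] 1)) =
             pi_star_generator eps sv V form rep E x))"

end

theory Submission
  imports Defs
begin

text \<open>
  Write \<open>c = \<pi>\<^sub>*(\<Omega>(g)) + \<psi>\<^sup>2\<close>, and for \<open>f\<close> in \<open>so\<^sub>\<epsilon>(V)\<close> let \<open>f\<^sub>* = \<Sum> f(e\<^sup>i) e\<^sub>i / 4\<close>, so that the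
  commutator with \<open>f\<^sub>*\<close> is \<open>f\<close> on \<open>V\<close>. One finds \<open>\<psi> v + v \<psi> = 2 \<phi>(v, -)\<^sub>*\<close>, and from it that the
  commutator of \<open>c\<close> with a vector \<open>v\<close> is \<open>\<Sum> h(e\<^sup>i)\<^sub>* e\<^sub>i\<close> up to a vector, where \<open>h\<close> combines
  \<open>\<pi>(\<mu>(v, -))\<close> with the Jacobiator of \<open>\<phi>\<close>. This commutator vanishes for all \<open>v\<close> exactly if the
  antisymmetrisation of \<open>h\<close> does, which is the component in \<open>V\<close> of the Jacobi identity for three
  vectors of \<open>V\<close>; all other instances of the Jacobi identity hold automatically.

  It remains to see that \<open>c\<close> is a scalar if it commutes with \<open>V\<close>. The operator
  \<open>R(x) = \<Sum> [x, e\<^sup>i] e\<^sub>i\<close> multiplies \<open>\<pi>\<^sub>*(\<Omega>(g))\<close> and \<open>W = \<Sum> \<phi>(e\<^sup>i, -)\<^sub>* \<phi>(e\<^sub>i, -)\<^sub>*\<close> by \<open>8\<close> up to scalars,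
  and \<open>12 \<psi>\<^sup>2 = 4 W + R(\<psi>\<^sup>2)\<close>; with \<open>R(c) = 0\<close> this gives \<open>R(\<psi>\<^sup>2) = 8 \<psi>\<^sup>2\<close> and so \<open>8 c = 0\<close>, up to scalars.
\<close>

text \<open>Commuting with \<open>V\<close> does not by itself make an element of the Clifford
  algebra a scalar: for a trivial grading and \<open>dim V\<close> odd, the product of an orthogonal
  basis commutes with \<open>V\<close> too. Instead of describing the centraliser, the proof uses
  the special shape of \<open>c\<close>, whose summands satisfy linear equations under
  \<open>R\<close>; the 8 is twice the length 4 of the words in a product of two elements
  \<open>f\<^sub>*\<close>. Passing from a scalar \<open>c\<close> to the Jacobi identity requires
  in turn that a vector which vanishes in the Clifford algebra is 0, hence that this algebra is not
  trivial.

  The objects in (b) live in quotients of quotients and are picked by \<open>SOME\<close> or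
  \<open>THE\<close>. Existence and uniqueness have to be established for each of them before it can
  be computed. The computations themselves are transferred to a type of class \<open>ring\<close>,
  where ordinary ring rewriting applies.\<close>

lemma linear_map_simps:
  assumes "Vector_Spaces.linear s t f"
  shows linear_map_add: "f (x + y) = f x + f y"
    and linear_map_scale: "f (s c x) = t c (f x)"
    and linear_map_zero: "f 0 = 0"
    and linear_map_uminus: "f (- x) = - f x"
    and linear_map_diff: "f (x - y) = f x - f y"
    and linear_map_sum: "f (\<Sum>i\<in>A. g i) = (\<Sum>i\<in>A. f (g i))"
proof -
  interpret Vector_Spaces.linear s t f by fact
  show "f (x + y) = f x + f y" "f (s c x) = t c (f x)" "f 0 = 0" "f (- x) = - f x"
    "f (x - y) = f x - f y" "f (\<Sum>i\<in>A. g i) = (\<Sum>i\<in>A. f (g i))"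
    by (rule add scale zero neg diff sum)+
qed

section \<open>Quotients of the free algebra\<close>

lemma poly_mapping_sum_single:
  "(\<Sum>w\<in>Poly_Mapping.keys p. Poly_Mapping.single w (Poly_Mapping.lookup p w)) = p"
proof (rule poly_mapping_eqI)
  fix w
  show "Poly_Mapping.lookup (\<Sum>w\<in>Poly_Mapping.keys p. Poly_Mapping.single w (Poly_Mapping.lookup p
      w)) w = Poly_Mapping.lookup p w"
    by (simp add: lookup_sum lookup_single when_def sum.delta' in_keys_iff)
qed

lemma poly_mapping_induct_single [case_names zero add]:
  fixes p :: "'a \<Rightarrow>\<^sub>0 'b::comm_monoid_add"
  assumes "P 0" and "\<And>p w c. P p \<Longrightarrow> P (p + Poly_Mapping.single w c)"
  shows "P p"
proof -
  have "P (\<Sum>w\<in>A. Poly_Mapping.single w (Poly_Mapping.lookup p w))" if "finite A" for A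
    using that by (induction A) (simp_all add: assms add.commute[of "Poly_Mapping.single _ _"])
  from this[of "Poly_Mapping.keys p"] show ?thesis
    by (simp add: poly_mapping_sum_single)
qed

lemma single_mult_list:
  "Poly_Mapping.single a c * Poly_Mapping.single b d =
    (Poly_Mapping.single (a @ b) (c * d) :: 'v list \<Rightarrow>\<^sub>0 'k::field)"
  by (simp add: mult_single plus_list_def)

lemma single_Nil_one: "Poly_Mapping.single [] 1 = (1 :: 'v list \<Rightarrow>\<^sub>0 'k::field)"
  using single_one[where 'a = "'v list" and 'b = 'k] by (simp only: zero_list_def)

text \<open>Multiplication by a constant of the algebra, the shape in which
  \<open>quotient_scale\<close> acts on classes. With it the free algebra is a vector space, and
  subspaces and projections become available for ideals.\<close>

definition word_scale :: "'k::field \<Rightarrow> ('v list \<Rightarrow>\<^sub>0 'k) \<Rightarrow> ('v list \<Rightarrow>\<^sub>0 'k)" where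
  "word_scale c p = Poly_Mapping.single [] c * p"

lemma word_scale_single [simp]:
  "word_scale c (Poly_Mapping.single w d) = Poly_Mapping.single w (c * d)"
  by (simp add: word_scale_def single_mult_list)

lemma word_scale_mult_left: "word_scale c p * q = word_scale c (p * q)"
  by (simp add: word_scale_def mult.assoc)

lemma word_scale_mult_right:
  fixes p :: "'v list \<Rightarrow>\<^sub>0 'k::field"
  shows "p * word_scale c q = word_scale c (p * q)"
proof -
  have "p * Poly_Mapping.single [] c = Poly_Mapping.single [] c * p"
    by (induction p rule: poly_mapping_induct_single)
      (simp_all add: algebra_simps single_mult_list)
  then show ?thesis
    by (simp add: word_scale_def flip: mult.assoc)
qed

lemma word_scale_one: "word_scale c 1 = Poly_Mapping.single [] c"
  by (simp add: word_scale_def)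

lemma vector_space_word_scale: "vector_space word_scale"
  by unfold_locales
    (simp_all add: word_scale_def algebra_simps single_add single_Nil_one single_mult_list flip:
        mult.assoc)

interpretation words: vector_space "word_scale :: 'k::field \<Rightarrow> ('v list \<Rightarrow>\<^sub>0 'k) \<Rightarrow> _"
  by (rule vector_space_word_scale)

lemma lookup_word_scale: "Poly_Mapping.lookup (word_scale c p) w = c * Poly_Mapping.lookup p w"
  by (induction p rule: poly_mapping_induct_single)
    (simp_all add: words.scale_right_distrib lookup_add lookup_single when_def algebra_simps)

definition linear_extension ::
  "('k::field \<Rightarrow> 'm::ab_group_add \<Rightarrow> 'm) \<Rightarrow> ('v list \<Rightarrow> 'm) \<Rightarrow> ('v list \<Rightarrow>\<^sub>0 'k) \<Rightarrow> 'm" where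
  "linear_extension s h p = (\<Sum>w\<in>Poly_Mapping.keys p. s (Poly_Mapping.lookup p w) (h w))"

context vector_space
begin

lemma linear_extension_superset:
  assumes "finite A" "Poly_Mapping.keys p \<subseteq> A"
  shows "linear_extension scale h p = (\<Sum>w\<in>A. scale (Poly_Mapping.lookup p w) (h w))"
  unfolding linear_extension_def using assms
  by (intro sum.mono_neutral_left) (auto simp: in_keys_iff)

lemma linear_linear_extension: "Vector_Spaces.linear word_scale scale (linear_extension scale h)"
proof -
  have add: "linear_extension scale h (p + q) = linear_extension scale h p + linear_extension
      scale h q" for p q
  proof -
    let ?A = "Poly_Mapping.keys p \<union> Poly_Mapping.keys q"
    have "linear_extension scale h r = (\<Sum>w\<in>?A. scale (Poly_Mapping.lookup r w) (h w))"
      if "Poly_Mapping.keys r \<subseteq> ?A" for r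
      by (rule linear_extension_superset) (use that in auto)
    from this[of p] this[of q] this[of "p + q"] show ?thesis
      using Poly_Mapping.keys_add[of p q]
      by (simp add: lookup_add scale_left_distrib sum.distrib)
  qed
  have scale: "linear_extension scale h (word_scale c p) = scale c (linear_extension scale h p)" for c p
  proof -
    have "Poly_Mapping.keys (word_scale c p) \<subseteq> Poly_Mapping.keys p"
      by (auto simp: in_keys_iff lookup_word_scale)
    then show ?thesis
      by (simp add: linear_extension_superset[OF finite_keys] linear_extension_def[of scale h p]
          lookup_word_scale scale_sum_right)
  qed
  show ?thesis
    unfolding linear_iff using vector_space_axioms vector_space_word_scale add scale by blast
qed

lemma linear_extension_single [simp]:
  "linear_extension scale h (Poly_Mapping.single w c) = scale c (h w)"
  by (simp add: linear_extension_def)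

end

text \<open>The generated two-sided ideal, built by adding one product \<open>a g b\<close> with
  monomials \<open>a\<close>, \<open>b\<close> at a time. Unlike an intersection of ideals it has an
  induction rule, so that a linear map vanishes on it as soon as it vanishes on such products;
  \<open>word_ideal_eq_genideal\<close> identifies it with \<open>Idl\<close>.\<close>

inductive_set word_ideal :: "('v list \<Rightarrow>\<^sub>0 'k::field) set \<Rightarrow> ('v list \<Rightarrow>\<^sub>0 'k) set" for S where
  zero: "0 \<in> word_ideal S"
| step: "p \<in> word_ideal S \<Longrightarrow> g \<in> S \<Longrightarrow>
    p + Poly_Mapping.single a c * g * Poly_Mapping.single b d \<in> word_ideal S"

lemma word_ideal_add: "q \<in> word_ideal S \<Longrightarrow> p \<in> word_ideal S \<Longrightarrow> p + q \<in> word_ideal S"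
  by (induction rule: word_ideal.induct) (auto simp: add.assoc[symmetric] intro: word_ideal.step)

lemma word_ideal_mult_left:
  assumes "p \<in> word_ideal S"
  shows "r * p \<in> word_ideal S"
proof (induction r rule: poly_mapping_induct_single)
  case zero
  then show ?case by (simp add: word_ideal.zero)
next
  case (add r w x)
  have "Poly_Mapping.single w x * p \<in> word_ideal S"
    using assms
  proof (induction rule: word_ideal.induct)
    case zero
    then show ?case by (simp add: word_ideal.zero)
  next
    case (step p g a c b d)
    then show ?case
      using word_ideal.step[OF step.IH step.hyps(2), of "w @ a" "x * c" b d]
      by (simp add: distrib_left single_mult_list flip: mult.assoc)
  qed
  with add show ?case
    by (auto simp: distrib_right intro: word_ideal_add)
qed

lemma word_ideal_mult_right:
  assumes "p \<in> word_ideal S"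
  shows "p * r \<in> word_ideal S"
proof (induction r rule: poly_mapping_induct_single)
  case zero
  then show ?case by (simp add: word_ideal.zero)
next
  case (add r w x)
  have "p * Poly_Mapping.single w x \<in> word_ideal S"
    using assms
  proof (induction rule: word_ideal.induct)
    case zero
    then show ?case by (simp add: word_ideal.zero)
  next
    case (step p g a c b d)
    then show ?case
      using word_ideal.step[OF step.IH step.hyps(2), of a c "b @ w" "d * x"]
      by (simp add: distrib_right single_mult_list mult.assoc)
  qed
  with add show ?case
    by (auto simp: distrib_left intro: word_ideal_add)
qed

lemma word_ideal_uminus: "p \<in> word_ideal S \<Longrightarrow> - p \<in> word_ideal S"
  using word_ideal_mult_left[of p S "- 1"] by simp

lemma word_ideal_diff: "p \<in> word_ideal S \<Longrightarrow> q \<in> word_ideal S \<Longrightarrow> p - q \<in> word_ideal S"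
  using word_ideal_add[of "- q" S p] word_ideal_uminus[of q S] by simp

lemma word_ideal_base: "g \<in> S \<Longrightarrow> g \<in> word_ideal S"
  using word_ideal.step[OF word_ideal.zero, of g S "[]" 1 "[]" 1] by (simp add: single_Nil_one)

lemma word_ideal_scale: "p \<in> word_ideal S \<Longrightarrow> word_scale c p \<in> word_ideal S"
  by (simp add: word_scale_def word_ideal_mult_left)

lemma subspace_word_ideal: "words.subspace (word_ideal S)"
  by (simp add: words.subspace_def word_ideal.zero word_ideal_add word_ideal_scale)

lemma linear_vanishes_on_word_ideal:
  assumes L: "Vector_Spaces.linear word_scale s L"
    and gen: "\<And>g a b. g \<in> S \<Longrightarrow> L (Poly_Mapping.single a 1 * g * Poly_Mapping.single b 1) = 0"
    and p: "p \<in> word_ideal S"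
  shows "L p = 0"
  using p
proof (induction rule: word_ideal.induct)
  case zero
  show ?case by (rule linear_map_zero[OF L])
next
  case (step p g a c b d)
  have "Poly_Mapping.single a c * g * Poly_Mapping.single b d =
      word_scale (c * d) (Poly_Mapping.single a 1 * g * Poly_Mapping.single b 1)"
    by (metis (no_types) mult.right_neutral word_scale_mult_left word_scale_mult_right word_scale_single
        words.scale_scale)
  then show ?case
    using step gen linear_map_scale[OF L, of "c * d" 0]
    by (simp add: linear_map_add[OF L] linear_map_scale[OF L] linear_map_zero[OF L])
qed

lemma ring_free_algebra: "ring (free_algebra :: ('v list \<Rightarrow>\<^sub>0 'k::field) ring)"
proof (rule ringI)
  show "abelian_group (free_algebra :: ('v list \<Rightarrow>\<^sub>0 'k::field) ring)"
  proof (rule abelian_groupI)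
    show "\<exists>y\<in>carrier free_algebra. y \<oplus>\<^bsub>free_algebra\<^esub> x = \<zero>\<^bsub>free_algebra\<^esub>"
      if "x \<in> carrier free_algebra" for x :: "'v list \<Rightarrow>\<^sub>0 'k"
      by (rule bexI[of _ "- x"]) (simp_all add: free_algebra_def)
  qed (simp_all add: free_algebra_def add_ac)
  show "Group.monoid (free_algebra :: ('v list \<Rightarrow>\<^sub>0 'k::field) ring)"
    by (rule monoidI) (simp_all add: free_algebra_def mult.assoc)
qed (simp_all add: free_algebra_def algebra_simps)

interpretation free_algebra: ring "free_algebra :: ('v list \<Rightarrow>\<^sub>0 'k::field) ring"
  by (rule ring_free_algebra)

lemma free_algebra_simps [simp]:
  "carrier free_algebra = UNIV" "x \<otimes>\<^bsub>free_algebra\<^esub> y = x * y" "x \<oplus>\<^bsub>free_algebra\<^esub> y = x + y"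
  "\<one>\<^bsub>free_algebra\<^esub> = 1" "\<zero>\<^bsub>free_algebra\<^esub> = 0"
  by (simp_all add: free_algebra_def)

lemma free_algebra_uminus [simp]: "\<ominus>\<^bsub>free_algebra\<^esub> x = - x"
  by (rule free_algebra.minus_equality) simp_all

lemma free_algebra_minus [simp]: "x \<ominus>\<^bsub>free_algebra\<^esub> y = x - y"
  by (simp add: a_minus_def)

lemma ideal_word_ideal: "ideal (word_ideal S) free_algebra"
proof (rule idealI[OF ring_free_algebra])
  show "subgroup (word_ideal S) (add_monoid free_algebra)"
    by (rule free_algebra.add.subgroupI)
      (auto simp: word_ideal.zero word_ideal_add word_ideal_uminus
        simp flip: a_inv_def intro: word_ideal.zero)
qed (simp_all add: word_ideal_mult_left word_ideal_mult_right)

lemma word_ideal_eq_genideal: "word_ideal S = Idl\<^bsub>free_algebra\<^esub> S"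
proof
  interpret I: ideal "Idl\<^bsub>free_algebra\<^esub> S" free_algebra
    by (rule free_algebra.genideal_ideal) simp
  show "word_ideal S \<subseteq> Idl\<^bsub>free_algebra\<^esub> S"
  proof
    fix p assume "p \<in> word_ideal S"
    then show "p \<in> Idl\<^bsub>free_algebra\<^esub> S"
    proof (induction rule: word_ideal.induct)
      case zero
      show ?case using I.zero_closed by simp
    next
      case (step p g a c b d)
      have "g \<in> Idl\<^bsub>free_algebra\<^esub> S"
        using free_algebra.genideal_self[of S] step.hyps by auto
      with step.IH show ?case
        using I.I_l_closed[of g "Poly_Mapping.single a c"]
          I.I_r_closed[of "Poly_Mapping.single a c * g" "Poly_Mapping.single b d"] I.a_closed by simp
    qed
  qed
  show "Idl\<^bsub>free_algebra\<^esub> S \<subseteq> word_ideal S"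
    by (rule free_algebra.genideal_minimal[OF ideal_word_ideal]) (auto intro: word_ideal_base)
qed

definition linear_relations :: "('k::field \<Rightarrow> 'v::ab_group_add \<Rightarrow> 'v) \<Rightarrow> ('v list \<Rightarrow>\<^sub>0 'k) set" where
  "linear_relations s =
     {Poly_Mapping.single [v + w] 1 - Poly_Mapping.single [v] 1 - Poly_Mapping.single [w] 1 | v w.
         True} \<union>
     {Poly_Mapping.single [s c v] 1 - Poly_Mapping.single [v] c | c v. True}"

lemma tensor_ideal_eq: "tensor_ideal s = word_ideal (linear_relations s)"
  by (simp add: tensor_ideal_def linear_relations_def word_ideal_eq_genideal)

lemma ideal_tensor_ideal: "ideal (tensor_ideal s) free_algebra"
  by (simp add: tensor_ideal_eq ideal_word_ideal)

lemma ring_tensor_algebra: "ring (tensor_algebra s)"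
  unfolding tensor_algebra_def by (rule ideal.quotient_is_ring[OF ideal_tensor_ideal])

lemma tensor_class_hom: "tensor_class s \<in> ring_hom free_algebra (tensor_algebra s)"
  using ideal.rcos_ring_hom[OF ideal_tensor_ideal[of s]]
  by (simp add: tensor_algebra_def tensor_class_def[abs_def])

lemma tensor_class_eq_iff: "tensor_class s p = tensor_class s q \<longleftrightarrow> p - q \<in> tensor_ideal s"
  using free_algebra.quotient_eq_iff_same_a_r_cos[OF ideal_tensor_ideal, of p q s]
  by (simp add: tensor_class_def)

lemma carrier_tensor_algebra: "carrier (tensor_algebra s) = range (tensor_class s)"
  by (auto simp: tensor_algebra_def FactRing_def A_RCOSETS_def RCOSETS_def a_r_coset_def
      tensor_class_def)

lemma ideal_relation_ideal: "ideal (relation_ideal s R) (tensor_algebra s)"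
  unfolding relation_ideal_def
  by (rule ring.genideal_ideal[OF ring_tensor_algebra]) (auto simp: carrier_tensor_algebra)

lemma ring_quotient_algebra: "ring (quotient_algebra s R)"
  unfolding quotient_algebra_def by (rule ideal.quotient_is_ring[OF ideal_relation_ideal])

lemma quotient_class_hom: "quotient_class s R \<in> ring_hom free_algebra (quotient_algebra s R)"
  using ring_hom_trans[OF tensor_class_hom ideal.rcos_ring_hom[OF ideal_relation_ideal[of s R]]]
  by (simp add: quotient_algebra_def quotient_class_def[abs_def] comp_def)

lemma quotient_class_add:
  "quotient_class s R (p + q) = quotient_class s R p \<oplus>\<^bsub>quotient_algebra s R\<^esub> quotient_class s R q"
  using ring_hom_add[OF quotient_class_hom, of p q] by simp

lemma quotient_class_mult:
  "quotient_class s R (p * q) = quotient_class s R p \<otimes>\<^bsub>quotient_algebra s R\<^esub> quotient_class s R q"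
  using ring_hom_mult[OF quotient_class_hom, of p q] by simp

lemma quotient_class_one: "quotient_class s R 1 = \<one>\<^bsub>quotient_algebra s R\<^esub>"
  using ring_hom_one[OF quotient_class_hom] by simp

lemma carrier_quotient_algebra: "carrier (quotient_algebra s R) = range (quotient_class s R)"
proof -
  have "carrier (quotient_algebra s R) =
      (\<lambda>t. relation_ideal s R +>\<^bsub>tensor_algebra s\<^esub> t) ` carrier (tensor_algebra s)"
    by (auto simp: quotient_algebra_def FactRing_def A_RCOSETS_def RCOSETS_def a_r_coset_def)
  then show ?thesis
    by (simp add: carrier_tensor_algebra image_image quotient_class_def)
qed

text \<open>By the third isomorphism theorem the two successive quotients amount to a single
  quotient of the free algebra by all relations together. Every equation between classes thereby
  becomes a membership in a \<open>word_ideal\<close>.\<close>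

lemma quotient_class_eq_iff:
  "quotient_class s R p = quotient_class s R q \<longleftrightarrow> p - q \<in> word_ideal (linear_relations s \<union> R)"
proof -
  let ?I = "word_ideal (linear_relations s \<union> R)"
  have T: "tensor_ideal s \<subseteq> ?I"
    unfolding tensor_ideal_eq word_ideal_eq_genideal[of "linear_relations s"]
    by (rule free_algebra.genideal_minimal[OF ideal_word_ideal]) (auto intro: word_ideal_base)
  have sub: "tensor_class s r \<in> relation_ideal s R" if "r \<in> ?I" for r
    using that
  proof (induction rule: word_ideal.induct)
    case zero
    interpret ideal "relation_ideal s R" "tensor_algebra s" by (rule ideal_relation_ideal)
    show ?case
      using ring_hom_zero[OF tensor_class_hom ring_free_algebra ring_tensor_algebra, of s] zero_closed
      by simp
  next
    case (step r g a c b d)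
    interpret J: ideal "relation_ideal s R" "tensor_algebra s" by (rule ideal_relation_ideal)
    have "tensor_class s g \<in> relation_ideal s R"
    proof (cases "g \<in> linear_relations s")
      case True
      then have "tensor_class s g = tensor_class s 0"
        by (simp add: tensor_class_eq_iff tensor_ideal_eq word_ideal_base)
      then show ?thesis
        using ring_hom_zero[OF tensor_class_hom ring_free_algebra ring_tensor_algebra, of s]
            J.zero_closed
        by simp
    next
      case False
      with step.hyps show ?thesis
        unfolding relation_ideal_def
        using ring.genideal_self[OF ring_tensor_algebra, of "tensor_class s ` R" s]
        by (auto simp: carrier_tensor_algebra)
    qed
    then show ?case
      using step.IH ring_hom_add[OF tensor_class_hom[of s]] ring_hom_mult[OF tensor_class_hom[of s]]
      by (simp add: J.I_l_closed J.I_r_closed carrier_tensor_algebra)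
  qed
  \<comment> \<open>The image of an ideal under the surjective \<open>tensor_class s\<close> is an
    ideal, and this one contains the generators of \<open>relation_ideal s R\<close>.\<close>
  have sup: "relation_ideal s R \<subseteq> tensor_class s ` ?I"
    unfolding relation_ideal_def
  proof (rule ring.genideal_minimal[OF ring_tensor_algebra])
    show "tensor_class s ` R \<subseteq> tensor_class s ` ?I"
      by (auto intro: word_ideal_base)
    interpret ring_hom_ring free_algebra "tensor_algebra s" "tensor_class s"
      by (rule ring_hom_ringI2[OF ring_free_algebra ring_tensor_algebra tensor_class_hom])
    show "ideal (tensor_class s ` ?I) (tensor_algebra s)"
    proof (rule idealI[OF ring_tensor_algebra])
      show "subgroup (tensor_class s ` ?I) (add_monoid (tensor_algebra s))"
      proof (rule S.add.subgroupI)
        show "\<ominus>\<^bsub>tensor_algebra s\<^esub> a \<in> tensor_class s ` ?I"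
          if "a \<in> tensor_class s ` ?I" for a
        proof -
          from that obtain r where r: "r \<in> ?I" "a = tensor_class s r" by blast
          have "\<ominus>\<^bsub>tensor_algebra s\<^esub> tensor_class s r = tensor_class s (- r)"
            using hom_a_inv[of r] by simp
          then show ?thesis using r by (simp add: word_ideal_uminus)
        qed
        show "a \<oplus>\<^bsub>tensor_algebra s\<^esub> b \<in> tensor_class s ` ?I"
          if "a \<in> tensor_class s ` ?I" "b \<in> tensor_class s ` ?I" for a b
          using that hom_add by (auto simp flip: hom_add intro!: imageI word_ideal_add)
      qed (auto simp: carrier_tensor_algebra intro: word_ideal.zero)
      show "x \<otimes>\<^bsub>tensor_algebra s\<^esub> a \<in> tensor_class s ` ?I"
        if "a \<in> tensor_class s ` ?I" "x \<in> carrier (tensor_algebra s)" for a x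
        using that by (auto simp: carrier_tensor_algebra simp flip: hom_mult intro:
            word_ideal_mult_left)
      show "a \<otimes>\<^bsub>tensor_algebra s\<^esub> x \<in> tensor_class s ` ?I"
        if "a \<in> tensor_class s ` ?I" "x \<in> carrier (tensor_algebra s)" for a x
        using that by (auto simp: carrier_tensor_algebra simp flip: hom_mult intro:
            word_ideal_mult_right)
    qed
  qed
  \<comment> \<open>\<open>?I\<close> contains the kernel of \<open>tensor_class s\<close>, so
    membership can be tested on any representative.\<close>
  have mem: "tensor_class s r \<in> relation_ideal s R \<longleftrightarrow> r \<in> ?I" for r
  proof
    assume "tensor_class s r \<in> relation_ideal s R"
    with sup obtain i where "i \<in> ?I" "tensor_class s r = tensor_class s i" by auto
    then have "r - i \<in> ?I" using T by (auto simp: tensor_class_eq_iff)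
    with word_ideal_add[OF \<open>i \<in> ?I\<close> this] show "r \<in> ?I" by simp
  qed (rule sub)
  interpret ring_hom_ring free_algebra "tensor_algebra s" "tensor_class s"
    by (rule ring_hom_ringI2[OF ring_free_algebra ring_tensor_algebra tensor_class_hom])
  have "tensor_class s p \<ominus>\<^bsub>tensor_algebra s\<^esub> tensor_class s q = tensor_class s (p - q)"
    using hom_add[of p "- q"] hom_a_inv[of q] by (simp add: a_minus_def)
  then show ?thesis
    using ring.quotient_eq_iff_same_a_r_cos[OF ring_tensor_algebra ideal_relation_ideal,
        of "tensor_class s p" s "tensor_class s q" R] mem
    by (simp add: quotient_class_def carrier_tensor_algebra)
qed

lemma quotient_scale_class:
  "quotient_scale s R c (quotient_class s R p) = quotient_class s R (word_scale c p)"
  by (simp add: quotient_scale_def word_scale_def quotient_class_mult)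

section \<open>Homogeneous dual bases\<close>

context commutation_factor
begin

lemma eps_nonzero: "eps a b \<noteq> 0"
  using eps_inverse[of a b] by auto

lemma eps_zero_left [simp]: "eps 0 a = 1"
  using eps_add_left[of 0 0 a] eps_nonzero[of 0 a] by simp

lemma eps_zero_right [simp]: "eps a 0 = 1"
  using eps_add_right[of a 0 0] eps_nonzero[of a 0] by simp

text \<open>The inverse of \<open>eps a b\<close> is \<open>eps b a\<close>; a negated degree
  therefore only exchanges the arguments, and sign computations never involve division.\<close>

lemma eps_minus_left [simp]: "eps (- a) b = eps b a"
proof -
  have "eps (- a) b * eps a b = eps b a * eps a b"
    using eps_add_left[of "- a" a b] eps_inverse[of b a] by simp
  then show ?thesis using eps_nonzero[of a b] by simp
qed

lemma eps_minus_right [simp]: "eps a (- b) = eps b a"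
proof -
  have "eps a (- b) * eps a b = eps b a * eps a b"
    using eps_add_right[of a "- b" b] eps_inverse[of b a] by simp
  then show ?thesis using eps_nonzero[of a b] by simp
qed

lemma eps_diff_left: "eps (a - b) c = eps a c * eps c b"
  using eps_add_left[of a "- b" c] by simp

lemma eps_diff_right: "eps a (b - c) = eps a b * eps c a"
  using eps_add_right[of a b "- c"] by simp

lemma eps_cancel: "eps a b * (eps b a * x) = x" "eps a b * (x * eps b a) = x"
  by (simp add: eps_inverse flip: mult.assoc) (simp add: eps_inverse mult.left_commute[of _ x])

lemmas eps_simps = eps_add_left eps_add_right eps_diff_left eps_diff_right

end

locale eps_symmetric_basis = eps_symmetric_space eps scale V form
  for eps :: "'c::ab_group_add \<Rightarrow> 'c \<Rightarrow> 'k::field"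
    and scale :: "'k \<Rightarrow> 'v::ab_group_add \<Rightarrow> 'v"
    and V :: "'c \<Rightarrow> 'v set"
    and form :: "'v \<Rightarrow> 'v \<Rightarrow> 'k" +
  fixes E :: "'v set"
  assumes fin_dim: "finite_dim scale"
    and hom_basis: "homogeneous_basis scale V E"
begin

lemma independent_E: "independent E" and span_E: "span E = UNIV"
  using hom_basis by (simp_all add: homogeneous_basis_def)

lemma finite_E: "finite E"
  using fin_dim independent_span_bound[OF _ independent_E] by (auto simp: finite_dim_def)

sublocale fd: finite_dimensional_vector_space scale E
  by unfold_locales (simp_all add: finite_E independent_E span_E)

definition dg :: "'v \<Rightarrow> 'c" where "dg e = (SOME a. e \<in> V a)"

lemma dg: "e \<in> E \<Longrightarrow> e \<in> V (dg e)"
  unfolding dg_def using hom_basis by (auto simp: homogeneous_basis_def intro: someI_ex)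

lemma linear_form_right: "Vector_Spaces.linear scale (*) (form v)"
  and linear_form_left: "Vector_Spaces.linear scale (*) (\<lambda>v. form v w)"
  using form_bilinear by (simp_all add: bilinear_map_def)

lemmas form_right = linear_map_simps[OF linear_form_right]
lemmas form_left = linear_map_simps[OF linear_form_left]

text \<open>Where the form does not vanish the degrees are opposite. Next to a factor
  \<open>form v w\<close>, any expression in the degree \<open>a\<close> may thus be read at
  \<open>- b\<close>.\<close>

lemma form_eps:
  assumes "v \<in> V a" "w \<in> V b"
  shows "form v w * f a = form v w * f (- b)"
  using form_degree[OF assms] add_eq_0_iff2[of a b] by (cases "form v w = 0") auto

lemma comp_sum: "(\<And>i. i \<in> A \<Longrightarrow> f i \<in> V a) \<Longrightarrow> sum f A \<in> V a"
  by (rule subspace_sum[OF subspace_comp])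

lemma comp_scale: "v \<in> V a \<Longrightarrow> scale c v \<in> V a"
  by (rule subspace_scale[OF subspace_comp])

abbreviation dual :: "'v \<Rightarrow> 'v" where "dual \<equiv> dual_vector form E"

lemma form_determined:
  assumes "\<And>e. e \<in> E \<Longrightarrow> form e w = form e w'"
  shows "w = w'"
proof -
  have "form v (w - w') = 0" for v
    by (rule span_induct[of v E "\<lambda>v. form v (w - w') = 0"])
      (simp_all add: span_E subspace_def form_left form_right assms)
  from form_nondegenerate_right[OF this] show ?thesis by simp
qed

text \<open>The values \<open>form e w\<close> are the coordinates of \<open>?T w\<close>, so
  non-degeneracy makes \<open>?T\<close> injective and finite dimension makes it surjective; a
  preimage of \<open>f\<close> is the vector sought.\<close>

lemma form_dual: 
  assumes "e \<in> E" "f \<in> E"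
  shows "form e (dual f) = (if e = f then 1 else 0)"
proof -
  let ?T = "\<lambda>w. \<Sum>e\<in>E. scale (form e w) e"
  have lin: "Vector_Spaces.linear scale scale ?T"
    by unfold_locales
      (simp_all add: form_right scale_left_distrib sum.distrib scale_sum_right)
  have coord: "form e w = c e" if "?T w = (\<Sum>e\<in>E. scale (c e) e)" "e \<in> E" for w c e
  proof -
    have "(\<Sum>e\<in>E. scale (form e w - c e) e) = 0"
      using that by (simp add: scale_left_diff_distrib sum_subtractf)
    from independentD[OF independent_E finite_E order_refl this \<open>e \<in> E\<close>] show ?thesis by simp
  qed
  have "inj ?T"
  proof (rule injI)
    fix w w' assume "?T w = ?T w'"
    from coord[OF this] show "w = w'" by (rule form_determined)
  qed
  then have "surj ?T" by (rule fd.linear_inj_imp_surj[OF lin])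
  then obtain w where "f = ?T w" by (rule surjE)
  then have "?T w = f" by (rule sym)
  also have "f = (\<Sum>e\<in>E. scale (if e = f then 1 else 0) e)"
    using finite_E \<open>f \<in> E\<close> by (simp add: if_distrib[of "\<lambda>c. scale c _"] cong: if_cong)
  finally have T: "?T w = (\<Sum>e\<in>E. scale (if e = f then 1 else 0) e)" .
  have w: "\<forall>e\<in>E. form e w = (if e = f then 1 else 0)"
    using coord[OF T] by simp
  then have "dual f = w"
    unfolding dual_vector_def
  proof (rule the_equality)
    fix w' assume "\<forall>e\<in>E. form e w' = (if e = f then 1 else 0)"
    with w show "w' = w" by (intro form_determined) simp
  qed
  then show ?thesis using w \<open>e \<in> E\<close> by simp
qed

lemma expand_basis: "(\<Sum>e\<in>E. scale (form v (dual e)) e) = v"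
proof -
  let ?r = "representation E v"
  have v: "(\<Sum>e\<in>E. scale (?r e) e) = v"
    by (rule sum_representation_eq) (simp_all add: independent_E span_E finite_E)
  have "form v (dual e) = ?r e" if "e \<in> E" for e
  proof -
    have "form v (dual e) = (\<Sum>f\<in>E. ?r f * form f (dual e))"
      by (subst v[symmetric]) (simp add: form_left)
    also have "\<dots> = ?r e"
      using that finite_E by (simp add: form_dual if_distrib[of "\<lambda>c. _ * c"] cong: if_cong)
    finally show ?thesis .
  qed
  then show ?thesis using v by simp
qed

lemma expand_dual: "(\<Sum>e\<in>E. scale (form e v) (dual e)) = v"
proof (rule form_determined)
  fix e assume "e \<in> E"
  then show "form e (\<Sum>e\<in>E. scale (form e v) (dual e)) = form e v"
    using finite_E by (simp add: form_right form_dual if_distrib[of "\<lambda>c. _ * c"] cong: if_cong)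
qed

text \<open>Since the form pairs opposite degrees only, dropping all terms of \<open>dual e\<close>
  outside degree \<open>- dg e\<close> changes none of its pairings with the basis. By
  non-degeneracy nothing has been dropped.\<close>

lemma dual_degree:
  assumes e: "e \<in> E"
  shows "dual e \<in> V (- dg e)"
proof -
  let ?c = "\<lambda>f. form (dual e) (dual f)"
  let ?E = "{f \<in> E. dg f = - dg e}"
  let ?w = "\<Sum>f\<in>?E. scale (?c f) f"
  have "form e' ?w = form e' (dual e)" if e': "e' \<in> E" for e'
  proof (cases "dg e' = dg e")
    case True
    have "form e' (\<Sum>f\<in>E. scale (?c f) f) = form e' ?w"
      unfolding form_right
    proof (rule sum.mono_neutral_right[OF finite_E])
      show "\<forall>f\<in>E - ?E. ?c f * form e' f = 0"
      proof
        fix f assume f: "f \<in> E - ?E"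
        then have "dg e' + dg f \<noteq> 0" using True by (auto simp: add_eq_0_iff)
        then show "?c f * form e' f = 0"
          using form_degree[OF dg[OF e'] dg[of f]] f by simp
      qed
    qed auto
    then show ?thesis by (simp add: expand_basis)
  next
    case False
    have "form e' f = 0" if f: "f \<in> ?E" for f
      by (rule form_degree[OF dg[OF e'] dg[of f]]) (use f False in auto)
    moreover have "form e' (dual e) = 0" using form_dual[OF e' e] False by auto
    ultimately show ?thesis by (simp add: form_right)
  qed
  then have "?w = dual e" by (rule form_determined)
  moreover have "?w \<in> V (- dg e)"
    by (rule comp_sum, rule comp_scale) (metis (mono_tags) dg mem_Collect_eq)
  ultimately show ?thesis by simp
qed

lemma linear_zero_on_comp:
  assumes L: "Vector_Spaces.linear scale t L" and v: "v \<in> V a"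
    and zero: "\<And>e. e \<in> E \<Longrightarrow> dg e = - a \<Longrightarrow> L (dual e) = 0"
  shows "L v = 0"
proof -
  have "L (scale (form e v) (dual e)) = 0" if e: "e \<in> E" for e
  proof (cases "dg e = - a")
    case True
    then show ?thesis
      using zero[OF e] linear_map_scale[OF L, of "form e v" 0]
      by (simp add: linear_map_scale[OF L] linear_map_zero[OF L])
  next
    case False
    then have "form e v = 0"
      by (intro form_degree[OF dg[OF e] v]) (simp add: add_eq_0_iff2)
    then show ?thesis by (simp add: linear_map_zero[OF L])
  qed
  then have "L (\<Sum>e\<in>E. scale (form e v) (dual e)) = 0" by (simp add: linear_map_sum[OF L])
  then show ?thesis by (simp add: expand_dual)
qed

text \<open>This is the invariance of the canonical tensor, the sum of
  \<open>dual e \<otimes> e\<close>: because \<open>f\<close> is skew for the form, its actions on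
  the two legs cancel.\<close>

lemma move_so:
  assumes \<beta>: "bilinear_map scale scale t \<beta>" and f: "f \<in> so_comp eps scale V form a"
  shows "(\<Sum>e\<in>E. \<beta> (f (dual e)) e) = - (\<Sum>e\<in>E. t (eps (dg e) a) (\<beta> (dual e) (f e)))"
proof -
  have l: "\<And>w. Vector_Spaces.linear scale t (\<lambda>v. \<beta> v w)" and r: "\<And>v. Vector_Spaces.linear scale t (\<beta> v)"
    using \<beta> by (simp_all add: bilinear_map_def)
  interpret t: vector_space t using Vector_Spaces.linear.axioms(2)[OF r] .
  have adj: "form g (f w) = - eps (dg g) a * form (f g) w" if "g \<in> E" for g w
  proof -
    have "form (f g) w + eps a (dg g) * form g (f w) = 0"
      using f dg[OF that] by (simp add: so_comp_def)
    then show ?thesis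
      using eps_cancel(1)[of "dg g" a "form g (f w)"] by (simp add: add_eq_0_iff2)
  qed
  have "(\<Sum>e\<in>E. \<beta> (f (dual e)) e) = (\<Sum>e\<in>E. \<beta> (\<Sum>g\<in>E. scale (form g (f (dual e))) (dual g)) e)"
    by (simp add: expand_dual)
  also have "\<dots> = (\<Sum>e\<in>E. \<Sum>g\<in>E. t (form g (f (dual e))) (\<beta> (dual g) e))"
    by (simp add: linear_map_simps[OF l])
  also have "\<dots> = (\<Sum>g\<in>E. \<Sum>e\<in>E. t (form g (f (dual e))) (\<beta> (dual g) e))"
    by (rule sum.swap)
  also have "\<dots> = (\<Sum>g\<in>E. - t (eps (dg g) a) (\<beta> (dual g) (\<Sum>e\<in>E. scale (form (f g) (dual e)) e)))"
    by (intro sum.cong refl) (simp add: linear_map_simps[OF r] t.scale_sum_right adj sum_negf)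
  finally show ?thesis by (simp add: expand_basis sum_negf)
qed

text \<open>The canonical tensor inherits \<epsilon>-symmetry from the form. The sign has equal
  arguments because \<open>form (dual g) (dual e)\<close> vanishes unless the degrees of
  \<open>e\<close> and \<open>g\<close> are opposite.\<close>

lemma symmetric_dual_tensor:
  assumes \<beta>: "bilinear_map scale scale t \<beta>"
  shows "(\<Sum>e\<in>E. t (eps (dg e) (dg e)) (\<beta> e (dual e))) = (\<Sum>e\<in>E. \<beta> (dual e) e)"
proof -
  have l: "\<And>w. Vector_Spaces.linear scale t (\<lambda>v. \<beta> v w)" and r: "\<And>v. Vector_Spaces.linear scale t (\<beta> v)"
    using \<beta> by (simp_all add: bilinear_map_def)
  interpret t: vector_space t using Vector_Spaces.linear.axioms(2)[OF r] .
  have c: "eps (dg g) (dg g) * form (dual g) (dual e) = form (dual e) (dual g)"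
    if "e \<in> E" "g \<in> E" for e g
  proof -
    have "form (dual e) (dual g) = eps (dg e) (dg g) * form (dual g) (dual e)"
      using form_symmetric[OF dual_degree[OF that(1)] dual_degree[OF that(2)]]
      by (simp only: eps_minus_left eps_minus_right)
    moreover have "form (dual g) (dual e) * eps (dg g) (dg g) = form (dual g) (dual e) * eps (dg
        e) (dg g)"
      using form_eps[OF dual_degree[OF that(2)] dual_degree[OF that(1)], of "\<lambda>x. eps x (dg g)"]
      by (simp only: eps_minus_left eps_minus_right)
    ultimately show ?thesis by (simp only: mult.commute)
  qed
  have "(\<Sum>e\<in>E. \<beta> (dual e) e) = (\<Sum>e\<in>E. \<beta> (\<Sum>g\<in>E. scale (form (dual e) (dual g)) g) e)"
    by (simp add: expand_basis)
  also have "\<dots> = (\<Sum>e\<in>E. \<Sum>g\<in>E. t (form (dual e) (dual g)) (\<beta> g e))"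
    by (simp add: linear_map_simps[OF l])
  also have "\<dots> = (\<Sum>g\<in>E. \<Sum>e\<in>E. t (form (dual e) (dual g)) (\<beta> g e))"
    by (rule sum.swap)
  also have "\<dots> = (\<Sum>g\<in>E. t (eps (dg g) (dg g)) (\<beta> g (\<Sum>e\<in>E. scale (form (dual g) (dual e)) e)))"
    by (intro sum.cong refl) (simp add: linear_map_simps[OF r] t.scale_sum_right c)
  finally show ?thesis by (simp add: expand_basis)
qed

lemma eq_on_dual_form:
  assumes "\<And>e. e \<in> E \<Longrightarrow> form v (dual e) = form w (dual e)"
  shows "v = w"
proof -
  have "(\<Sum>e\<in>E. scale (form v (dual e)) e) = (\<Sum>e\<in>E. scale (form w (dual e)) e)"
    by (rule sum.cong) (simp_all add: assms)
  then show ?thesis by (simp only: expand_basis)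
qed

end

section \<open>Computations in the Clifford algebra\<close>

text \<open>
  The ring need not be unital, and \<open>u\<close> plays the part of the unit of the Clifford algebra: the
  quotient algebra will be realised inside a ring of endomorphisms of a larger space, where its
  unit becomes a projection.
\<close>

locale clifford_model = eps_symmetric_basis eps sv V form E
  for eps :: "'c::ab_group_add \<Rightarrow> 'c \<Rightarrow> 'k::field"
    and sv :: "'k \<Rightarrow> 'v::ab_group_add \<Rightarrow> 'v"
    and V :: "'c \<Rightarrow> 'v set"
    and form :: "'v \<Rightarrow> 'v \<Rightarrow> 'k"
    and E :: "'v set" +
  fixes sc :: "'k \<Rightarrow> 'r::ring \<Rightarrow> 'r" and u :: 'r and io :: "'v \<Rightarrow> 'r"
  assumes sc_vector_space: "vector_space sc"
    and sc_mult_left: "sc c x * y = sc c (x * y)"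
    and sc_mult_right: "x * sc c y = sc c (x * y)"
    and linear_io: "Vector_Spaces.linear sv sc io"
    and unit_io: "u * io v = io v" "io v * u = io v"
    and clifford: "\<lbrakk>v \<in> V a; w \<in> V b\<rbrakk> \<Longrightarrow>
      io v * io w + sc (eps a b) (io w * io v) = sc (2 * form v w) u"
    and two_nonzero: "(2::'k) \<noteq> 0"
    and three_nonzero: "(3::'k) \<noteq> 0"
begin

sublocale A: vector_space sc
  by (rule sc_vector_space)

lemmas io = linear_map_simps[OF linear_io]
lemmas sc_mult = sc_mult_left sc_mult_right
lemmas sc_ring = sc_mult A.scale_right_distrib A.scale_right_diff_distrib A.scale_minus_right

lemma four_nonzero: "(4::'k) \<noteq> 0"
proof -
  have "(4::'k) = 2 * 2" by simp
  then show ?thesis using two_nonzero by (metis mult_eq_0_iff)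
qed

lemma clifford_swap:
  assumes "v \<in> V a" "w \<in> V b"
  shows "io v * io w = sc (2 * form v w) u - sc (eps a b) (io w * io v)"
  using clifford[OF assms] by (simp add: eq_diff_eq)

lemma soD:
  assumes "f \<in> so_comp eps sv V form a"
  shows so_linear: "Vector_Spaces.linear sv sv f"
    and so_degree: "v \<in> V b \<Longrightarrow> f v \<in> V (a + b)"
    and so_form: "v \<in> V b \<Longrightarrow> form (f v) w = - eps a b * form v (f w)"
  using assms by (auto simp: so_comp_def add_eq_0_iff2)

lemma so_degree_dual:
  "f \<in> so_comp eps sv V form a \<Longrightarrow> e \<in> E \<Longrightarrow> f (dual e) \<in> V (a - dg e)"
  using so_degree[OF _ dual_degree[of e], of f a] by simp

section \<open>Quadratic elements of the Clifford algebra and the operator \<open>R\<close>\<close>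

definition star :: "('v \<Rightarrow> 'v) \<Rightarrow> 'r" where
  "star f = sc (1 / 4) (\<Sum>e\<in>E. io (f (dual e)) * io e)"

lemma four_star: "(\<Sum>e\<in>E. io (f (dual e)) * io e) = sc 4 (star f)"
  using four_nonzero by (simp add: star_def)

lemma star_add: "star (\<lambda>v. f v + g v) = star f + star g"
  by (simp add: star_def io distrib_right sum.distrib A.scale_right_distrib)

lemma star_scale: "star (\<lambda>v. sv c (f v)) = sc c (star f)"
  by (simp add: star_def io sc_mult A.scale_sum_right mult.commute)

lemma star_diff: "star (\<lambda>v. f v - g v) = star f - star g"
  by (simp add: star_def io left_diff_distrib sum_subtractf A.scale_right_diff_distrib)

lemma linear_star:
  assumes "\<And>v. Vector_Spaces.linear s sv (\<lambda>x. f x v)"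
  shows "Vector_Spaces.linear s sc (\<lambda>x. star (f x))"
proof -
  interpret s: vector_space s using Vector_Spaces.linear.axioms(1)[OF assms] .
  have "f (x + y) = (\<lambda>v. f x v + f y v)" "f (s c x) = (\<lambda>v. sv c (f x v))" for x y c
    by (simp_all add: fun_eq_iff linear_map_simps[OF assms])
  then show ?thesis
    by unfold_locales (simp_all add: star_add star_scale)
qed

lemma bilinear_mult:
  assumes f: "Vector_Spaces.linear s sc f" and g: "Vector_Spaces.linear t sc g"
  shows "bilinear_map s t sc (\<lambda>x y. f x * g y)"
proof -
  interpret s: vector_space s using Vector_Spaces.linear.axioms(1)[OF f] .
  interpret t: vector_space t using Vector_Spaces.linear.axioms(1)[OF g] .
  show ?thesis
    unfolding bilinear_map_def
    by (intro conjI allI; unfold_locales)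
      (simp_all add: linear_map_simps[OF f] linear_map_simps[OF g] sc_mult algebra_simps)
qed

lemma linear_io_comp:
  assumes "Vector_Spaces.linear s sv f"
  shows "Vector_Spaces.linear s sc (\<lambda>v. io (f v))"
  using Vector_Spaces.linear_compose[OF assms linear_io] by (simp add: comp_def)

text \<open>Moving \<open>io w\<close> through \<open>io (f (dual e)) * io e\<close> leaves two
  contractions. Each sums to \<open>2 * io (f w)\<close>, the second one after \<open>f\<close> is
  moved onto \<open>w\<close> by skewness; the total of 4 is cancelled by the factor
  \<open>1 / 4\<close> in \<open>star\<close>.\<close>

lemma star_io:
  assumes f: "f \<in> so_comp eps sv V form a" and w: "w \<in> V b"
  shows "star f * io w = sc (eps a b) (io w * star f) + io (f w)"
proof -
  note flin = linear_map_simps[OF so_linear[OF f]]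
  have e: "io (f (dual e)) * io e * io w =
      sc (eps a b) (io w * (io (f (dual e)) * io e)) + sc (2 * form e w) (io (f (dual e)))
       + sc (2 * form (f w) (dual e)) (io e)" if "e \<in> E" for e
  proof -
    let ?x = "f (dual e)"
    have x: "?x \<in> V (a - dg e)" by (rule so_degree_dual[OF f that])
    have ew: "io e * io w = sc (2 * form e w) u - sc (eps (dg e) b) (io w * io e)"
      by (rule clifford_swap[OF dg[OF that] w])
    have xw: "io ?x * io w = sc (2 * form ?x w) u - sc (eps (a - dg e) b) (io w * io ?x)"
      by (rule clifford_swap[OF x w])
    have c: "eps (dg e) b * eps (a - dg e) b = eps a b"
      by (simp add: eps_simps mult.left_commute[of _ "eps a b"] eps_inverse)
    have fw: "f w \<in> V (a + b)" by (rule so_degree[OF f w])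
    have "form ?x w = - eps (dg e) a * (eps (a + b) (dg e) * form (f w) (dual e))"
      using so_form[OF f dual_degree[OF that], of w] form_symmetric[OF dual_degree[OF that] fw]
      by simp
    then have "eps (dg e) b * form ?x w = - (eps (dg e) b * (eps (dg e) a * (eps a (dg e) * (eps b
        (dg e) * form (f w) (dual e)))))"
      by (simp add: eps_simps mult.assoc)
    then have d: "eps (dg e) b * form ?x w = - form (f w) (dual e)"
      by (simp add: eps_cancel)
    have "io ?x * io e * io w = sc (2 * form e w) (io ?x) - sc (eps (dg e) b) (io ?x * io w * io e)"
      by (simp add: mult.assoc ew sc_mult right_diff_distrib unit_io)
    also have "io ?x * io w * io e = sc (2 * form ?x w) (io e) - sc (eps (a - dg e) b) (io w * io
        ?x * io e)"
      by (simp add: xw sc_mult left_diff_distrib unit_io)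
    finally show ?thesis
      using c d by (simp add: A.scale_right_diff_distrib mult.assoc mult.left_commute[of _ 2])
  qed
  have 1: "(\<Sum>e\<in>E. sc (form e w) (io (f (dual e)))) = io (f w)"
    by (subst (2) expand_dual[of w, symmetric]) (simp add: flin io)
  have 2: "(\<Sum>e\<in>E. sc (form (f w) (dual e)) (io e)) = io (f w)"
    by (subst (2) expand_basis[of "f w", symmetric]) (simp add: io)
  have "(\<Sum>e\<in>E. io (f (dual e)) * io e) * io w =
      sc (eps a b) (io w * (\<Sum>e\<in>E. io (f (dual e)) * io e)) +
      (sc 2 (\<Sum>e\<in>E. sc (form e w) (io (f (dual e)))) + sc 2 (\<Sum>e\<in>E. sc (form (f w) (dual e)) (io e)))"
    by (simp add: sum_distrib_right sum_distrib_left e sum.distrib A.scale_sum_right add.assoc)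
  then have "sc 4 (star f) * io w = sc (eps a b) (io w * sc 4 (star f)) + sc 4 (io (f w))"
    unfolding 1 2 four_star by (simp flip: A.scale_left_distrib)
  then have "sc 4 (star f * io w) = sc 4 (sc (eps a b) (io w * star f) + io (f w))"
    by (simp add: sc_mult A.scale_right_distrib mult.commute)
  then show ?thesis using four_nonzero by (simp only: A.scale_cancel_left) simp
qed

text \<open>By \<open>star_io\<close>, \<open>star f\<close> acts as a derivation on the words of
  \<open>star g\<close>. On the first letter this gives \<open>f g\<close>, and on the second, after
  \<open>move_so\<close>, it gives \<open>- g f\<close>; so \<open>star\<close> is a morphism of
  colour Lie algebras.\<close>

lemma star_star:
  assumes f: "f \<in> so_comp eps sv V form a" and g: "g \<in> so_comp eps sv V form b"
  shows "star f * star g =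
    sc (eps a b) (star g * star f) + star (\<lambda>v. f (g v) - sv (eps a b) (g (f v)))"
proof -
  note glin = linear_map_simps[OF so_linear[OF g]]
  have e: "star f * (io (g (dual e)) * io e) = sc (eps a b) (io (g (dual e)) * io e * star f)
      + io (f (g (dual e))) * io e + sc (eps a b) (sc (eps (dg e) a) (io (g (dual e)) * io (f e)))"
    if "e \<in> E" for e
  proof -
    let ?y = "g (dual e)"
    have 1: "star f * io ?y = sc (eps a (b - dg e)) (io ?y * star f) + io (f ?y)"
      by (rule star_io[OF f so_degree_dual[OF g that]])
    have 2: "star f * io e = sc (eps a (dg e)) (io e * star f) + io (f e)"
      by (rule star_io[OF f dg[OF that]])
    have "star f * (io ?y * io e) = sc (eps a (b - dg e)) (io ?y * (star f * io e)) + io (f ?y) * io e"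
      by (simp add: mult.assoc[symmetric] 1 distrib_right sc_mult)
    also have "\<dots> = sc (eps a (b - dg e) * eps a (dg e)) (io ?y * io e * star f)
        + io (f ?y) * io e + sc (eps a (b - dg e)) (io ?y * io (f e))"
      by (simp add: 2 distrib_left sc_ring mult.assoc add_ac)
    also have "eps a (b - dg e) * eps a (dg e) = eps a b"
      by (simp add: eps_simps mult.assoc eps_inverse)
    also have "eps a (b - dg e) = eps a b * eps (dg e) a" by (simp add: eps_simps)
    finally show ?thesis by simp
  qed
  have b: "bilinear_map sv sv sc (\<lambda>x y. io (g x) * io y)"
    by (intro bilinear_mult linear_io_comp linear_io so_linear[OF g])
  have m: "(\<Sum>e\<in>E. sc (eps (dg e) a) (io (g (dual e)) * io (f e))) = - (\<Sum>e\<in>E. io (g (f (dual e))) *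
      io e)"
    using move_so[OF b f] by simp
  have "star f * (\<Sum>e\<in>E. io (g (dual e)) * io e) = sc (eps a b) ((\<Sum>e\<in>E. io (g (dual e)) * io e) * star f)
      + (\<Sum>e\<in>E. io (f (g (dual e))) * io e) - sc (eps a b) (\<Sum>e\<in>E. io (g (f (dual e))) * io e)"
    unfolding sum_distrib_left
    by (simp add: e sum.distrib m del: A.scale_scale flip: A.scale_sum_right sum_distrib_right)
  then have "sc 4 (star f * star g) = sc 4 (sc (eps a b) (star g * star f) +
      (star (\<lambda>v. f (g v)) - sc (eps a b) (star (\<lambda>v. g (f v)))))"
    unfolding four_star four_star[of "\<lambda>v. f (g v)"] four_star[of "\<lambda>v. g (f v)"]
    by (simp add: sc_ring mult.commute)
  then show ?thesis
    using four_nonzero by (simp add: star_diff star_scale)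
qed

text \<open>Self-adjointness moves \<open>C\<close> to the other leg of the canonical tensor.
  Reversing the two letters by the Clifford relation and using the symmetry of the tensor, the sum
  equals a scalar minus itself.\<close>

lemma trace_scalar:
  assumes C: "Vector_Spaces.linear sv sv C" and deg: "\<And>v a. v \<in> V a \<Longrightarrow> C v \<in> V a"
    and adj: "\<And>e w. e \<in> E \<Longrightarrow> form (C e) w = form e (C w)"
  shows "\<exists>c. (\<Sum>e\<in>E. io (C (dual e)) * io e) = sc c u"
proof -
  let ?T = "\<Sum>e\<in>E. io (C (dual e)) * io e"
  let ?s = "\<Sum>e\<in>E. 2 * form (dual e) (C e)"
  have "?T = (\<Sum>e\<in>E. io (\<Sum>g\<in>E. sv (form g (C (dual e))) (dual g)) * io e)"
    by (simp add: expand_dual)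
  also have "\<dots> = (\<Sum>e\<in>E. \<Sum>g\<in>E. sc (form (C g) (dual e)) (io (dual g) * io e))"
    by (simp add: io sc_mult sum_distrib_right adj)
  also have "\<dots> = (\<Sum>g\<in>E. \<Sum>e\<in>E. sc (form (C g) (dual e)) (io (dual g) * io e))"
    by (rule sum.swap)
  also have "\<dots> = (\<Sum>g\<in>E. io (dual g) * io (\<Sum>e\<in>E. sv (form (C g) (dual e)) e))"
    by (simp add: io sc_mult sum_distrib_left)
  also have "\<dots> = (\<Sum>g\<in>E. io (dual g) * io (C g))"
    by (simp add: expand_basis)
  also have "\<dots> = (\<Sum>g\<in>E. sc (2 * form (dual g) (C g)) u - sc (eps (dg g) (dg g)) (io (C g) * io
      (dual g)))"
  proof (rule sum.cong[OF refl])
    fix g assume "g \<in> E"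
    from clifford_swap[OF dual_degree[OF this] deg[OF dg[OF this]]]
    show "io (dual g) * io (C g) =
        sc (2 * form (dual g) (C g)) u - sc (eps (dg g) (dg g)) (io (C g) * io (dual g))"
      by simp
  qed
  also have "\<dots> = sc ?s u - (\<Sum>g\<in>E. sc (eps (dg g) (dg g)) (io (C g) * io (dual g)))"
    by (simp add: sum_subtractf A.scale_sum_left)
  also have "(\<Sum>g\<in>E. sc (eps (dg g) (dg g)) (io (C g) * io (dual g))) = ?T"
    by (rule symmetric_dual_tensor) (intro bilinear_mult linear_io_comp linear_io C)
  finally have "?T + ?T = sc ?s u" by (simp add: eq_diff_eq)
  then have "sc 2 ?T = sc 2 (sc (?s / 2) u)"
    using two_nonzero A.scale_left_distrib[of 1 1 ?T] by simp
  then have "?T = sc (?s / 2) u" using two_nonzero by (simp only: A.scale_cancel_left) simp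
  then show ?thesis ..
qed

text \<open>The operator \<open>R\<close> of the overview, with the ordinary commutator. On an
  element of degree 0 and even word length \<open>n\<close>, the commutator with
  \<open>dual e\<close> is twice a contraction and \<open>io e\<close> restores the lost letter; up
  to shorter words it therefore multiplies by \<open>2 * n\<close>, like an Euler operator.\<close>

definition euler :: "'r \<Rightarrow> 'r" where
  "euler c = (\<Sum>e\<in>E. (c * io (dual e) - io (dual e) * c) * io e)"

lemma linear_euler: "Vector_Spaces.linear sc sc euler"
  by unfold_locales
    (simp_all add: euler_def algebra_simps sum.distrib sum_subtractf A.scale_sum_right
      sc_mult A.scale_right_diff_distrib)

lemma euler_unit: "euler u = 0"
  by (simp add: euler_def unit_io)

end

section \<open>Casimir elements of linear families in \<open>so\<close>\<close>

text \<open>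
  A linear family of elements of \<open>so\<^sub>\<epsilon>(V)\<close>, parametrised by a space with its own
  non-degenerate form; it will be the representation on \<open>V\<close>, and \<open>v \<mapsto> \<phi>(v, -)\<close>.
\<close>

locale so_family = clifford_model eps sv V form E sc u io + Y: eps_symmetric_basis eps sy Y B X
  for eps :: "'c::ab_group_add \<Rightarrow> 'c \<Rightarrow> 'k::field"
    and sv :: "'k \<Rightarrow> 'v::ab_group_add \<Rightarrow> 'v"
    and V :: "'c \<Rightarrow> 'v set"
    and form :: "'v \<Rightarrow> 'v \<Rightarrow> 'k"
    and E :: "'v set"
    and sc :: "'k \<Rightarrow> 'r::ring \<Rightarrow> 'r" and u :: 'r and io :: "'v \<Rightarrow> 'r"
    and sy :: "'k \<Rightarrow> 'y::ab_group_add \<Rightarrow> 'y"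
    and Y :: "'c \<Rightarrow> 'y set"
    and B :: "'y \<Rightarrow> 'y \<Rightarrow> 'k"
    and X :: "'y set" +
  fixes \<theta> :: "'y \<Rightarrow> 'v \<Rightarrow> 'v"
  assumes family_linear: "Vector_Spaces.linear sy sv (\<lambda>x. \<theta> x v)"
    and family_so: "x \<in> Y a \<Longrightarrow> \<theta> x \<in> so_comp eps sv V form a"
begin

definition casimir_element :: 'r where
  "casimir_element = (\<Sum>x\<in>X. star (\<theta> (Y.dual x)) * star (\<theta> x))"

definition casimir_operator :: "'v \<Rightarrow> 'v" where
  "casimir_operator v = (\<Sum>x\<in>X. \<theta> (Y.dual x) (\<theta> x v))"

text \<open>\<open>family_so\<close> gives linearity for homogeneous \<open>x\<close> only; a
  general \<open>x\<close> is expanded in the homogeneous basis \<open>X\<close>.\<close>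

lemma family_linear_right: "Vector_Spaces.linear sv sv (\<theta> x)"
proof -
  have "\<theta> x v = (\<Sum>y\<in>X. sv (B x (Y.dual y)) (\<theta> y v))" for v
    by (subst Y.expand_basis[of x, symmetric]) (simp add: linear_map_simps[OF family_linear])
  moreover have "\<theta> y (v + w) = \<theta> y v + \<theta> y w" "\<theta> y (sv c v) = sv c (\<theta> y v)" if "y \<in> X" for y v w c
    using linear_map_simps[OF so_linear[OF family_so[OF Y.dg[OF that]]]] by blast+
  ultimately show ?thesis
    by unfold_locales
      (simp_all add: scale_right_distrib sum.distrib scale_sum_right mult.commute)
qed

lemma bilinear_family_family: "bilinear_map sy sy sv (\<lambda>x y. \<theta> x (\<theta> y v))"
  unfolding bilinear_map_def
  by (intro conjI allI family_linear)
    (unfold_locales, simp_all add: linear_map_simps[OF family_linear] linear_map_simps[OF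
        family_linear_right])

lemma casimir_operator_symmetric:
  "(\<Sum>x\<in>X. sv (eps (Y.dg x) (Y.dg x)) (\<theta> x (\<theta> (Y.dual x) v))) = casimir_operator v"
  unfolding casimir_operator_def by (rule Y.symmetric_dual_tensor[OF bilinear_family_family])

text \<open>Passing \<open>io v\<close> through the two \<open>star\<close> factors leaves one term
  for each. The symmetry of the canonical tensor of \<open>Y\<close> makes the two sums equal once
  they are brought into the same order, and that reordering costs the vector
  \<open>casimir_operator v\<close>.\<close>

lemma casimir_commutator:
  assumes v: "v \<in> V b"
  shows "casimir_element * io v - io v * casimir_element =
    sc 2 (\<Sum>x\<in>X. star (\<theta> (Y.dual x)) * io (\<theta> x v)) - io (casimir_operator v)"
proof -
  have x: "star (\<theta> (Y.dual x)) * star (\<theta> x) * io v = io v * (star (\<theta> (Y.dual x)) * star (\<theta> x))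
      + (star (\<theta> (Y.dual x)) * io (\<theta> x v)
         + (sc (eps (Y.dg x) (Y.dg x)) (star (\<theta> x) * io (\<theta> (Y.dual x) v))
         - sc (eps (Y.dg x) (Y.dg x)) (io (\<theta> x (\<theta> (Y.dual x) v)))))"
    if "x \<in> X" for x
  proof -
    let ?d = "Y.dg x" and ?f = "\<theta> (Y.dual x)" and ?g = "\<theta> x"
    have f: "?f \<in> so_comp eps sv V form (- ?d)" and g: "?g \<in> so_comp eps sv V form ?d"
      using family_so Y.dg Y.dual_degree that by blast+
    have fv: "?f v \<in> V (b - ?d)" using so_degree[OF f v] by simp
    have 1: "star ?g * io v = sc (eps ?d b) (io v * star ?g) + io (?g v)"
      by (rule star_io[OF g v])
    have 2: "star ?f * io v = sc (eps b ?d) (io v * star ?f) + io (?f v)"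
      using star_io[OF f v] by simp
    \<comment> \<open>Brings the second term into the order of the first, with the sign that
      \<open>symmetric_dual_tensor\<close> expects.\<close>
    have 3: "sc (eps ?d b) (io (?f v) * star ?g) = sc (eps ?d ?d) (star ?g * io (?f v)) - sc (eps
        ?d ?d) (io (?g (?f v)))"
    proof -
      have "sc (eps ?d ?d) (star ?g * io (?f v)) =
          sc (eps ?d ?d * eps ?d (b - ?d)) (io (?f v) * star ?g) + sc (eps ?d ?d) (io (?g (?f v)))"
        using star_io[OF g fv] by (simp add: A.scale_right_distrib)
      also have "eps ?d ?d * eps ?d (b - ?d) = eps ?d b"
        by (simp add: eps_simps eps_cancel)
      finally show ?thesis by simp
    qed
    have "star ?f * star ?g * io v = sc (eps ?d b) (star ?f * io v * star ?g) + star ?f * io (?g v)"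
      by (simp add: mult.assoc 1 distrib_left sc_mult)
    also have "\<dots> = sc (eps ?d b * eps b ?d) (io v * star ?f * star ?g) + sc (eps ?d b) (io (?f v)
        * star ?g)
        + star ?f * io (?g v)"
      by (simp add: 2 distrib_right sc_mult A.scale_right_distrib)
    finally show ?thesis
      by (simp add: eps_inverse mult.assoc add_ac 3)
  qed
  have s: "Vector_Spaces.linear sy sc (\<lambda>x. star (\<theta> x))"
    by (rule linear_star[OF family_linear])
  have b1: "bilinear_map sy sy sc (\<lambda>x y. star (\<theta> x) * io (\<theta> y v))"
    by (intro bilinear_mult s linear_io_comp family_linear)
  have 1: "(\<Sum>x\<in>X. sc (eps (Y.dg x) (Y.dg x)) (star (\<theta> x) * io (\<theta> (Y.dual x) v))) =
      (\<Sum>x\<in>X. star (\<theta> (Y.dual x)) * io (\<theta> x v))"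
    using Y.symmetric_dual_tensor[OF b1] .
  have 2: "(\<Sum>x\<in>X. sc (eps (Y.dg x) (Y.dg x)) (io (\<theta> x (\<theta> (Y.dual x) v)))) = io (casimir_operator v)"
    by (simp add: io flip: casimir_operator_symmetric)
  have "casimir_element * io v = io v * casimir_element
      + (\<Sum>x\<in>X. star (\<theta> (Y.dual x)) * io (\<theta> x v)) +
       ((\<Sum>x\<in>X. sc (eps (Y.dg x) (Y.dg x)) (star (\<theta> x) * io (\<theta> (Y.dual x) v)))
        - (\<Sum>x\<in>X. sc (eps (Y.dg x) (Y.dg x)) (io (\<theta> x (\<theta> (Y.dual x) v)))))"
    unfolding casimir_element_def sum_distrib_right sum_distrib_left
    by (simp add: x sum.distrib sum_subtractf add.assoc)
  then show ?thesis
    unfolding 1 2 using A.scale_left_distrib[of 1 1] by simp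
qed

lemma linear_casimir_operator: "Vector_Spaces.linear sv sv casimir_operator"
  by unfold_locales
    (simp_all add: casimir_operator_def linear_map_simps[OF family_linear_right] sum.distrib
        scale_sum_right)

lemma casimir_operator_degree: "v \<in> V a \<Longrightarrow> casimir_operator v \<in> V a"
  unfolding casimir_operator_def
proof (rule comp_sum)
  fix x assume v: "v \<in> V a" and x: "x \<in> X"
  have "\<theta> x v \<in> V (Y.dg x + a)" by (rule so_degree[OF family_so[OF Y.dg[OF x]] v])
  from so_degree[OF family_so[OF Y.dual_degree[OF x]] this]
  show "\<theta> (Y.dual x) (\<theta> x v) \<in> V a" by simp
qed

text \<open>Transposition reverses the order of two skew factors; the symmetry of the canonical
  tensor of \<open>Y\<close> restores it.\<close>

lemma casimir_operator_adjoint: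
  assumes v: "v \<in> V b"
  shows "form (casimir_operator v) w = form v (casimir_operator w)"
proof -
  have x: "form (\<theta> (Y.dual x) (\<theta> x v)) w = eps (Y.dg x) (Y.dg x) * form v (\<theta> x (\<theta> (Y.dual x) w))"
    if "x \<in> X" for x
  proof -
    let ?d = "Y.dg x"
    have f: "\<theta> (Y.dual x) \<in> so_comp eps sv V form (- ?d)" and g: "\<theta> x \<in> so_comp eps sv V form ?d"
      using family_so Y.dg Y.dual_degree that by blast+
    have "form (\<theta> (Y.dual x) (\<theta> x v)) w = - eps (?d + b) ?d * form (\<theta> x v) (\<theta> (Y.dual x) w)"
      using so_form[OF f so_degree[OF g v], of w] by simp
    also have "\<dots> = (eps ?d ?d * (eps b ?d * (eps ?d b * form v (\<theta> x (\<theta> (Y.dual x) w)))))"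
      using so_form[OF g v, of "\<theta> (Y.dual x) w"] by (simp add: eps_simps)
    finally show ?thesis by (simp add: eps_cancel)
  qed
  have "form (casimir_operator v) w = (\<Sum>x\<in>X. eps (Y.dg x) (Y.dg x) * form v (\<theta> x (\<theta> (Y.dual x) w)))"
    by (simp add: casimir_operator_def form_left x)
  also have "\<dots> = form v (casimir_operator w)"
    by (simp add: form_right flip: casimir_operator_symmetric)
  finally show ?thesis .
qed

text \<open>In the commutator formula the sum over \<open>e\<close> of
  \<open>io (\<theta> x (dual e)) * io e\<close> is \<open>4 * star (\<theta> x)\<close>; with the
  factor 2 in front this is the 8. The vector term contributes a scalar by
  \<open>trace_scalar\<close>.\<close>

lemma euler_casimir: "\<exists>c. euler casimir_element = sc 8 casimir_element + sc c u"
proof -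
  let ?S = "\<lambda>x. star (\<theta> (Y.dual x))"
  obtain c where c: "(\<Sum>e\<in>E. io (casimir_operator (dual e)) * io e) = sc c u"
    using trace_scalar[OF linear_casimir_operator casimir_operator_degree
        casimir_operator_adjoint[OF dg]]
    by blast
  have "euler casimir_element =
      (\<Sum>e\<in>E. (sc 2 (\<Sum>x\<in>X. ?S x * io (\<theta> x (dual e))) - io (casimir_operator (dual e))) * io e)"
    unfolding euler_def by (intro sum.cong refl) (simp only: casimir_commutator[OF dual_degree])
  also have "\<dots> = sc 2 (\<Sum>e\<in>E. \<Sum>x\<in>X. ?S x * (io (\<theta> x (dual e)) * io e)) - sc c u"
    by (simp add: left_diff_distrib sum_subtractf c sc_mult sum_distrib_right mult.assoc
        flip: A.scale_sum_right)
  also have "(\<Sum>e\<in>E. \<Sum>x\<in>X. ?S x * (io (\<theta> x (dual e)) * io e)) =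
      (\<Sum>x\<in>X. ?S x * (\<Sum>e\<in>E. io (\<theta> x (dual e)) * io e))"
    by (subst sum.swap) (simp add: sum_distrib_left)
  also have "\<dots> = sc 4 casimir_element"
    by (simp add: four_star casimir_element_def sc_mult A.scale_sum_right)
  finally have "euler casimir_element = sc 8 casimir_element + sc (- c) u" by simp
  then show ?thesis ..
qed

end

section \<open>Cubic sums formed from families in \<open>so\<close>\<close>

context clifford_model
begin

lemma star_unit [simp]: "star f * u = star f" "u * star f = star f"
proof -
  show "star f * u = star f"
    by (simp add: star_def sc_mult sum_distrib_right mult.assoc unit_io)
  show "u * star f = star f"
    by (simp add: star_def sc_mult sum_distrib_left mult.assoc[symmetric] unit_io)
qed

lemma four_div_two: "(4::'k) / 2 = 2"
proof -
  have "(2 * 2 :: 'k) / 2 = 2" using two_nonzero by (rule nonzero_mult_div_cancel_left)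
  then show ?thesis by simp
qed

lemma so_bracket:
  assumes f: "f \<in> so_comp eps sv V form a" and g: "g \<in> so_comp eps sv V form b"
  shows "(\<lambda>v. f (g v) - sv (eps a b) (g (f v))) \<in> so_comp eps sv V form (a + b)"
proof -
  note flin = linear_map_simps[OF so_linear[OF f]] and glin = linear_map_simps[OF so_linear[OF g]]
  have "Vector_Spaces.linear sv sv (\<lambda>v. f (g v) - sv (eps a b) (g (f v)))"
    by unfold_locales (simp_all add: flin glin algebra_simps)
  moreover have "f (g v) - sv (eps a b) (g (f v)) \<in> V (a + b + c)" if "v \<in> V c" for v c
    using so_degree[OF f so_degree[OF g that]] so_degree[OF g so_degree[OF f that]]
    by (auto intro!: subspace_diff[OF subspace_comp] comp_scale simp: add_ac)
  moreover have "form (f (g v) - sv (eps a b) (g (f v))) w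
      + eps (a + b) c * form v (f (g w) - sv (eps a b) (g (f w))) = 0" if v: "v \<in> V c" for v c w
  proof -
    have 1: "form (f (g v)) w = eps a b * (eps a c * (eps b c * form v (g (f w))))"
      using so_form[OF f so_degree[OF g v], of w] so_form[OF g v, of "f w"] by (simp add:
          eps_simps mult.assoc)
    have 2: "form (g (f v)) w = eps b a * (eps b c * (eps a c * form v (f (g w))))"
      using so_form[OF g so_degree[OF f v], of w] so_form[OF f v, of "g w"] by (simp add:
          eps_simps mult.assoc)
    have 3: "eps a b * form (g (f v)) w = eps b c * (eps a c * form v (f (g w)))"
      unfolding 2 by (simp add: eps_cancel)
    have "form (f (g v) - sv (eps a b) (g (f v))) w = eps a b * (eps a c * (eps b c * form v (g (f w))))
        - eps b c * (eps a c * form v (f (g w)))"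
      by (simp add: form_left 1 3)
    then show ?thesis by (simp add: form_right eps_simps algebra_simps)
  qed
  ultimately show ?thesis by (simp add: so_comp_def)
qed

lemma so_diff:
  assumes f: "f \<in> so_comp eps sv V form a" and g: "g \<in> so_comp eps sv V form a"
  shows "(\<lambda>v. f v - g v) \<in> so_comp eps sv V form a"
proof -
  note flin = linear_map_simps[OF so_linear[OF f]] and glin = linear_map_simps[OF so_linear[OF g]]
  have "Vector_Spaces.linear sv sv (\<lambda>v. f v - g v)"
    by unfold_locales (simp_all add: flin glin algebra_simps)
  then show ?thesis
    using so_degree[OF f] so_degree[OF g] so_form[OF f] so_form[OF g]
    by (simp add: so_comp_def form_left form_right subspace_diff[OF subspace_comp] algebra_simps)
qed

lemma so_scale:
  assumes f: "f \<in> so_comp eps sv V form a"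
  shows "(\<lambda>v. sv c (f v)) \<in> so_comp eps sv V form a"
proof -
  note flin = linear_map_simps[OF so_linear[OF f]]
  have "Vector_Spaces.linear sv sv (\<lambda>v. sv c (f v))"
    by unfold_locales (simp_all add: flin scale_right_distrib mult.commute)
  then show ?thesis
    using so_degree[OF f] so_form[OF f]
    by (simp add: so_comp_def form_left form_right comp_scale)
qed

text \<open>The Clifford relation between \<open>v\<close> and a dual vector expresses the
  coordinate \<open>form v (dual e)\<close> as a multiple of \<open>u\<close>. Here non-triviality
  of the Clifford algebra enters.\<close>

lemma io_injective:
  assumes "u \<noteq> 0" "v \<in> V a" "io v = 0"
  shows "v = 0"
proof (rule eq_on_dual_form)
  fix e assume "e \<in> E"
  from clifford[OF assms(2) dual_degree[OF this]] assms two_nonzero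
  show "form v (dual e) = form 0 (dual e)" by (simp add: form_left)
qed

text \<open>
  For a family \<open>h\<close> of elements of \<open>so\<^sub>\<epsilon>(V)\<close>, the element \<open>\<Sum> star (h e) e\<close> only depends, up to a
  vector, on the antisymmetrisation of the form \<open>(h(e) g, l)\<close> in its three arguments.
\<close>

definition cyclic_vanish :: "('v \<Rightarrow> 'v \<Rightarrow> 'v) \<Rightarrow> bool" where
  "cyclic_vanish h \<longleftrightarrow> (\<forall>e\<in>E. \<forall>g\<in>E. \<forall>l\<in>E.
     form (h e (dual g)) (dual l) - eps (dg e) (dg g) * form (h g (dual e)) (dual l)
      + eps (dg e) (dg l) * eps (dg g) (dg l) * form (h l (dual e)) (dual g) = 0)"

lemma star_sum_bracket:
  assumes h: "\<And>e. e \<in> E \<Longrightarrow> h e \<in> so_comp eps sv V form (a - dg e)" and w: "w \<in> V b"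
  shows "(\<Sum>e\<in>E. star (h e) * io e) * io w + sc (eps a b) (io w * (\<Sum>e\<in>E. star (h e) * io e)) =
    sc 2 (\<Sum>e\<in>E. sc (form e w) (star (h e))) - (\<Sum>e\<in>E. sc (eps (dg e) b) (io (h e w) * io e))"
proof -
  have "star (h e) * io e * io w + sc (eps a b) (io w * (star (h e) * io e)) =
      sc 2 (sc (form e w) (star (h e))) - sc (eps (dg e) b) (io (h e w) * io e)" if e: "e \<in> E" for e
  proof -
    have c: "eps (dg e) b * eps (a - dg e) b = eps a b"
      by (simp add: eps_simps mult.left_commute[of _ "eps a b"] eps_inverse)
    have "star (h e) * io e * io w = sc (2 * form e w) (star (h e)) - sc (eps (dg e) b) (star (h
        e) * io w * io e)"
      using clifford_swap[OF dg[OF e] w] by (simp add: mult.assoc right_diff_distrib sc_mult)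
    also have "star (h e) * io w * io e = sc (eps (a - dg e) b) (io w * (star (h e) * io e)) + io
        (h e w) * io e"
      using star_io[OF h[OF e] w] by (simp add: distrib_right sc_mult mult.assoc)
    finally show ?thesis by (simp add: A.scale_right_distrib c)
  qed
  then show ?thesis
    unfolding sum_distrib_left sum_distrib_right A.scale_sum_right
    by (simp flip: sum.distrib sum_subtractf)
qed

text \<open>Two colour brackets, with \<open>dual g\<close> and then \<open>dual l\<close>, lower
  the cubic sum to a vector and annihilate \<open>io z\<close>. Injectivity of \<open>io\<close>
  turns the result into an identity in the underlying space, whose pairing with
  \<open>dual e0\<close> is the claim.\<close>

lemma cyclic_vanish_if_vector:
  assumes unit: "u \<noteq> 0"
    and h: "\<And>e. e \<in> E \<Longrightarrow> h e \<in> so_comp eps sv V form (a - dg e)"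
    and z: "z \<in> V a" and eq: "(\<Sum>e\<in>E. star (h e) * io e) = io z"
  shows "cyclic_vanish h"
  unfolding cyclic_vanish_def
proof (intro ballI)
  fix g l e0 assume g: "g \<in> E" and l: "l \<in> E" and e0: "e0 \<in> E"
  let ?N = "\<Sum>e\<in>E. sc (eps (dg g) (dg e)) (io (h e (dual g)) * io e)"
  let ?\<chi> = "eps (a - dg g) (- dg l)"
  let ?c = "\<lambda>e. eps (dg g) (dg e) * (eps (dg l) (dg e) * form (h e (dual g)) (dual l))"
  have delta: "(\<Sum>e\<in>E. sc (form e (dual g')) (x e)) = x g'" if "g' \<in> E" for g' x
    using that finite_E by (simp add: form_dual if_distrib[of "\<lambda>c. sc c _"] cong: if_cong)
  have N: "sc 2 (star (h g)) - ?N = sc (2 * form z (dual g)) u"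
    using star_sum_bracket[OF h dual_degree[OF g]] clifford[OF z dual_degree[OF g]]
    unfolding eq delta[OF g] by simp
  have "io (h e (dual g)) * io e * io (dual l) - sc ?\<chi> (io (dual l) * (io (h e (dual g)) * io e)) =
      sc (2 * form e (dual l)) (io (h e (dual g)))
      - sc (2 * (eps (dg l) (dg e) * form (h e (dual g)) (dual l))) (io e)" if e: "e \<in> E" for e
  proof -
    let ?x = "h e (dual g)"
    have x: "?x \<in> V (a - dg e - dg g)" by (rule so_degree_dual[OF h[OF e] g])
    have "io ?x * io e * io (dual l) = sc (2 * form e (dual l)) (io ?x)
        - sc (eps (dg l) (dg e)) (io ?x * io (dual l) * io e)"
      using clifford_swap[OF dg[OF e] dual_degree[OF l]]
      by (simp add: mult.assoc right_diff_distrib sc_mult unit_io)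
    also have "io ?x * io (dual l) * io e = sc (2 * form ?x (dual l)) (io e)
        - sc (eps (dg l) (a - dg e - dg g)) (io (dual l) * (io ?x * io e))"
      using clifford_swap[OF x dual_degree[OF l]]
      by (simp add: mult.assoc left_diff_distrib sc_mult unit_io)
    also have "sc (eps (dg l) (dg e)) (sc (2 * form ?x (dual l)) (io e)
        - sc (eps (dg l) (a - dg e - dg g)) (io (dual l) * (io ?x * io e))) =
        sc (2 * (eps (dg l) (dg e) * form ?x (dual l))) (io e) - sc ?\<chi> (io (dual l) * (io ?x * io e))"
      by (simp add: A.scale_right_diff_distrib eps_simps mult_ac eps_cancel)
    finally show ?thesis by simp
  qed
  then have "?N * io (dual l) - sc ?\<chi> (io (dual l) * ?N) =
      sc 2 (\<Sum>e\<in>E. sc (form e (dual l)) (sc (eps (dg g) (dg e)) (io (h e (dual g)))))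
      - sc 2 (\<Sum>e\<in>E. sc (?c e) (io e))"
    unfolding sum_distrib_left sum_distrib_right A.scale_sum_right sum_subtractf[symmetric]
  proof (intro sum.cong refl, goal_cases)
    case (1 e)
    have "sc (eps (dg g) (dg e)) (io (h e (dual g)) * io e) * io (dual l)
       - sc ?\<chi> (io (dual l) * sc (eps (dg g) (dg e)) (io (h e (dual g)) * io e)) =
      sc (eps (dg g) (dg e)) (io (h e (dual g)) * io e * io (dual l) - sc ?\<chi> (io (dual l) * (io (h
          e (dual g)) * io e)))"
      by (simp add: sc_ring mult_ac)
    then show ?case
      unfolding 1(1)[OF 1(2)] by (simp add: A.scale_right_diff_distrib mult_ac)
  qed
  then have 1: "?N * io (dual l) - sc ?\<chi> (io (dual l) * ?N) =
      sc 2 (sc (eps (dg g) (dg l)) (io (h l (dual g)))) - sc 2 (\<Sum>e\<in>E. sc (?c e) (io e))"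
    unfolding delta[OF l] .
  have 2: "sc 2 (star (h g)) * io (dual l) - sc ?\<chi> (io (dual l) * sc 2 (star (h g))) = sc 2 (io (h
      g (dual l)))"
    using star_io[OF h[OF g] dual_degree[OF l]] by (simp add: sc_ring mult.commute)
  \<comment> \<open>A scalar has trivial bracket provided the sign \<open>?\<chi>\<close> is 1: if
    \<open>form z (dual g)\<close> is non-zero, then \<open>a = dg g\<close> and the first argument
    of \<open>?\<chi>\<close> is 0.\<close>
  have 3: "sc (2 * form z (dual g)) u * io (dual l) - sc ?\<chi> (io (dual l) * sc (2 * form z (dual
      g)) u) = 0"
  proof (cases "form z (dual g) = 0")
    case False
    then have "a - dg g = 0" using form_degree[OF z dual_degree[OF g]] by auto
    then show ?thesis by (simp add: sc_mult unit_io)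
  qed (simp add: sc_mult)
  have "sc 2 (io (h g (dual l))) = ?N * io (dual l) - sc ?\<chi> (io (dual l) * ?N)"
    unfolding 2[symmetric] using 3 unfolding N[symmetric]
    by (simp add: left_diff_distrib right_diff_distrib sc_ring algebra_simps)
  then have "sc 2 (io (h g (dual l)) - sc (eps (dg g) (dg l)) (io (h l (dual g))) + (\<Sum>e\<in>E. sc (?c
      e) (io e))) = 0"
    unfolding 1 by (simp add: A.scale_right_diff_distrib A.scale_right_distrib)
  then have Z: "io (h g (dual l) - sv (eps (dg g) (dg l)) (h l (dual g)) + (\<Sum>e\<in>E. sv (?c e) e)) = 0"
    using two_nonzero by (simp add: io)
  have "h g (dual l) \<in> V (a - dg g - dg l)" "h l (dual g) \<in> V (a - dg g - dg l)"
    using so_degree_dual[OF h[OF g] l] so_degree_dual[OF h[OF l] g] by (simp_all add: algebra_simps)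
  \<comment> \<open>A non-zero coefficient \<open>?c e\<close> forces \<open>e\<close> to have the
    right degree, so the sum is homogeneous.\<close>
  moreover have "(\<Sum>e\<in>E. sv (?c e) e) \<in> V (a - dg g - dg l)"
  proof (rule comp_sum)
    fix e assume e: "e \<in> E"
    show "sv (?c e) e \<in> V (a - dg g - dg l)"
    proof (cases "form (h e (dual g)) (dual l) = 0")
      case True
      then show ?thesis by (simp add: subspace_0[OF subspace_comp])
    next
      case False
      then have "a - dg e - dg g + - dg l = 0"
        using form_degree[OF so_degree_dual[OF h[OF e] g] dual_degree[OF l]] by auto
      then have "dg e = a - dg g - dg l" by (simp add: algebra_simps)
      then show ?thesis using dg[OF e] by (simp add: comp_scale)
    qed
  qed
  ultimately have "h g (dual l) - sv (eps (dg g) (dg l)) (h l (dual g)) + (\<Sum>e\<in>E. sv (?c e) e) = 0"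
    by (intro io_injective[OF unit _ Z, of "a - dg g - dg l"]) (simp add: subspace_add
        subspace_diff subspace_comp comp_scale)
  then have "form (h g (dual l) - sv (eps (dg g) (dg l)) (h l (dual g)) + (\<Sum>e\<in>E. sv (?c e) e))
      (dual e0) = 0"
    by (simp add: form_left)
  then show "form (h g (dual l)) (dual e0) - eps (dg g) (dg l) * form (h l (dual g)) (dual e0)
      + eps (dg g) (dg e0) * eps (dg l) (dg e0) * form (h e0 (dual g)) (dual l) = 0"
    using e0 finite_E by (simp add: form_left form_dual if_distrib[of "\<lambda>c. _ * c"] mult.assoc
        cong: if_cong)
qed

text \<open>\<open>?Y\<close> is four times the sum in question. The hypothesis expresses each
  coefficient of \<open>?Y\<close> through two permuted ones; after the words are sorted back, each
  of the two sums contributes \<open>- ?Y\<close> and a multiple of \<open>?T\<close>. So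
  \<open>3 * ?Y = 6 * ?T\<close>, and \<open>1 / 2\<close> is \<open>6 / (3 * 4)\<close>.\<close>

lemma star_sum_if_cyclic_vanish:
  assumes h: "\<And>e. e \<in> E \<Longrightarrow> h e \<in> so_comp eps sv V form (a - dg e)"
    and cyc: "cyclic_vanish h"
  shows "(\<Sum>e\<in>E. star (h e) * io e) = sc (1 / 2) (io (\<Sum>e\<in>E. h e e))"
proof -
  let ?Y = "\<Sum>e\<in>E. \<Sum>g\<in>E. io (h e (dual g)) * io g * io e"
  let ?T = "io (\<Sum>e\<in>E. h e e)"
  let ?f = "\<lambda>e g l. form (h e (dual g)) (dual l)"
  have ex: "io v = (\<Sum>l\<in>E. sc (form v (dual l)) (io l))" for v
    by (subst expand_basis[of v, symmetric]) (simp add: io)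
  have hlin: "h e (\<Sum>i\<in>A. sv (c i) (x i)) = (\<Sum>i\<in>A. sv (c i) (h e (x i)))"
    if "e \<in> E" for e A and c :: "'v \<Rightarrow> 'k" and x
    by (simp add: linear_map_simps[OF so_linear[OF h[OF that]]])
  have Y: "?Y = (\<Sum>e\<in>E. \<Sum>g\<in>E. \<Sum>l\<in>E. sc (?f e g l) (io l * io g * io e))"
    by (subst ex) (simp add: sum_distrib_right sc_mult)
  have sym: "eps (dg e) (dg g) * form g e = form e g" if "e \<in> E" "g \<in> E" for e g
    using form_symmetric[OF dg[OF that(1)] dg[OF that(2)]] by simp
  have T: "(\<Sum>g\<in>E. \<Sum>e\<in>E. sc (form e g) (io (h g (dual e)))) = ?T"
  proof -
    have "(\<Sum>e\<in>E. sc (form e g) (io (h g (dual e)))) = io (h g g)" if "g \<in> E" for g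
      by (subst (2) expand_dual[of g, symmetric]) (simp add: hlin that io)
    then show ?thesis by (simp add: io)
  qed
  \<comment> \<open>Swapping the last two letters turns the words into those of \<open>?Y\<close>
    with \<open>e\<close> and \<open>g\<close> exchanged; the contractions add up to twice
    \<open>?T\<close>.\<close>
  have Y1: "(\<Sum>e\<in>E. \<Sum>g\<in>E. sc (eps (dg e) (dg g)) (io (h g (dual e)) * io g * io e)) = sc 2 ?T - ?Y"
  proof -
    have "sc (eps (dg e) (dg g)) (io (h g (dual e)) * io g * io e) =
        sc 2 (sc (form e g) (io (h g (dual e)))) - io (h g (dual e)) * io e * io g"
      if e: "e \<in> E" and g: "g \<in> E" for e g
    proof -
      have "io (h g (dual e)) * io g * io e = sc (2 * form g e) (io (h g (dual e)))
          - sc (eps (dg g) (dg e)) (io (h g (dual e)) * io e * io g)"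
        using clifford_swap[OF dg[OF g] dg[OF e]] by (simp add: mult.assoc right_diff_distrib
            sc_mult unit_io)
      then show ?thesis
        using sym[OF e g] by (simp add: A.scale_right_diff_distrib eps_inverse
            mult.left_commute[of _ 2])
    qed
    then have "(\<Sum>e\<in>E. \<Sum>g\<in>E. sc (eps (dg e) (dg g)) (io (h g (dual e)) * io g * io e)) =
      (\<Sum>e\<in>E. \<Sum>g\<in>E. sc 2 (sc (form e g) (io (h g (dual e)))) - io (h g (dual e)) * io e * io g)"
      by (intro sum.cong refl)
    also have "\<dots> = (\<Sum>g\<in>E. \<Sum>e\<in>E. sc 2 (sc (form e g) (io (h g (dual e)))) - io (h g (dual e)) * io
        e * io g)"
      by (rule sum.swap)
    also have "\<dots> = sc 2 ?T - ?Y"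
      unfolding sum_subtractf A.scale_sum_right[symmetric] T by simp
    finally show ?thesis .
  qed
  \<comment> \<open>The letter \<open>l\<close> travels past \<open>g\<close> and then past
    \<open>e\<close>. The two contractions are summed in \<open>t1\<close> and \<open>t2\<close>,
    the fully permuted words in \<open>t3\<close>.\<close>
  have Y2: "(\<Sum>e\<in>E. \<Sum>g\<in>E. \<Sum>l\<in>E. sc (eps (dg e) (dg l) * eps (dg g) (dg l) * ?f l e g) (io l * io g
      * io e)) =
      ?Y - sc 4 ?T"
  proof -
    have prod: "sc (eps (dg e) (dg l) * eps (dg g) (dg l) * ?f l e g) (io l * io g * io e) =
       sc 2 (sc (eps (dg e) (dg l)) (sc (form g l * ?f l e g) (io e)))
       - sc 2 (sc (form e l) (sc (?f l e g) (io g)))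
       + sc (?f l e g) (io g * io e * io l)"
      if e: "e \<in> E" and g: "g \<in> E" and l: "l \<in> E" for e g l
    proof -
      have "io l * io g * io e = sc (2 * form l g) (io e) - sc (eps (dg l) (dg g)) (io g * (io l *
          io e))"
        using clifford_swap[OF dg[OF l] dg[OF g]] by (simp add: mult.assoc left_diff_distrib
            sc_mult unit_io)
      also have "io g * (io l * io e) = sc (2 * form l e) (io g) - sc (eps (dg l) (dg e)) (io g *
          io e * io l)"
        using clifford_swap[OF dg[OF l] dg[OF e]] by (simp add: right_diff_distrib sc_mult unit_io
            mult.assoc)
      finally have p: "io l * io g * io e = sc (2 * form l g) (io e)
         - sc (eps (dg l) (dg g) * (2 * form l e)) (io g)
         + sc (eps (dg l) (dg g) * eps (dg l) (dg e)) (io g * io e * io l)"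
        by (simp add: A.scale_right_diff_distrib)
      have c1: "eps (dg e) (dg l) * eps (dg g) (dg l) * ?f l e g * (2 * form l g) =
          2 * (eps (dg e) (dg l) * (form g l * ?f l e g))"
        unfolding sym[OF g l, symmetric] by (simp add: mult_ac)
      have c2: "eps (dg e) (dg l) * eps (dg g) (dg l) * ?f l e g * (eps (dg l) (dg g) * (2 * form
          l e)) =
          2 * (form e l * ?f l e g)"
        unfolding sym[OF e l, symmetric] by (simp add: mult_ac eps_cancel)
      have c3: "eps (dg e) (dg l) * eps (dg g) (dg l) * ?f l e g * (eps (dg l) (dg g) * eps (dg l)
          (dg e)) = ?f l e g"
        by (simp add: mult_ac eps_cancel eps_inverse)
      show ?thesis
        unfolding p A.scale_right_diff_distrib A.scale_right_distrib A.scale_scale c1 c2 c3 by simp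
    qed
    \<comment> \<open>The contraction pairs \<open>h l (dual e)\<close> with \<open>l\<close>;
      moving the skew \<open>h l\<close> across the form leaves \<open>h l l\<close> and the minus
      sign.\<close>
    have t1: "(\<Sum>e\<in>E. \<Sum>g\<in>E. \<Sum>l\<in>E. sc (eps (dg e) (dg l)) (sc (form g l * ?f l e g) (io e))) = - ?T"
    proof -
      have "(\<Sum>g\<in>E. form g l * ?f l e g) = form (h l (dual e)) l" for e l
        by (subst (2) expand_dual[of l, symmetric]) (simp add: form_right)
      moreover have "eps (dg e) (dg l) * form (h l (dual e)) l = - form (h l l) (dual e)"
        if e: "e \<in> E" and l: "l \<in> E" for e l
      proof -
        have hl: "h l l \<in> V a" using so_degree[OF h[OF l] dg[OF l]] by simp
        have "form (h l (dual e)) l = - eps (a - dg l) (- dg e) * (eps (- dg e) a * form (h l l)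
            (dual e))"
          using so_form[OF h[OF l] dual_degree[OF e], of l] form_symmetric[OF dual_degree[OF e]
              hl] by simp
        then show ?thesis by (simp add: eps_simps mult.assoc eps_cancel mult.left_commute[of "eps
            (dg e) a"])
      qed
      ultimately have "(\<Sum>e\<in>E. \<Sum>l\<in>E. \<Sum>g\<in>E. sc (eps (dg e) (dg l)) (sc (form g l * ?f l e g) (io e))) =
          (\<Sum>e\<in>E. \<Sum>l\<in>E. - sc (form (h l l) (dual e)) (io e))"
        unfolding A.scale_sum_right[symmetric] A.scale_sum_left[symmetric]
        by (intro sum.cong refl) simp
      moreover have "(\<Sum>e\<in>E. \<Sum>g\<in>E. \<Sum>l\<in>E. sc (eps (dg e) (dg l)) (sc (form g l * ?f l e g) (io e))) =
          (\<Sum>e\<in>E. \<Sum>l\<in>E. \<Sum>g\<in>E. sc (eps (dg e) (dg l)) (sc (form g l * ?f l e g) (io e)))"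
        by (intro sum.cong refl sum.swap)
      moreover have "(\<Sum>e\<in>E. \<Sum>l\<in>E. - sc (form (h l l) (dual e)) (io e)) =
          (\<Sum>l\<in>E. \<Sum>e\<in>E. - sc (form (h l l) (dual e)) (io e))"
        by (rule sum.swap)
      moreover have "\<dots> = - ?T"
        by (simp only: sum_negf ex[symmetric] linear_map_sum[OF linear_io])
      ultimately show ?thesis by simp
    qed
    have t2: "(\<Sum>e\<in>E. \<Sum>g\<in>E. \<Sum>l\<in>E. sc (form e l) (sc (?f l e g) (io g))) = ?T"
    proof -
      have "(\<Sum>e\<in>E. \<Sum>g\<in>E. \<Sum>l\<in>E. sc (form e l) (sc (?f l e g) (io g))) =
          (\<Sum>e\<in>E. \<Sum>l\<in>E. \<Sum>g\<in>E. sc (form e l) (sc (?f l e g) (io g)))"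
        by (intro sum.cong refl sum.swap)
      also have "\<dots> = (\<Sum>e\<in>E. \<Sum>l\<in>E. sc (form e l) (io (h l (dual e))))"
        by (simp only: A.scale_sum_right[symmetric] ex[symmetric])
      also have "\<dots> = ?T" by (subst sum.swap) (rule T)
      finally show ?thesis .
    qed
    have t3: "(\<Sum>e\<in>E. \<Sum>g\<in>E. \<Sum>l\<in>E. sc (?f l e g) (io g * io e * io l)) = ?Y"
    proof -
      have "?Y = (\<Sum>l\<in>E. \<Sum>e\<in>E. \<Sum>g\<in>E. sc (?f l e g) (io g * io e * io l))" by (rule Y)
      also have "\<dots> = (\<Sum>e\<in>E. \<Sum>l\<in>E. \<Sum>g\<in>E. sc (?f l e g) (io g * io e * io l))" by (rule sum.swap)
      also have "\<dots> = (\<Sum>e\<in>E. \<Sum>g\<in>E. \<Sum>l\<in>E. sc (?f l e g) (io g * io e * io l))"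
        by (intro sum.cong refl sum.swap)
      finally show ?thesis by simp
    qed
    have "(\<Sum>e\<in>E. \<Sum>g\<in>E. \<Sum>l\<in>E. sc (eps (dg e) (dg l) * eps (dg g) (dg l) * ?f l e g) (io l * io g *
        io e)) =
       (\<Sum>e\<in>E. \<Sum>g\<in>E. \<Sum>l\<in>E. sc 2 (sc (eps (dg e) (dg l)) (sc (form g l * ?f l e g) (io e)))
       - sc 2 (sc (form e l) (sc (?f l e g) (io g))) + sc (?f l e g) (io g * io e * io l))"
      by (intro sum.cong refl prod)
    also have "\<dots> = sc 2 (- ?T) - sc 2 ?T + ?Y"
      unfolding sum.distrib sum_subtractf A.scale_sum_right[symmetric] t1 t2 t3 ..
    also have "\<dots> = ?Y - sc 4 ?T"
      using A.scale_left_distrib[of 2 2 ?T] by simp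
    finally show ?thesis .
  qed
  have f: "?f e g l = eps (dg e) (dg g) * ?f g e l - eps (dg e) (dg l) * eps (dg g) (dg l) * ?f l e g"
    if "e \<in> E" "g \<in> E" "l \<in> E" for e g l
  proof -
    have "x = y - z" if "x - y + z = 0" for x y z :: 'k
      using that by (simp add: add_eq_0_iff2 diff_eq_eq)
    then show ?thesis using cyc that unfolding cyclic_vanish_def by blast
  qed
  have "sc (?f e g l) x = sc (eps (dg e) (dg g) * ?f g e l) x
      - sc (eps (dg e) (dg l) * eps (dg g) (dg l) * ?f l e g) x"
    if "e \<in> E" "g \<in> E" "l \<in> E" for e g l x
    unfolding f[OF that] by (rule A.scale_left_diff_distrib)
  then have "?Y = (\<Sum>e\<in>E. \<Sum>g\<in>E. \<Sum>l\<in>E. sc (eps (dg e) (dg g) * ?f g e l) (io l * io g * io e)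
     - sc (eps (dg e) (dg l) * eps (dg g) (dg l) * ?f l e g) (io l * io g * io e))"
    unfolding Y by (intro sum.cong refl)
  also have "\<dots> = (\<Sum>e\<in>E. \<Sum>g\<in>E. sc (eps (dg e) (dg g)) (\<Sum>l\<in>E. sc (?f g e l) (io l * io g * io e)))
      - (?Y - sc 4 ?T)"
    unfolding sum_subtractf Y2 by (simp only: A.scale_sum_right A.scale_scale)
  also have "\<dots> = (\<Sum>e\<in>E. \<Sum>g\<in>E. sc (eps (dg e) (dg g)) (io (h g (dual e)) * io g * io e)) - (?Y - sc
      4 ?T)"
    by (simp only: ex[of "h _ (dual _)"] sum_distrib_right sc_mult_left)
  also have "\<dots> = sc 2 ?T - ?Y - (?Y - sc 4 ?T)" unfolding Y1 ..
  finally have "?Y + ?Y + ?Y = sc 6 ?T"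
    using A.scale_left_distrib[of 2 4 ?T] by (simp add: algebra_simps)
  moreover have "?Y + ?Y + ?Y = sc 3 ?Y"
    using A.scale_left_distrib[of 2 1 ?Y] A.scale_left_distrib[of 1 1 ?Y] by simp
  ultimately have "sc 3 ?Y = sc 3 (sc 2 ?T)" by simp
  then have Y': "?Y = sc 2 ?T" using three_nonzero by (simp only: A.scale_cancel_left) simp
  have "?Y = (\<Sum>e\<in>E. sc 4 (star (h e)) * io e)"
    by (simp add: sum_distrib_right[symmetric] four_star)
  then have "sc 4 (\<Sum>e\<in>E. star (h e) * io e) = sc 4 (sc (1 / 2) ?T)"
    unfolding Y' by (simp add: sc_mult A.scale_sum_right four_div_two)
  then show ?thesis using four_nonzero by (simp only: A.scale_cancel_left) simp
qed

end

section \<open>The cubic element and the Jacobiator of \<open>phi\<close>\<close>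

locale cubic_space = eps_symmetric_basis eps sv V form E
  for eps :: "'c::ab_group_add \<Rightarrow> 'c \<Rightarrow> 'k::field"
    and sv :: "'k \<Rightarrow> 'v::ab_group_add \<Rightarrow> 'v"
    and V :: "'c \<Rightarrow> 'v set"
    and form :: "'v \<Rightarrow> 'v \<Rightarrow> 'k"
    and E :: "'v set" +
  fixes phi :: "'v \<Rightarrow> 'v \<Rightarrow> 'v"
  assumes phi_bilinear: "bilinear_map sv sv sv phi"
    and phi_degree_zero: "degree_zero V V phi"
    and phi_antisymmetric: "eps_antisymmetric eps V sv phi"
    and phi_invariant: "\<lbrakk>v \<in> V a; w \<in> V b\<rbrakk> \<Longrightarrow>
        form (phi v w) z = - eps a b * form w (phi v z)"
begin

lemma linear_phi_right: "Vector_Spaces.linear sv sv (phi v)"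
  and linear_phi_left: "Vector_Spaces.linear sv sv (\<lambda>v. phi v w)"
  using phi_bilinear by (simp_all add: bilinear_map_def)

lemmas phi_right = linear_map_simps[OF linear_phi_right]
lemmas phi_left = linear_map_simps[OF linear_phi_left]

lemma phi_degree: "v \<in> V a \<Longrightarrow> w \<in> V b \<Longrightarrow> phi v w \<in> V (a + b)"
  using phi_degree_zero unfolding degree_zero_def by blast

lemma phi_swap: "v \<in> V a \<Longrightarrow> w \<in> V b \<Longrightarrow> phi v w = - sv (eps a b) (phi w v)"
  using phi_antisymmetric unfolding eps_antisymmetric_def by blast

lemma phi_so:
  assumes v: "v \<in> V a"
  shows "phi v \<in> so_comp eps sv V form a"
  using phi_degree[OF v] phi_invariant[OF v] by (simp add: so_comp_def linear_phi_right)

end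

locale cubic_model = clifford_model eps sv V form E sc u io + cubic_space eps sv V form E phi
  for eps :: "'c::ab_group_add \<Rightarrow> 'c \<Rightarrow> 'k::field"
    and sv :: "'k \<Rightarrow> 'v::ab_group_add \<Rightarrow> 'v"
    and V :: "'c \<Rightarrow> 'v set"
    and form :: "'v \<Rightarrow> 'v \<Rightarrow> 'k"
    and E :: "'v set"
    and sc :: "'k \<Rightarrow> 'r::ring \<Rightarrow> 'r" and u :: 'r and io :: "'v \<Rightarrow> 'r"
    and phi :: "'v \<Rightarrow> 'v \<Rightarrow> 'v"
begin

sublocale Phi: so_family eps sv V form E sc u io sv V form E phi
  by unfold_locales (simp_all add: phi_so phi_left)

text \<open>The explicit formula for the cubic term with its innermost sum carried out: invariance
  turns its coefficients into those of the vector \<open>phi (dual e) (dual g)\<close>. That this is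
  the quantised tensor is shown in \<open>quotient_endo_cubic\<close>.\<close>

definition psi :: 'r where
  "psi = sc (1 / 12) (\<Sum>e\<in>E. \<Sum>g\<in>E. io (phi (dual e) (dual g)) * io g * io e)"

lemma three_psi: "sc 3 psi = (\<Sum>e\<in>E. star (phi (dual e)) * io e)"
proof -
  have "(\<Sum>e\<in>E. star (phi (dual e)) * io e) =
      (\<Sum>e\<in>E. sc (1 / 4) (\<Sum>g\<in>E. io (phi (dual e) (dual g)) * io g) * io e)"
    by (simp only: star_def)
  also have "\<dots> = sc (1 / 4) (\<Sum>e\<in>E. \<Sum>g\<in>E. io (phi (dual e) (dual g)) * io g * io e)"
    by (simp only: sc_mult_left sum_distrib_right A.scale_sum_right)
  also have "(1 / 4 :: 'k) = 3 * (1 / 12)"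
  proof -
    have "x * (1 / (x * y)) = 1 / y" if "x \<noteq> 0" for x y :: 'k
      using that by (cases "y = 0") simp_all
    moreover have "(3::'k) * 4 = 12" by simp
    ultimately show ?thesis using three_nonzero by metis
  qed
  finally show ?thesis by (simp add: psi_def)
qed

text \<open>In the form of \<open>three_psi\<close>, moving \<open>io v\<close> past
  \<open>io e\<close> yields \<open>2 * star (phi v)\<close>, and moving it past the
  \<open>star\<close> factor yields \<open>4 * star (phi v)\<close> by antisymmetry of
  \<open>phi\<close>. Dividing the sum 6 by 3 leaves 2.\<close>

lemma psi_io:
  assumes v: "v \<in> V b"
  shows "psi * io v + io v * psi = sc 2 (star (phi v))"
proof -
  have e: "star (phi (dual e)) * io e * io v + io v * (star (phi (dual e)) * io e) =
      sc 2 (sc (form e v) (star (phi (dual e)))) + io (phi v (dual e)) * io e" if e: "e \<in> E" for e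
  proof -
    let ?F = "star (phi (dual e))"
    have 1: "?F * io e * io v = sc (2 * form e v) ?F - sc (eps (dg e) b) (?F * io v * io e)"
      using clifford_swap[OF dg[OF e] v] by (simp add: mult.assoc right_diff_distrib sc_mult)
    have 2: "?F * io v = sc (eps b (dg e)) (io v * ?F) + io (phi (dual e) v)"
      using star_io[OF phi_so[OF dual_degree[OF e]] v] by simp
    have 3: "io (phi (dual e) v) = - sc (eps b (dg e)) (io (phi v (dual e)))"
      using phi_swap[OF dual_degree[OF e] v] by (simp add: io)
    show ?thesis
      unfolding 1 2 3
      by (simp add: sc_ring distrib_right eps_inverse mult.assoc left_diff_distrib)
  qed
  have F: "(\<Sum>e\<in>E. sc (form e v) (star (phi (dual e)))) = star (phi v)"
    by (subst (2) expand_dual[of v, symmetric])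
      (simp add: linear_map_simps[OF linear_star[where f = phi, OF linear_phi_left]])
  have "sc 3 psi * io v + io v * sc 3 psi = sc 2 (star (phi v)) + sc 4 (star (phi v))"
    unfolding three_psi sum_distrib_left sum_distrib_right sum.distrib[symmetric]
    using F four_star[of "phi v"] by (simp add: e sum.distrib del: A.scale_scale flip:
        A.scale_sum_right)
  then have "sc 3 (psi * io v + io v * psi) = sc 3 (sc 2 (star (phi v)))"
    by (simp add: sc_ring flip: A.scale_left_distrib)
  then show ?thesis using three_nonzero by (simp only: A.scale_cancel_left) simp
qed

lemma psi_square_commutator:
  assumes v: "v \<in> V b"
  shows "psi * psi * io v - io v * (psi * psi) = sc 2 (psi * star (phi v) - star (phi v) * psi)"
proof -
  have "psi * io v = sc 2 (star (phi v)) - io v * psi" using psi_io[OF v] by (simp add: eq_diff_eq)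
  then have "psi * (psi * io v) = sc 2 (psi * star (phi v)) - (sc 2 (star (phi v)) - io v * psi) * psi"
    by (simp add: right_diff_distrib sc_mult flip: mult.assoc)
  then show ?thesis by (simp add: mult.assoc left_diff_distrib sc_ring)
qed

text \<open>The Jacobiator of \<open>\<phi>\<close> at \<open>v\<close> and \<open>w\<close> of degrees \<open>a\<close> and \<open>b\<close>.\<close>

definition dphi :: "'c \<Rightarrow> 'c \<Rightarrow> 'v \<Rightarrow> 'v \<Rightarrow> 'v \<Rightarrow> 'v" where
  "dphi a b v w z = phi v (phi w z) - sv (eps a b) (phi w (phi v z)) - phi (phi v w) z"

lemma dphi_so:
  assumes "v \<in> V a" "w \<in> V b"
  shows "dphi a b v w \<in> so_comp eps sv V form (a + b)"
  unfolding dphi_def[abs_def]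
  by (intro so_diff[OF so_bracket] phi_so phi_degree assms)

text \<open>Together with the skewness in \<open>dphi_so\<close> this makes
  \<open>form (dphi a b v w z) y\<close> totally antisymmetric in \<open>w\<close>,
  \<open>z\<close>, \<open>y\<close>, which collapses the cyclic sum in
  \<open>commutator_family_cyclic\<close>.\<close>

lemma dphi_swap:
  assumes v: "v \<in> V a" and w: "w \<in> V b" and z: "z \<in> V c"
  shows "dphi a b v w z = - sv (eps b c) (dphi a c v z w)"
proof -
  have 1: "sv (eps b c) (phi v (phi z w)) = - phi v (phi w z)"
    using phi_swap[OF w z] by (simp add: phi_right)
  have 2: "sv (eps b c) (sv (eps a c) (phi z (phi v w))) = - phi (phi v w) z"
    using phi_swap[OF phi_degree[OF v w] z] by (simp add: eps_simps mult.commute)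
  have 3: "sv (eps b c) (phi (phi v z) w) = - sv (eps a b) (phi w (phi v z))"
  proof -
    have "sv (eps b c) (phi (phi v z) w) = - sv (eps b c * (eps a b * eps c b)) (phi w (phi v z))"
      using phi_swap[OF phi_degree[OF v z] w] by (simp add: eps_simps)
    also have "eps b c * (eps a b * eps c b) = eps a b" by (simp add: eps_cancel)
    finally show ?thesis .
  qed
  show ?thesis
    unfolding dphi_def scale_right_diff_distrib 1 2 3 by simp
qed

text \<open>\<open>star (phi v)\<close> acts as a derivation on the words in
  \<open>three_psi\<close>. On the first factor it gives the bracket of \<open>phi v\<close> and
  \<open>phi (dual e)\<close>; on \<open>io e\<close>, after \<open>move_so\<close>, it gives
  \<open>- phi (phi v (dual e))\<close>. These are the parts of the Jacobiator.\<close>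

lemma star_phi_psi_commutator:
  assumes v: "v \<in> V b"
  shows "sc 3 (star (phi v) * psi - psi * star (phi v)) = (\<Sum>e\<in>E. star (dphi b (- dg e) v (dual e))
      * io e)"
proof -
  let ?S = "star (phi v)"
  have e: "?S * (star (phi (dual e)) * io e) - star (phi (dual e)) * io e * ?S =
      sc (eps (dg e) b) (star (phi (dual e)) * io (phi v e))
      + star (\<lambda>z. phi v (phi (dual e) z) - sv (eps b (- dg e)) (phi (dual e) (phi v z))) * io e"
    if e: "e \<in> E" for e
  proof -
    let ?F = "star (phi (dual e))"
    let ?b = "star (\<lambda>z. phi v (phi (dual e) z) - sv (eps b (- dg e)) (phi (dual e) (phi v z)))"
    have 1: "?S * ?F = sc (eps (dg e) b) (?F * ?S) + ?b"
      using star_star[OF phi_so[OF v] phi_so[OF dual_degree[OF e]]] by simp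
    have 2: "?S * io e = sc (eps b (dg e)) (io e * ?S) + io (phi v e)"
      by (rule star_io[OF phi_so[OF v] dg[OF e]])
    have "?S * (?F * io e) = sc (eps (dg e) b) (?F * (?S * io e)) + ?b * io e"
      by (simp add: 1 distrib_right sc_mult mult.assoc[symmetric])
    then show ?thesis
      unfolding 2 by (simp add: sc_ring distrib_left eps_inverse mult.assoc)
  qed
  have b: "bilinear_map sv sv sc (\<lambda>x y. star (phi x) * io y)"
    by (intro bilinear_mult linear_star linear_phi_left linear_io)
  have m: "(\<Sum>e\<in>E. sc (eps (dg e) b) (star (phi (dual e)) * io (phi v e))) =
      - (\<Sum>e\<in>E. star (phi (phi v (dual e))) * io e)"
    using move_so[OF b phi_so[OF v]] by simp
  have "sc 3 (?S * psi - psi * ?S) = ?S * sc 3 psi - sc 3 psi * ?S"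
    by (simp add: sc_ring)
  also have "\<dots> = (\<Sum>e\<in>E. ?S * (star (phi (dual e)) * io e) - star (phi (dual e)) * io e * ?S)"
    unfolding three_psi by (simp add: sum_distrib_left sum_distrib_right sum_subtractf)
  also have "\<dots> = (\<Sum>e\<in>E. star (\<lambda>z. phi v (phi (dual e) z) - sv (eps b (- dg e)) (phi (dual e) (phi
      v z))) * io e
      - star (phi (phi v (dual e))) * io e)"
    by (simp only: e sum.distrib m sum_subtractf cong: sum.cong) simp
  also have "\<dots> = (\<Sum>e\<in>E. star (dphi b (- dg e) v (dual e)) * io e)"
    by (intro sum.cong refl) (simp only: dphi_def[abs_def] star_diff left_diff_distrib)
  finally show ?thesis .
qed

text \<open>The contraction of an antisymmetric map with the symmetric canonical tensor is zero,
  which removes the first term of \<open>dphi\<close>; the other two cancel by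
  \<open>move_so\<close>. Hence \<open>phi\<close> adds no vector term when
  \<open>star_sum_if_cyclic_vanish\<close> is applied.\<close>

lemma dphi_trace:
  assumes v: "v \<in> V b"
  shows "(\<Sum>e\<in>E. dphi b (- dg e) v (dual e) e) = 0"
proof -
  have "(\<Sum>e\<in>E. phi (dual e) e) = (\<Sum>e\<in>E. sv (eps (dg e) (dg e)) (phi e (dual e)))"
    using symmetric_dual_tensor[OF phi_bilinear] by simp
  also have "\<dots> = - (\<Sum>e\<in>E. phi (dual e) e)"
    unfolding sum_negf[symmetric]
  proof (intro sum.cong refl)
    fix e assume e: "e \<in> E"
    show "sv (eps (dg e) (dg e)) (phi e (dual e)) = - phi (dual e) e"
      using phi_swap[OF dual_degree[OF e] dg[OF e]] by simp
  qed
  finally have "sv 2 (\<Sum>e\<in>E. phi (dual e) e) = 0"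
    using scale_left_distrib[of 1 1 "\<Sum>e\<in>E. phi (dual e) e"] by (simp add: eq_neg_iff_add_eq_0)
  then have 0: "(\<Sum>e\<in>E. phi (dual e) e) = 0" using two_nonzero by simp
  have "(\<Sum>e\<in>E. phi (phi v (dual e)) e) = - (\<Sum>e\<in>E. sv (eps (dg e) b) (phi (dual e) (phi v e)))"
    by (rule move_so[OF phi_bilinear phi_so[OF v]])
  moreover have "(\<Sum>e\<in>E. phi v (phi (dual e) e)) = 0"
    unfolding linear_map_sum[OF linear_phi_right, symmetric] 0 by (simp add: phi_right)
  ultimately show ?thesis by (simp add: dphi_def sum_subtractf)
qed

text \<open>In \<open>psi * (3 * psi)\<close>, with the right factor written by
  \<open>three_psi\<close>, \<open>psi\<close> is moved to the far right. Passing the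
  \<open>star\<close> factor leaves the commutator of \<open>psi * psi\<close> with
  \<open>dual e\<close>, hence the term \<open>euler\<close>. Passing \<open>io e\<close> leaves
  \<open>2 * star (phi e)\<close>, hence the Casimir element, and changes the sign, so that the two
  copies of \<open>6 * psi * psi\<close> add.\<close>

lemma psi_square_euler: "sc 12 (psi * psi) = sc 4 Phi.casimir_element + euler (psi * psi)"
proof -
  let ?W = Phi.casimir_element
  have e: "sc 2 (psi * (star (phi (dual e)) * io e)) =
      sc 4 (star (phi (dual e)) * star (phi e)) - sc 2 (star (phi (dual e)) * io e * psi)
      + (psi * psi * io (dual e) - io (dual e) * (psi * psi)) * io e" if e: "e \<in> E" for e
  proof -
    let ?F = "star (phi (dual e))"
    have "(psi * psi * io (dual e) - io (dual e) * (psi * psi)) * io e =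
        sc 2 (psi * (?F * io e)) - sc 2 (?F * (psi * io e))"
      unfolding psi_square_commutator[OF dual_degree[OF e]]
      by (simp add: left_diff_distrib sc_ring mult.assoc)
    moreover have "psi * io e = sc 2 (star (phi e)) - io e * psi"
      using psi_io[OF dg[OF e]] by (simp add: eq_diff_eq)
    ultimately show ?thesis by (simp add: right_diff_distrib sc_ring mult.assoc)
  qed
  have "sc 2 (psi * sc 3 psi) = (\<Sum>e\<in>E. sc 2 (psi * (star (phi (dual e)) * io e)))"
    unfolding three_psi sum_distrib_left A.scale_sum_right ..
  also have "\<dots> = sc 4 ?W - sc 2 (sc 3 psi * psi) + euler (psi * psi)"
    unfolding three_psi euler_def Phi.casimir_element_def sum_distrib_right A.scale_sum_right
    by (simp only: e sum.distrib sum_subtractf cong: sum.cong)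
  finally have "sc 6 (psi * psi) + sc 6 (psi * psi) = sc 4 ?W + euler (psi * psi)"
    by (simp add: sc_mult algebra_simps)
  then show ?thesis by (simp flip: A.scale_left_distrib)
qed

end

section \<open>The moment map and the commutator of the Dirac square with a vector\<close>

locale moment_model = cubic_model eps sv V form E sc u io phi + so_family eps sv V form E sc u io
    sg G B X rep
  for eps :: "'c::ab_group_add \<Rightarrow> 'c \<Rightarrow> 'k::field"
    and sv :: "'k \<Rightarrow> 'v::ab_group_add \<Rightarrow> 'v"
    and V :: "'c \<Rightarrow> 'v set"
    and form :: "'v \<Rightarrow> 'v \<Rightarrow> 'k"
    and E :: "'v set"
    and sc :: "'k \<Rightarrow> 'r::ring \<Rightarrow> 'r" and u :: 'r and io :: "'v \<Rightarrow> 'r"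
    and phi :: "'v \<Rightarrow> 'v \<Rightarrow> 'v"
    and sg :: "'k \<Rightarrow> 'x::ab_group_add \<Rightarrow> 'x"
    and G :: "'c \<Rightarrow> 'x set"
    and B :: "'x \<Rightarrow> 'x \<Rightarrow> 'k"
    and X :: "'x set"
    and rep :: "'x \<Rightarrow> 'v \<Rightarrow> 'v" +
  fixes mu :: "'v \<Rightarrow> 'v \<Rightarrow> 'x"
  assumes mu_bilinear: "bilinear_map sv sv sg mu"
    and mu_degree_zero: "degree_zero V G mu"
    and mu_moment: "B x (mu v w) = form (rep x v) w"
begin

lemma mu_degree: "v \<in> V a \<Longrightarrow> w \<in> V b \<Longrightarrow> mu v w \<in> G (a + b)"
  using mu_degree_zero unfolding degree_zero_def by blast

text \<open>The component in \<open>V\<close> of the Jacobi identity for three vectors, divided by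
  the sign \<open>eps c a\<close>; see \<open>jacobiator_VVV\<close>.\<close>

definition jacobi_V :: bool where
  "jacobi_V \<longleftrightarrow> (\<forall>a b c. \<forall>v\<in>V a. \<forall>w\<in>V b. \<forall>z\<in>V c.
     dphi a b v w z = rep (mu v w) z + sv (eps a (b + c)) (rep (mu w z) v) - sv (eps b c) (rep (mu
         v z) w))"

text \<open>The family \<open>h\<close> of the overview. The 2 is that of
  \<open>casimir_commutator\<close>; \<open>- 2 / 3\<close> combines the 2 of
  \<open>psi_square_commutator\<close>, with reversed order, and the 3 of
  \<open>star_phi_psi_commutator\<close>.\<close>

definition commutator_family :: "'c \<Rightarrow> 'v \<Rightarrow> 'v \<Rightarrow> 'v \<Rightarrow> 'v" where
  "commutator_family a v e z = sv 2 (rep (mu v (dual e)) z) - sv (2 / 3) (dphi a (- dg e) v (dual e) z)"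

lemma commutator_family_so:
  assumes v: "v \<in> V a" and e: "e \<in> E"
  shows "commutator_family a v e \<in> so_comp eps sv V form (a - dg e)"
  unfolding commutator_family_def[abs_def]
  using family_so[OF mu_degree[OF v dual_degree[OF e]]] dphi_so[OF v dual_degree[OF e]]
  by (intro so_diff so_scale) simp_all

lemma mu_expand:
  assumes L: "Vector_Spaces.linear sg t L"
  shows "L (mu v w) = (\<Sum>x\<in>X. t (form (rep x v) w) (L (Y.dual x)))"
  by (subst Y.expand_dual[of "mu v w", symmetric]) (simp add: linear_map_simps[OF L] mu_moment)

text \<open>By its defining property \<open>mu\<close> is the transpose of the action, so the
  canonical tensor of \<open>G\<close> can be traded for that of \<open>V\<close>.\<close>

lemma family_moment:
  "(\<Sum>x\<in>X. star (rep (Y.dual x)) * io (rep x v)) = (\<Sum>e\<in>E. star (rep (mu v (dual e))) * io e)"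
proof -
  have "(\<Sum>x\<in>X. star (rep (Y.dual x)) * io (rep x v)) =
      (\<Sum>x\<in>X. star (rep (Y.dual x)) * io (\<Sum>e\<in>E. sv (form (rep x v) (dual e)) e))"
    by (simp only: expand_basis)
  also have "\<dots> = (\<Sum>x\<in>X. \<Sum>e\<in>E. sc (form (rep x v) (dual e)) (star (rep (Y.dual x)) * io e))"
    by (simp add: io sum_distrib_left sc_mult)
  also have "\<dots> = (\<Sum>e\<in>E. \<Sum>x\<in>X. sc (form (rep x v) (dual e)) (star (rep (Y.dual x)) * io e))"
    by (rule sum.swap)
  also have "\<dots> = (\<Sum>e\<in>E. star (rep (mu v (dual e))) * io e)"
    by (simp only: mu_expand[OF linear_star[where f = rep, OF family_linear]] sum_distrib_right sc_mult)
  finally show ?thesis .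
qed

lemma casimir_operator_moment: "casimir_operator v = (\<Sum>e\<in>E. rep (mu v (dual e)) e)"
proof -
  have "casimir_operator v = (\<Sum>x\<in>X. rep (Y.dual x) (\<Sum>e\<in>E. sv (form (rep x v) (dual e)) e))"
    by (simp only: expand_basis casimir_operator_def)
  also have "\<dots> = (\<Sum>x\<in>X. \<Sum>e\<in>E. sv (form (rep x v) (dual e)) (rep (Y.dual x) e))"
    by (simp add: linear_map_simps[OF family_linear_right])
  also have "\<dots> = (\<Sum>e\<in>E. \<Sum>x\<in>X. sv (form (rep x v) (dual e)) (rep (Y.dual x) e))"
    by (rule sum.swap)
  also have "\<dots> = (\<Sum>e\<in>E. rep (mu v (dual e)) e)"
    by (simp only: mu_expand[OF family_linear])
  finally show ?thesis .
qed

abbreviation dirac_square :: 'r where "dirac_square \<equiv> casimir_element + psi * psi"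

lemma dirac_square_commutator:
  assumes v: "v \<in> V a"
  shows "dirac_square * io v - io v * dirac_square = (\<Sum>e\<in>E. star (commutator_family a v e) * io e)
      - io (casimir_operator v)"
proof -
  let ?D = "\<Sum>e\<in>E. star (dphi a (- dg e) v (dual e)) * io e"
  have "psi * psi * io v - io v * (psi * psi) = sc (- (2 / 3)) (sc 3 (star (phi v) * psi - psi *
      star (phi v)))"
    unfolding psi_square_commutator[OF v] A.scale_scale mult_minus_left
      nonzero_eq_divide_eq[OF three_nonzero, THEN iffD1, OF refl]
    by (simp add: A.scale_right_diff_distrib)
  then have "psi * psi * io v - io v * (psi * psi) = - sc (2 / 3) ?D"
    unfolding star_phi_psi_commutator[OF v] by simp
  moreover have "casimir_element * io v - io v * casimir_element =
      sc 2 (\<Sum>e\<in>E. star (rep (mu v (dual e))) * io e) - io (casimir_operator v)"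
    unfolding casimir_commutator[OF v] family_moment ..
  moreover have "(\<Sum>e\<in>E. star (commutator_family a v e) * io e) =
      sc 2 (\<Sum>e\<in>E. star (rep (mu v (dual e))) * io e) - sc (2 / 3) ?D"
    by (simp add: commutator_family_def[abs_def] star_diff star_scale left_diff_distrib
        sum_subtractf sc_mult A.scale_sum_right)
  moreover have "dirac_square * io v - io v * dirac_square = (casimir_element * io v - io v *
      casimir_element)
      + (psi * psi * io v - io v * (psi * psi))"
    by (simp add: algebra_simps)
  ultimately show ?thesis by simp
qed

text \<open>The Jacobiator is totally antisymmetric, so its three terms agree and
  \<open>3 * 2 / 3\<close> becomes the same 2 that stands before the moment part. In that part,
  \<open>form (rep (mu (dual e) (dual g)) v) (dual l)\<close> is the value of \<open>B\<close> on
  two moments, and the symmetry of \<open>B\<close> identifies it with the third cyclic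
  term.\<close>

lemma commutator_family_cyclic:
  assumes v: "v \<in> V a" and e: "e \<in> E" and g: "g \<in> E" and l: "l \<in> E"
  shows "form (commutator_family a v e (dual g)) (dual l) - eps (dg e) (dg g) * form
      (commutator_family a v g (dual e)) (dual l)
      + eps (dg e) (dg l) * eps (dg g) (dg l) * form (commutator_family a v l (dual e)) (dual g) =
    2 * (form (rep (mu v (dual e)) (dual g) + sv (eps a (- dg e - dg g)) (rep (mu (dual e) (dual g)) v)
        - sv (eps (dg e) (dg g)) (rep (mu v (dual g)) (dual e))) (dual l)
      - form (dphi a (- dg e) v (dual e) (dual g)) (dual l))"
proof -
  let ?d = "\<lambda>e g l. form (dphi a (- dg e) v (dual e) (dual g)) (dual l)"
  let ?m = "\<lambda>e g l. form (rep (mu v (dual e)) (dual g)) (dual l)"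
  have d1: "eps (dg x) (dg y) * ?d y x z = - ?d x y z" if "x \<in> E" "y \<in> E" for x y z
    using dphi_swap[OF v dual_degree[OF that(1)] dual_degree[OF that(2)]] by (simp add: form_left)
  have d2: "?d e l g = - (eps (dg l) (dg g) * ?d e g l)"
  proof -
    have D: "dphi a (- dg e) v (dual e) \<in> so_comp eps sv V form (a - dg e)"
      using dphi_so[OF v dual_degree[OF e]] by simp
    have "?d e l g = - eps (dg l) (a - dg e) * (eps (a - dg e - dg g) (dg l) * ?d e g l)"
      using so_form[OF D dual_degree[OF l], of "dual g"]
        form_symmetric[OF dual_degree[OF l] so_degree_dual[OF D g]] by simp
    also have "\<dots> = - (eps (dg l) (dg g) * ?d e g l)"
      by (simp add: eps_simps mult_ac eps_cancel)
    finally show ?thesis .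
  qed
  have d3: "eps (dg e) (dg l) * eps (dg g) (dg l) * ?d l e g = ?d e g l"
  proof -
    have "eps (dg e) (dg l) * eps (dg g) (dg l) * ?d l e g = eps (dg g) (dg l) * (- ?d e l g)"
      unfolding d1[OF e l, symmetric] by simp
    then show ?thesis unfolding d2 by (simp add: eps_cancel)
  qed
  have m: "eps a (- dg e - dg g) * form (rep (mu (dual e) (dual g)) v) (dual l) =
      eps (dg e) (dg l) * eps (dg g) (dg l) * ?m l e g"
  proof -
    have "form (rep (mu (dual e) (dual g)) v) (dual l) = B (mu (dual e) (dual g)) (mu v (dual l))"
      by (simp add: mu_moment)
    also have "\<dots> = eps (- dg e - dg g) (a - dg l) * B (mu v (dual l)) (mu (dual e) (dual g))"
      using Y.form_symmetric[OF mu_degree[OF dual_degree[OF e] dual_degree[OF g]] mu_degree[OF v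
          dual_degree[OF l]]]
      by simp
    finally have "form (rep (mu (dual e) (dual g)) v) (dual l) = eps (- dg e - dg g) (a - dg l) *
        ?m l e g"
      by (simp add: mu_moment)
    then show ?thesis by (simp add: eps_simps mult_ac eps_cancel eps_inverse)
  qed
  have h: "form (commutator_family a v x y) z = 2 * form (rep (mu v (dual x)) y) z - 2 / 3 * form
      (dphi a (- dg x) v (dual x) y) z" for x y z
    by (simp add: commutator_family_def form_left)
  have ring: "(2 * m1 - t * d0) - p * (2 * m2 - t * d2) + q * (2 * m3 - t * d3) =
      2 * (m1 + q * m3 - p * m2) - t * (d0 - p * d2 + q * d3)" for m1 m2 m3 d0 d2 d3 p q t :: 'k
    by (simp add: algebra_simps)
  have "2 / 3 * (?d e g l - eps (dg e) (dg g) * ?d g e l + eps (dg e) (dg l) * eps (dg g) (dg l) *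
      ?d l e g)
      = 2 * ?d e g l"
    unfolding d3 d1[OF e g] using three_nonzero by (simp add: divide_simps)
  then show ?thesis
    unfolding h ring by (simp add: form_left m right_diff_distrib)
qed

lemma cyclic_vanish_commutator_family_iff:
  assumes v: "v \<in> V a"
  shows "cyclic_vanish (commutator_family a v) \<longleftrightarrow> (\<forall>e\<in>E. \<forall>g\<in>E. dphi a (- dg e) v (dual e) (dual g) =
     rep (mu v (dual e)) (dual g) + sv (eps a (- dg e - dg g)) (rep (mu (dual e) (dual g)) v)
        - sv (eps (dg e) (dg g)) (rep (mu v (dual g)) (dual e)))"
  unfolding cyclic_vanish_def
  using two_nonzero eq_on_dual_form by (simp add: commutator_family_cyclic[OF v]) metis

lemma jacobi_V_iff: "jacobi_V \<longleftrightarrow> (\<forall>a. \<forall>v\<in>V a. cyclic_vanish (commutator_family a v))"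
proof
  assume J: jacobi_V
  show "\<forall>a. \<forall>v\<in>V a. cyclic_vanish (commutator_family a v)"
  proof (intro allI ballI)
    fix a v assume v: "v \<in> V a"
    show "cyclic_vanish (commutator_family a v)"
      unfolding cyclic_vanish_commutator_family_iff[OF v]
    proof (intro ballI)
      fix e g assume "e \<in> E" "g \<in> E"
      then have "dual e \<in> V (- dg e)" "dual g \<in> V (- dg g)" by (simp_all add: dual_degree)
      with J v show "dphi a (- dg e) v (dual e) (dual g) =
         rep (mu v (dual e)) (dual g) + sv (eps a (- dg e - dg g)) (rep (mu (dual e) (dual g)) v)
        - sv (eps (dg e) (dg g)) (rep (mu v (dual g)) (dual e))"
        unfolding jacobi_V_def by (metis eps_minus_left eps_minus_right uminus_add_conv_diff
            add.commute diff_conv_add_uminus)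
    qed
  qed
next
  assume C: "\<forall>a. \<forall>v\<in>V a. cyclic_vanish (commutator_family a v)"
  note repl = linear_map_simps[OF family_linear] linear_map_simps[OF family_linear_right]
  have mul: "\<And>w. Vector_Spaces.linear sv sg (\<lambda>v. mu v w)" and mur: "\<And>v. Vector_Spaces.linear sv sg
      (mu v)"
    using mu_bilinear by (simp_all add: bilinear_map_def)
  note mus = linear_map_simps[OF mul] linear_map_simps[OF mur]
  show jacobi_V
    unfolding jacobi_V_def
  proof (intro allI ballI)
    fix a b c v w z assume v: "v \<in> V a" and w: "w \<in> V b" and z: "z \<in> V c"
    let ?L = "\<lambda>w z. dphi a b v w z - rep (mu v w) z - sv (eps a (b + c)) (rep (mu w z) v) + sv
        (eps b c) (rep (mu v z) w)"
    have l1: "Vector_Spaces.linear sv sv (\<lambda>w. ?L w z)" for z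
      by unfold_locales (simp_all add: dphi_def repl mus phi_left phi_right algebra_simps)
    have l2: "Vector_Spaces.linear sv sv (\<lambda>z. ?L w z)" for w
      by unfold_locales (simp_all add: dphi_def repl mus phi_left phi_right algebra_simps)
    have "?L w z = 0"
    proof (rule linear_zero_on_comp[OF l1 w])
      fix e assume e: "e \<in> E" "dg e = - b"
      show "?L (dual e) z = 0"
      proof (rule linear_zero_on_comp[OF l2 z])
        fix g assume g: "g \<in> E" "dg g = - c"
        have "dphi a (- dg e) v (dual e) (dual g) =
         rep (mu v (dual e)) (dual g) + sv (eps a (- dg e - dg g)) (rep (mu (dual e) (dual g)) v)
        - sv (eps (dg e) (dg g)) (rep (mu v (dual g)) (dual e))"
          using C v e g cyclic_vanish_commutator_family_iff[OF v] by blast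
        then show "?L (dual e) (dual g) = 0" by (simp add: e g)
      qed
    qed
    then show "dphi a b v w z = rep (mu v w) z + sv (eps a (b + c)) (rep (mu w z) v) - sv (eps b
        c) (rep (mu v z) w)"
      by (simp add: algebra_simps add_eq_0_iff)
  qed
qed

theorem scalar_iff_jacobi_V:
  assumes unit: "u \<noteq> 0"
  shows "(\<exists>c. dirac_square = sc c u) \<longleftrightarrow> jacobi_V"
proof
  assume "\<exists>c. dirac_square = sc c u"
  then obtain c where c: "dirac_square = sc c u" ..
  show jacobi_V
    unfolding jacobi_V_iff
  proof (intro allI ballI)
    fix a v assume v: "v \<in> V a"
    have "dirac_square * io v - io v * dirac_square = 0" unfolding c by (simp add: sc_mult unit_io)
    then have "(\<Sum>e\<in>E. star (commutator_family a v e) * io e) = io (casimir_operator v)"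
      unfolding dirac_square_commutator[OF v] by simp
    then show "cyclic_vanish (commutator_family a v)"
      using cyclic_vanish_if_vector[OF unit _ casimir_operator_degree[OF v], of "commutator_family
          a v"] commutator_family_so[OF v] by blast
  qed
next
  assume jacobi_V
  have comm: "dirac_square * io v - io v * dirac_square = 0" if v: "v \<in> V a" for v a
  proof -
    \<comment> \<open>This 2 meets the \<open>1 / 2\<close> of
      \<open>star_sum_if_cyclic_vanish\<close>, so the cubic sum cancels the vector term of the
      commutator exactly.\<close>
    have "(\<Sum>e\<in>E. commutator_family a v e e) = sv 2 (casimir_operator v)"
      using dphi_trace[OF v]
      by (simp add: commutator_family_def sum_subtractf casimir_operator_moment flip: scale_sum_right)
    moreover have "cyclic_vanish (commutator_family a v)" using \<open>jacobi_V\<close> v unfolding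
        jacobi_V_iff by blast
    note star_sum_if_cyclic_vanish[OF commutator_family_so[OF v] this]
    ultimately show ?thesis
      unfolding dirac_square_commutator[OF v] using two_nonzero by (simp add: io)
  qed
  note el = linear_map_simps[OF linear_euler]
  let ?O = casimir_element and ?W = Phi.casimir_element and ?P = "psi * psi"
  obtain c1 where c1: "euler ?O = sc 8 ?O + sc c1 u" using euler_casimir by blast
  obtain c2 where c2: "euler ?W = sc 8 ?W + sc c2 u" using Phi.euler_casimir by blast
  have "euler dirac_square = 0" unfolding euler_def using comm[OF dual_degree] by simp
  then have P: "euler ?P = - sc 8 ?O - sc c1 u" by (simp add: el c1 add_eq_0_iff)
  \<comment> \<open>Since \<open>euler ?P\<close> is \<open>- 8 * ?O\<close> up to scalars,
    \<open>euler\<close> multiplies it by 8, just as it does \<open>?W\<close>. Applying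
    \<open>euler\<close> to \<open>psi_square_euler\<close> therefore multiplies the right-hand
    side, which is \<open>12 * ?P\<close>, by 8; this is the origin of
    \<open>96 = 12 * 8\<close>.\<close>
  have "sc 12 (euler ?P) = sc 4 (euler ?W) + euler (euler ?P)"
    using arg_cong[OF psi_square_euler, of euler] by (simp only: el)
  also have "\<dots> = sc 8 (sc 4 ?W + euler ?P) + sc (4 * c2) u"
    unfolding P c2 by (simp add: el c1 euler_unit A.scale_right_distrib A.scale_right_diff_distrib)
  also have "sc 4 ?W + euler ?P = sc 12 ?P" by (rule psi_square_euler[symmetric])
  finally have "sc 12 (- sc 8 ?O - sc c1 u) = sc 8 (sc 12 ?P) + sc (4 * c2) u" unfolding P .
  then have "sc 96 ?O + sc 96 ?P = - sc (12 * c1) u - sc (4 * c2) u"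
  proof -
    assume "sc 12 (- sc 8 ?O - sc c1 u) = sc 8 (sc 12 ?P) + sc (4 * c2) u"
    then have "sc 96 ?P + sc (4 * c2) u = - sc 96 ?O - sc (12 * c1) u"
      by (simp add: A.scale_right_diff_distrib)
    then have "sc 96 ?P = - sc 96 ?O - sc (12 * c1) u - sc (4 * c2) u"
      by (simp only: eq_diff_eq)
    then show ?thesis by simp
  qed
  then have eq: "sc 96 dirac_square = sc (- (12 * c1) - 4 * c2) u"
    by (simp add: A.scale_right_distrib A.scale_left_diff_distrib)
  have "(96::'k) \<noteq> 0"
  proof -
    have "(96::'k) = 4 * 4 * 2 * 3" by simp
    then show ?thesis using two_nonzero three_nonzero four_nonzero by (metis mult_eq_0_iff)
  qed
  then have "sc (1 / 96) (sc 96 dirac_square) = dirac_square" by simp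
  then have "dirac_square = sc (1 / 96 * (- (12 * c1) - 4 * c2)) u"
    unfolding eq A.scale_scale by (rule sym)
  then show "\<exists>c. dirac_square = sc c u" ..
qed

end

section \<open>The quotient algebra inside an endomorphism ring\<close>

text \<open>A linear choice of representatives modulo \<open>S\<close>: a basis of \<open>S\<close>
  is extended to the whole space, and the map kills the former and fixes the added vectors.\<close>

lemma (in vector_space) projection_along_subspace:
  assumes "subspace S"
  shows "\<exists>f. Vector_Spaces.linear scale scale f \<and> (\<forall>p. p - f p \<in> S) \<and> (\<forall>p\<in>S. f p = 0)"
proof -
  interpret p: vector_space_pair scale scale by unfold_locales
  obtain B where B: "B \<subseteq> S" "independent B" "S \<subseteq> span B"
    using maximal_independent_subset[of S] by metis
  obtain f where f: "Vector_Spaces.linear scale scale f"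
    and fB: "\<forall>x\<in>extend_basis B. f x = (if x \<in> B then 0 else x)"
    using p.linear_independent_extend[OF independent_extend_basis[OF B(2)], of "\<lambda>x. if x \<in> B then
        0 else x"]
    by blast
  note flin = linear_map_simps[OF f]
  have "f p = 0" if "p \<in> S" for p
  proof -
    have "p \<in> span B" using B(3) that by blast
    then show ?thesis
    proof (rule span_induct)
      show "subspace {x. f x = 0}" by (simp add: subspace_def flin)
      show "f x = 0" if "x \<in> B" for x
        using fB extend_basis_superset[OF B(2)] that by auto
    qed
  qed
  moreover have "p - f p \<in> S" for p
  proof -
    have "p \<in> span (extend_basis B)" using span_extend_basis[OF B(2)] by simp
    then show ?thesis
    proof (rule span_induct)
      show "subspace {x. x - f x \<in> S}"
        unfolding subspace_def
      proof (intro conjI ballI allI)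
        show "0 \<in> {x. x - f x \<in> S}" using subspace_0[OF assms] by (simp add: flin)
        show "x + y \<in> {x. x - f x \<in> S}" if "x \<in> {x. x - f x \<in> S}" "y \<in> {x. x - f x \<in> S}" for x y
          using subspace_add[OF assms, of "x - f x" "y - f y"] that by (simp add: flin algebra_simps)
        show "scale c x \<in> {x. x - f x \<in> S}" if "x \<in> {x. x - f x \<in> S}" for x c
          using subspace_scale[OF assms, of "x - f x" c] that by (simp add: flin algebra_simps)
      qed
      show "x - f x \<in> S" if "x \<in> extend_basis B" for x
        using fB B(1) that subspace_0[OF assms] by (cases "x \<in> B") auto
    qed
  qed
  ultimately show ?thesis using f by blast
qed

text \<open>The Clifford algebra depends on the terms \<open>V\<close> and \<open>form\<close> and
  so cannot itself be a type of class \<open>ring\<close>. The endomorphisms of the free algebra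
  form such a type and contain an isomorphic copy of it.\<close>

typedef (overloaded) ('v, 'k::field) word_endo =
  "{f :: ('v list \<Rightarrow>\<^sub>0 'k) \<Rightarrow> ('v list \<Rightarrow>\<^sub>0 'k). Vector_Spaces.linear word_scale word_scale f}"
  by (rule exI[of _ "\<lambda>p. p"]) (simp add: words.linear_ident)

lemma linear_Rep_word_endo: "Vector_Spaces.linear word_scale word_scale (Rep_word_endo f)"
  using Rep_word_endo[of f] by simp

lemma Rep_Abs_word_endo:
  "Vector_Spaces.linear word_scale word_scale f \<Longrightarrow> Rep_word_endo (Abs_word_endo f) = f"
  by (simp add: Abs_word_endo_inverse)

definition endo_scale :: "'k::field \<Rightarrow> ('v, 'k) word_endo \<Rightarrow> ('v, 'k) word_endo" where
  "endo_scale c f = Abs_word_endo (\<lambda>p. word_scale c (Rep_word_endo f p))"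

lemma Rep_endo_scale: "Rep_word_endo (endo_scale c f) p = word_scale c (Rep_word_endo f p)"
proof -
  have "Vector_Spaces.linear word_scale word_scale (\<lambda>p. word_scale c (Rep_word_endo f p))"
    by unfold_locales
      (simp_all add: linear_map_simps[OF linear_Rep_word_endo] words.scale_right_distrib mult.commute)
  then show ?thesis by (simp add: endo_scale_def Rep_Abs_word_endo)
qed

instantiation word_endo :: (type, field) ring
begin

definition zero_word_endo :: "('a, 'b) word_endo" where
  "0 = Abs_word_endo (\<lambda>p. 0)"
definition plus_word_endo :: "('a, 'b) word_endo \<Rightarrow> ('a, 'b) word_endo \<Rightarrow> ('a, 'b) word_endo" where
  "f + g = Abs_word_endo (\<lambda>p. Rep_word_endo f p + Rep_word_endo g p)"
definition uminus_word_endo :: "('a, 'b) word_endo \<Rightarrow> ('a, 'b) word_endo" where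
  "- f = Abs_word_endo (\<lambda>p. - Rep_word_endo f p)"
definition minus_word_endo :: "('a, 'b) word_endo \<Rightarrow> ('a, 'b) word_endo \<Rightarrow> ('a, 'b) word_endo" where
  "f - g = Abs_word_endo (\<lambda>p. Rep_word_endo f p - Rep_word_endo g p)"
definition times_word_endo :: "('a, 'b) word_endo \<Rightarrow> ('a, 'b) word_endo \<Rightarrow> ('a, 'b) word_endo" where
  "f * g = Abs_word_endo (\<lambda>p. Rep_word_endo f (Rep_word_endo g p))"

lemma Rep_word_endo_simps:
  fixes f g :: "('a, 'b) word_endo"
  shows "Rep_word_endo (0 :: ('a, 'b) word_endo) p = 0"
    "Rep_word_endo (f + g) p = Rep_word_endo f p + Rep_word_endo g p"
    "Rep_word_endo (- f) p = - Rep_word_endo f p"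
    "Rep_word_endo (f - g) p = Rep_word_endo f p - Rep_word_endo g p"
    "Rep_word_endo (f * g) p = Rep_word_endo f (Rep_word_endo g p)"
proof -
  note lin = linear_map_simps[OF linear_Rep_word_endo]
  have "Vector_Spaces.linear word_scale word_scale (\<lambda>p :: 'a list \<Rightarrow>\<^sub>0 'b. 0 :: 'a list \<Rightarrow>\<^sub>0 'b)"
    by unfold_locales simp_all
  then show "Rep_word_endo (0 :: ('a, 'b) word_endo) p = 0"
    by (simp add: zero_word_endo_def Rep_Abs_word_endo)
  have "Vector_Spaces.linear word_scale word_scale (\<lambda>p. Rep_word_endo f p + Rep_word_endo g p)"
    by unfold_locales (simp_all add: lin algebra_simps)
  then show "Rep_word_endo (f + g) p = Rep_word_endo f p + Rep_word_endo g p"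
    by (simp add: plus_word_endo_def Rep_Abs_word_endo)
  have "Vector_Spaces.linear word_scale word_scale (\<lambda>p. - Rep_word_endo f p)"
    by unfold_locales (simp_all add: lin)
  then show "Rep_word_endo (- f) p = - Rep_word_endo f p"
    by (simp add: uminus_word_endo_def Rep_Abs_word_endo)
  have "Vector_Spaces.linear word_scale word_scale (\<lambda>p. Rep_word_endo f p - Rep_word_endo g p)"
    by unfold_locales (simp_all add: lin algebra_simps)
  then show "Rep_word_endo (f - g) p = Rep_word_endo f p - Rep_word_endo g p"
    by (simp add: minus_word_endo_def Rep_Abs_word_endo)
  have "Vector_Spaces.linear word_scale word_scale (\<lambda>p. Rep_word_endo f (Rep_word_endo g p))"
    by unfold_locales (simp_all add: lin)
  then show "Rep_word_endo (f * g) p = Rep_word_endo f (Rep_word_endo g p)"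
    by (simp add: times_word_endo_def Rep_Abs_word_endo)
qed

instance
  by standard
    (simp_all add: Rep_word_endo_inject[symmetric] fun_eq_iff Rep_word_endo_simps
      linear_map_simps[OF linear_Rep_word_endo] algebra_simps)

end

lemma word_endo_eqI: "(\<And>p. Rep_word_endo f p = Rep_word_endo g p) \<Longrightarrow> f = g"
  by (simp add: Rep_word_endo_inject[symmetric] fun_eq_iff)

lemma vector_space_endo_scale: "vector_space endo_scale"
  by unfold_locales
    (rule word_endo_eqI, simp add: Rep_endo_scale Rep_word_endo_simps
      words.scale_right_distrib words.scale_left_distrib)+

lemma endo_scale_mult: "endo_scale c f * g = endo_scale c (f * g)" "f * endo_scale c g =
    endo_scale c (f * g)"
  by (rule word_endo_eqI, simp add: Rep_endo_scale Rep_word_endo_simps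
      linear_map_simps[OF linear_Rep_word_endo])+

definition ideal_projection :: "('v list \<Rightarrow>\<^sub>0 'k::field) set \<Rightarrow> ('v list \<Rightarrow>\<^sub>0 'k) \<Rightarrow> ('v list \<Rightarrow>\<^sub>0 'k)" where
  "ideal_projection S = (SOME f. Vector_Spaces.linear word_scale word_scale f \<and>
     (\<forall>p. p - f p \<in> word_ideal S) \<and> (\<forall>p\<in>word_ideal S. f p = 0))"

lemma ideal_projection:
  shows linear_ideal_projection: "Vector_Spaces.linear word_scale word_scale (ideal_projection S)"
    and ideal_projection_diff: "p - ideal_projection S p \<in> word_ideal S"
    and ideal_projection_zero: "p \<in> word_ideal S \<Longrightarrow> ideal_projection S p = 0"
  using someI_ex[OF words.projection_along_subspace[OF subspace_word_ideal[of S]]]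
  unfolding ideal_projection_def by blast+

text \<open>The left regular representation of the quotient algebra, written on the representatives
  chosen by \<open>ideal_projection\<close>. It is faithful on the quotient, as its value at the
  word \<open>1\<close> represents \<open>p\<close>; the image of 1 is the projection itself and not
  the identity.\<close>

definition quotient_endo :: "('v list \<Rightarrow>\<^sub>0 'k::field) set \<Rightarrow> ('v list \<Rightarrow>\<^sub>0 'k) \<Rightarrow> ('v, 'k) word_endo" where
  "quotient_endo S p = Abs_word_endo (\<lambda>q. ideal_projection S (p * q))"

lemma Rep_quotient_endo: "Rep_word_endo (quotient_endo S p) q = ideal_projection S (p * q)"
proof -
  have "Vector_Spaces.linear word_scale word_scale (\<lambda>q. ideal_projection S (p * q))"
    by unfold_locales
      (simp_all add: linear_map_simps[OF linear_ideal_projection] word_scale_mult_right distrib_left)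
  then show ?thesis by (simp add: quotient_endo_def Rep_Abs_word_endo)
qed

lemma linear_quotient_endo: "Vector_Spaces.linear word_scale endo_scale (quotient_endo S)"
proof -
  interpret e: vector_space endo_scale by (rule vector_space_endo_scale)
  show ?thesis
    by unfold_locales
      (rule word_endo_eqI, simp add: Rep_quotient_endo Rep_word_endo_simps Rep_endo_scale
        linear_map_simps[OF linear_ideal_projection] word_scale_mult_left distrib_right)+
qed

lemma quotient_endo_mult: "quotient_endo S (p * q) = quotient_endo S p * quotient_endo S q"
proof (rule word_endo_eqI)
  fix r
  have "p * (q * r - ideal_projection S (q * r)) \<in> word_ideal S"
    by (rule word_ideal_mult_left[OF ideal_projection_diff])
  from ideal_projection_zero[OF this]
  have "ideal_projection S (p * (q * r)) = ideal_projection S (p * ideal_projection S (q * r))"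
    by (simp add: right_diff_distrib linear_map_simps[OF linear_ideal_projection])
  then show "Rep_word_endo (quotient_endo S (p * q)) r = Rep_word_endo (quotient_endo S p *
      quotient_endo S q) r"
    by (simp add: Rep_quotient_endo Rep_word_endo_simps mult.assoc)
qed

lemma quotient_endo_zero_iff: "quotient_endo S p = 0 \<longleftrightarrow> p \<in> word_ideal S"
proof
  assume "quotient_endo S p = 0"
  then have "Rep_word_endo (quotient_endo S p) 1 = 0" by (simp add: Rep_word_endo_simps)
  then show "p \<in> word_ideal S"
    using ideal_projection_diff[of p S] by (simp add: Rep_quotient_endo)
next
  assume "p \<in> word_ideal S"
  then show "quotient_endo S p = 0"
    by (intro word_endo_eqI)
      (simp add: Rep_quotient_endo Rep_word_endo_simps ideal_projection_zero word_ideal_mult_right)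
qed

lemma quotient_endo_eq_iff: "quotient_endo S p = quotient_endo S q \<longleftrightarrow> p - q \<in> word_ideal S"
  using quotient_endo_zero_iff[of S "p - q"] by (simp add: linear_map_simps[OF linear_quotient_endo])

lemma quotient_class_eq_iff_endo:
  "quotient_class s R p = quotient_class s R q \<longleftrightarrow>
    quotient_endo (linear_relations s \<union> R) p = quotient_endo (linear_relations s \<union> R) q"
  by (simp add: quotient_class_eq_iff quotient_endo_eq_iff)

lemma word_ideal_linear_relations:
  assumes "vector_space s"
  shows "Poly_Mapping.single [v + w] 1 - Poly_Mapping.single [v] 1 - Poly_Mapping.single [w] 1
      \<in> word_ideal (linear_relations s \<union> R)"
    and "Poly_Mapping.single [s c v] 1 - Poly_Mapping.single [v] c \<in> word_ideal (linear_relations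
        s \<union> R)"
  by (rule word_ideal_base, auto simp: linear_relations_def)+

lemma linear_quotient_endo_generator:
  assumes "vector_space s"
  shows "Vector_Spaces.linear s endo_scale (\<lambda>v. quotient_endo (linear_relations s \<union> R)
      (Poly_Mapping.single [v] 1))"
proof -
  interpret s: vector_space s by fact
  interpret e: vector_space endo_scale by (rule vector_space_endo_scale)
  note lin = linear_map_simps[OF linear_quotient_endo]
  show ?thesis
  proof unfold_locales
    fix v w c
    show "quotient_endo (linear_relations s \<union> R) (Poly_Mapping.single [v + w] 1) =
        quotient_endo (linear_relations s \<union> R) (Poly_Mapping.single [v] 1) +
        quotient_endo (linear_relations s \<union> R) (Poly_Mapping.single [w] 1)"
      unfolding lin(1)[symmetric] quotient_endo_eq_iff
      using word_ideal_linear_relations(1)[OF assms] by (simp add: diff_diff_add)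
    have "quotient_endo (linear_relations s \<union> R) (Poly_Mapping.single [s c v] 1) =
        quotient_endo (linear_relations s \<union> R) (word_scale c (Poly_Mapping.single [v] 1))"
      unfolding quotient_endo_eq_iff
      using word_ideal_linear_relations(2)[OF assms] by simp
    then show "quotient_endo (linear_relations s \<union> R) (Poly_Mapping.single [s c v] 1) =
        endo_scale c (quotient_endo (linear_relations s \<union> R) (Poly_Mapping.single [v] 1))"
      by (simp only: lin)
  qed
qed

section \<open>The Clifford algebra is not trivial\<close>

text \<open>
  The Clifford algebra acts on the exterior algebra: a basis vector \<open>x\<close> acts by multiplication by
  \<open>x\<close> plus contraction with \<open>x\<close>.
\<close>

context eps_symmetric_basis
begin

text \<open>The exterior algebra is modelled on words without linear relations between letters. The
  action only inserts letters from \<open>E\<close>; any other letter gets coefficient 0, which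
  keeps the contraction defined on all words.\<close>

definition contract_coeff :: "'v \<Rightarrow> 'v \<Rightarrow> 'k" where
  "contract_coeff x e = (if e \<in> E then form x e else 0)"

lemma contract_coeff_eps:
  assumes "x \<in> E"
  shows "contract_coeff x e * f (dg x) = contract_coeff x e * f (- dg e)"
proof (cases "e \<in> E")
  case True
  then show ?thesis using form_eps[OF dg[OF assms] dg[OF True], of f] by (simp add: contract_coeff_def)
qed (simp add: contract_coeff_def)

fun contract_word :: "'v \<Rightarrow> 'v list \<Rightarrow> ('v list \<Rightarrow>\<^sub>0 'k)" where
  "contract_word x [] = 0"
| "contract_word x (e # w) = Poly_Mapping.single w (contract_coeff x e)
     - word_scale (eps (dg x) (dg e)) (Poly_Mapping.single [e] 1 * contract_word x w)"

definition contraction :: "'v \<Rightarrow> ('v list \<Rightarrow>\<^sub>0 'k) \<Rightarrow> ('v list \<Rightarrow>\<^sub>0 'k)" where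
  "contraction x = linear_extension word_scale (contract_word x)"

lemma linear_contraction: "Vector_Spaces.linear word_scale word_scale (contraction x)"
  unfolding contraction_def by (rule words.linear_linear_extension)

lemmas contraction = linear_map_simps[OF linear_contraction]

lemma contraction_single: "contraction x (Poly_Mapping.single w c) = word_scale c (contract_word x w)"
  by (simp add: contraction_def words.linear_extension_single)

lemma contraction_Cons:
  "contraction x (Poly_Mapping.single [e] 1 * p) = word_scale (contract_coeff x e) p
     - word_scale (eps (dg x) (dg e)) (Poly_Mapping.single [e] 1 * contraction x p)"
  by (induction p rule: poly_mapping_induct_single)
    (simp_all add: distrib_left contraction single_mult_list contraction_single
      words.scale_right_distrib words.scale_right_diff_distrib word_scale_mult_right mult.commute)

lemma contraction_anticommute:
  assumes x: "x \<in> E" and y: "y \<in> E"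
  shows "contraction x (contraction y p) = - word_scale (eps (dg x) (dg y)) (contraction y
      (contraction x p))"
proof -
  have w: "contraction x (contraction y (Poly_Mapping.single w 1)) =
      - word_scale (eps (dg x) (dg y)) (contraction y (contraction x (Poly_Mapping.single w 1)))" for w
  proof (induction w)
    case Nil
    then show ?case by (simp add: contraction_single contraction)
  next
    case (Cons e w)
    let ?p = "Poly_Mapping.single w (1::'k)" and ?e = "Poly_Mapping.single [e] (1::'k)"
    have split: "Poly_Mapping.single (e # w) 1 = ?e * ?p" by (simp add: single_mult_list)
    have two: "contraction a (contraction b (?e * ?p)) =
        word_scale (contract_coeff b e) (contraction a ?p)
        - word_scale (eps (dg b) (dg e) * contract_coeff a e) (contraction b ?p)
        + word_scale (eps (dg b) (dg e) * eps (dg a) (dg e)) (?e * contraction a (contraction b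
            ?p))" for a b
      by (simp only: contraction_Cons contraction words.scale_right_diff_distrib words.scale_scale) simp
    have 1: "contract_coeff y e = eps (dg x) (dg y) * (eps (dg x) (dg e) * contract_coeff y e)"
      using contract_coeff_eps[OF y, of e "\<lambda>d. eps (dg x) d"] by (auto simp: eps_inverse mult_ac)
    have 2: "eps (dg x) (dg y) * contract_coeff x e = eps (dg y) (dg e) * contract_coeff x e"
      using contract_coeff_eps[OF x, of e "\<lambda>d. eps d (dg y)"] by (simp add: mult_ac)
    show ?case
      unfolding split two words.scale_right_diff_distrib words.scale_right_distrib words.scale_scale
      using Cons.IH 1 2
      by (auto simp: word_scale_mult_right mult_ac)
  qed
  show ?thesis
  proof (induction p rule: poly_mapping_induct_single)
    case zero
    then show ?case by (simp add: contraction)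
  next
    case (add p v c)
    have "Poly_Mapping.single v c = word_scale c (Poly_Mapping.single v 1)" by simp
    then show ?case
      using add w[of v]
      by (simp only: contraction words.scale_right_distrib words.scale_minus_right minus_add_distrib)
        (simp add: words.scale_left_commute)
  qed
qed

text \<open>A presentation on the basis letters alone. All its relations are homogeneous of length
  two, which makes it evident that \<open>1\<close> survives in the quotient.\<close>

definition basis_exterior_relations :: "('v list \<Rightarrow>\<^sub>0 'k) set" where
  "basis_exterior_relations =
     {Poly_Mapping.single [e, f] 1 + Poly_Mapping.single [f, e] (eps (dg e) (dg f)) | e f. e \<in> E \<and>
         f \<in> E}"

abbreviation "ext_ideal \<equiv> word_ideal basis_exterior_relations"

text \<open>The contractions of the two words of a generator cancel, because a non-zero pairing
  forces opposite degrees. Contraction thus passes through a generator up to a scalar.\<close>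

lemma contraction_ext_ideal:
  assumes x: "x \<in> E" and p: "p \<in> ext_ideal"
  shows "contraction x p \<in> ext_ideal"
proof -
  have g: "contraction x (g * q) = word_scale c (g * contraction x q)"
    if "e \<in> E" "f \<in> E" "g = Poly_Mapping.single [e, f] 1 + Poly_Mapping.single [f, e] (eps (dg e)
        (dg f))"
      "c = eps (dg x) (dg e) * eps (dg x) (dg f)" for g e f c q
  proof -
    let ?e = "Poly_Mapping.single [e] (1::'k)" and ?f = "Poly_Mapping.single [f] (1::'k)"
    have "Poly_Mapping.single [f, e] (eps (dg e) (dg f)) = word_scale (eps (dg e) (dg f)) (?f * ?e)"
      by (simp add: single_mult_list)
    then have gg: "g = ?e * ?f + word_scale (eps (dg e) (dg f)) (?f * ?e)"
      using that by (simp add: single_mult_list)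
    have 1: "contract_coeff x e = eps (dg e) (dg f) * (eps (dg x) (dg f) * contract_coeff x e)"
      using contract_coeff_eps[OF x, of e "\<lambda>d. eps d (dg f)"] by (auto simp: eps_inverse mult_ac)
    have 2: "eps (dg x) (dg e) * contract_coeff x f = eps (dg e) (dg f) * contract_coeff x f"
      using contract_coeff_eps[OF x, of f "\<lambda>d. eps d (dg e)"] by (simp add: mult_ac)
    have "contraction x (?e * (?f * q)) = word_scale (contract_coeff x e) (?f * q)
       - word_scale (eps (dg x) (dg e) * contract_coeff x f) (?e * q) + word_scale c (?e * (?f *
           contraction x q))"
      by (simp add: contraction_Cons words.scale_right_diff_distrib right_diff_distrib
          word_scale_mult_right that)
    moreover have "word_scale (eps (dg e) (dg f)) (contraction x (?f * (?e * q))) =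
       word_scale (eps (dg e) (dg f) * contract_coeff x f) (?e * q)
       - word_scale (contract_coeff x e) (?f * q) + word_scale c (word_scale (eps (dg e) (dg f))
           (?f * (?e * contraction x q)))"
      unfolding contraction_Cons that using 1
      by (auto simp: words.scale_right_diff_distrib right_diff_distrib word_scale_mult_right mult_ac)
    ultimately show ?thesis
      unfolding gg
      by (simp add: distrib_right word_scale_mult_left mult.assoc contraction
          words.scale_right_distrib 2)
  qed
  have w: "contraction x (Poly_Mapping.single a 1 * r) \<in> ext_ideal"
    if "r \<in> ext_ideal" "contraction x r \<in> ext_ideal" for a r
  proof (induction a)
    case Nil
    then show ?case using that by (simp add: single_Nil_one)
  next
    case (Cons e a)
    have "Poly_Mapping.single (e # a) 1 * r = Poly_Mapping.single [e] 1 * (Poly_Mapping.single a 1 * r)"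
      by (simp add: single_mult_list flip: mult.assoc)
    then show ?case
      using Cons that
      by (simp add: contraction_Cons word_ideal_diff word_ideal_scale word_ideal_mult_left)
  qed
  show ?thesis
    using p
  proof (induction rule: word_ideal.induct)
    case zero
    then show ?case by (simp add: contraction word_ideal.zero)
  next
    case (step p h a c b d)
    then obtain e f where ef: "e \<in> E" "f \<in> E"
      "h = Poly_Mapping.single [e, f] 1 + Poly_Mapping.single [f, e] (eps (dg e) (dg f))"
      by (auto simp: basis_exterior_relations_def)
    have h: "h \<in> ext_ideal" using step.hyps(2) by (rule word_ideal_base)
    have "contraction x (h * Poly_Mapping.single b d) \<in> ext_ideal"
      unfolding g[OF ef refl] by (intro word_ideal_scale word_ideal_mult_right h)
    then have "contraction x (Poly_Mapping.single a 1 * (h * Poly_Mapping.single b d)) \<in> ext_ideal"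
      by (intro w word_ideal_mult_right h)
    moreover have "Poly_Mapping.single a c * h * Poly_Mapping.single b d =
        word_scale c (Poly_Mapping.single a 1 * (h * Poly_Mapping.single b d))"
      by (simp add: word_scale_mult_left[symmetric] mult.assoc)
    ultimately show ?case
      using step.IH by (simp add: contraction word_ideal_add word_ideal_scale)
  qed
qed

definition clifford_act :: "'v \<Rightarrow> ('v list \<Rightarrow>\<^sub>0 'k) \<Rightarrow> ('v list \<Rightarrow>\<^sub>0 'k)" where
  "clifford_act v p = (\<Sum>e\<in>E. word_scale (form v (dual e)) (Poly_Mapping.single [e] 1 * p +
      contraction e p))"

lemma linear_clifford_act: "Vector_Spaces.linear word_scale word_scale (clifford_act v)"
  by unfold_locales
    (simp_all add: clifford_act_def distrib_left contraction words.scale_right_distrib sum.distrib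
      words.scale_sum_right word_scale_mult_right algebra_simps)

lemmas clifford_act = linear_map_simps[OF linear_clifford_act]

lemma clifford_act_left:
  "clifford_act (v + w) p = clifford_act v p + clifford_act w p"
  "clifford_act (scale c v) p = word_scale c (clifford_act v p)"
  by (simp_all add: clifford_act_def form_left words.scale_left_distrib sum.distrib
      words.scale_sum_right)

lemma clifford_act_ext_ideal: "p \<in> ext_ideal \<Longrightarrow> clifford_act v p \<in> ext_ideal"
  unfolding clifford_act_def
  by (rule words.subspace_sum[OF subspace_word_ideal])
    (simp add: word_ideal_scale word_ideal_add word_ideal_mult_left contraction_ext_ideal)

text \<open>For basis vectors, two contractions anticommute, the mixed terms add up to
  \<open>2 * form e f\<close>, and two multiplications leave an exterior relation; hence the
  identity modulo \<open>ext_ideal\<close>. The general case follows by expansion, the signs being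
  constant where the coordinates do not vanish.\<close>

lemma clifford_act_relation:
  assumes v: "v \<in> V a" and w: "w \<in> V b"
  shows "clifford_act v (clifford_act w p) + word_scale (eps a b) (clifford_act w (clifford_act v p))
     - word_scale (2 * form v w) p \<in> ext_ideal"
proof -
  let ?v = "\<lambda>e. form v (dual e)" and ?w = "\<lambda>e. form w (dual e)"
  let ?c = "\<lambda>e p. Poly_Mapping.single [e] (1::'k) * p + contraction e p"
  let ?g = "\<lambda>e f. Poly_Mapping.single [e, f] 1 + Poly_Mapping.single [f, e] (eps (dg e) (dg f))"
  have ef: "?c e (?c f p) + word_scale (eps (dg e) (dg f)) (?c f (?c e p)) = ?g e f * p +
      word_scale (2 * form e f) p"
    if e: "e \<in> E" and f: "f \<in> E" for e f p
  proof -
    have sym: "eps (dg e) (dg f) * form f e = form e f"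
      using form_symmetric[OF dg[OF e] dg[OF f]] by simp
    have an: "contraction e (contraction f p) = - word_scale (eps (dg e) (dg f)) (contraction f
        (contraction e p))"
      by (rule contraction_anticommute[OF e f])
    have gp: "?g e f * p = Poly_Mapping.single [e] 1 * (Poly_Mapping.single [f] 1 * p)
       + word_scale (eps (dg e) (dg f)) (Poly_Mapping.single [f] 1 * (Poly_Mapping.single [e] 1 * p))"
      by (simp add: distrib_right single_mult_list word_scale_mult_left[symmetric] flip: mult.assoc)
    show ?thesis
      unfolding gp
      by (simp add: contraction distrib_left words.scale_right_distrib words.scale_right_diff_distrib
          contraction_Cons an contract_coeff_def e f sym eps_inverse eps_cancel mult.assoc
          words.scale_left_distrib[symmetric])
  qed
  have vw: "(\<Sum>e\<in>E. \<Sum>f\<in>E. ?v e * ?w f * form e f) = form v w"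
  proof -
    have "form v w = (\<Sum>e\<in>E. ?v e * form e w)"
      by (subst expand_basis[of v, symmetric]) (simp add: form_left)
    moreover have "form e w = (\<Sum>f\<in>E. ?w f * form e f)" for e
      by (subst expand_basis[of w, symmetric]) (simp add: form_right)
    ultimately show ?thesis by (simp add: sum_distrib_left mult.assoc)
  qed
  have eps: "?v e * ?w f * eps a b = ?v e * ?w f * eps (dg e) (dg f)" if e: "e \<in> E" and f: "f \<in> E"
      for e f
  proof -
    have "?v e * eps a b = ?v e * eps (dg e) b"
      using form_eps[OF v dual_degree[OF e], of "\<lambda>d. eps d b"] by simp
    moreover have "?w f * eps (dg e) b = ?w f * eps (dg e) (dg f)"
      using form_eps[OF w dual_degree[OF f], of "\<lambda>d. eps (dg e) d"] by simp
    ultimately show ?thesis by (auto simp: mult_ac)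
  qed
  have c2: "clifford_act x (clifford_act y p) = (\<Sum>e\<in>E. \<Sum>f\<in>E. word_scale (form x (dual e) * form y
      (dual f)) (?c e (?c f p)))" for x y
    by (simp add: clifford_act_def[of x] clifford_act_def[of y] sum_distrib_left contraction
        words.scale_sum_right
        word_scale_mult_right words.scale_right_distrib sum.distrib distrib_left)
  have "clifford_act v (clifford_act w p) + word_scale (eps a b) (clifford_act w (clifford_act v p)) =
     (\<Sum>e\<in>E. \<Sum>f\<in>E. word_scale (?v e * ?w f) (?c e (?c f p)) + word_scale (?v e * ?w f * eps a b)
         (?c f (?c e p)))"
    unfolding c2[of v w] c2[of w v] sum.distrib
    by (subst sum.swap[of _ E E]) (simp add: words.scale_sum_right mult_ac)
  also have "\<dots> = (\<Sum>e\<in>E. \<Sum>f\<in>E. word_scale (?v e * ?w f) (?g e f * p) + word_scale (2 * (?v e * ?w f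
      * form e f)) p)"
  proof (intro sum.cong refl)
    fix e f assume e: "e \<in> E" and f: "f \<in> E"
    have "word_scale (?v e * ?w f) (?c e (?c f p)) + word_scale (?v e * ?w f * eps a b) (?c f (?c
        e p)) =
       word_scale (?v e * ?w f) (?c e (?c f p) + word_scale (eps (dg e) (dg f)) (?c f (?c e p)))"
      unfolding eps[OF e f] by (simp only: words.scale_right_distrib words.scale_scale)
    then show "word_scale (?v e * ?w f) (?c e (?c f p)) + word_scale (?v e * ?w f * eps a b) (?c f
        (?c e p)) =
       word_scale (?v e * ?w f) (?g e f * p) + word_scale (2 * (?v e * ?w f * form e f)) p"
      unfolding ef[OF e f] by (simp add: words.scale_right_distrib mult_ac)
  qed
  also have "\<dots> = (\<Sum>e\<in>E. \<Sum>f\<in>E. word_scale (?v e * ?w f) (?g e f * p)) + word_scale (2 * form v w) p"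
    unfolding vw[symmetric] by (simp add: sum.distrib words.scale_sum_left sum_distrib_left)
  finally have eq: "clifford_act v (clifford_act w p) + word_scale (eps a b) (clifford_act w
      (clifford_act v p))
      - word_scale (2 * form v w) p = (\<Sum>e\<in>E. \<Sum>f\<in>E. word_scale (?v e * ?w f) (?g e f * p))"
    by simp
  have "?g e f \<in> ext_ideal" if "e \<in> E" "f \<in> E" for e f
    by (rule word_ideal_base) (use that in \<open>auto simp: basis_exterior_relations_def\<close>)
  then show ?thesis
    unfolding eq by (intro words.subspace_sum[OF subspace_word_ideal] word_ideal_scale
        word_ideal_mult_right)
qed

abbreviation "clifford_ideal \<equiv> word_ideal (linear_relations scale \<union> clifford_relations eps V form)"

text \<open>Words act through \<open>clifford_act\<close>, and the Clifford ideal maps the word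
  \<open>1\<close> into \<open>ext_ideal\<close>. If it contained 1, then 1 would lie in
  \<open>ext_ideal\<close>, whose members have no constant term.\<close>

lemma one_notin_clifford_ideal: "1 \<notin> clifford_ideal"
proof
  let ?act = "\<lambda>w q. foldr clifford_act w q"
  let ?Act = "\<lambda>p q. linear_extension word_scale (\<lambda>w. ?act w q) p"
  have lin: "Vector_Spaces.linear word_scale word_scale (\<lambda>p. ?Act p q)" for q
    by (rule words.linear_linear_extension)
  have act_add: "?act w (p + q) = ?act w p + ?act w q" "?act w (word_scale c p) = word_scale c
      (?act w p)" for w p q c
    by (induction w) (simp_all add: clifford_act)
  have Act: "?Act (Poly_Mapping.single a c * g * Poly_Mapping.single b d) q =
      word_scale (c * d) (?act a (?Act g (?act b q)))" for a c g b d q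
  proof (induction g rule: poly_mapping_induct_single)
    case zero
    have "?act a 0 = 0" using act_add(2)[of a 0 0] by simp
    then show ?case by (simp add: linear_map_simps[OF lin])
  next
    case (add p w e)
    then show ?case
      by (simp add: distrib_left distrib_right linear_map_simps[OF lin] act_add
          words.scale_right_distrib
          single_mult_list words.linear_extension_single mult_ac)
  qed
  have act_ideal: "?act w p \<in> ext_ideal" if "p \<in> ext_ideal" for w p
    using that by (induction w) (simp_all add: clifford_act_ext_ideal)
  have gen: "?Act g q \<in> ext_ideal" if "g \<in> linear_relations scale \<union> clifford_relations eps V form"
      for g q
    using that
  proof
    assume "g \<in> linear_relations scale"
    then show ?thesis
      by (auto simp: linear_relations_def linear_map_simps[OF lin] words.linear_extension_single
          clifford_act_left word_ideal.zero)
  next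
    assume "g \<in> clifford_relations eps V form"
    then obtain x y a b where "x \<in> V a" "y \<in> V b"
      and "g = Poly_Mapping.single [x, y] 1 + Poly_Mapping.single [y, x] (eps a b) -
          Poly_Mapping.single [] (2 * form x y)"
      by (auto simp: clifford_relations_def)
    then show ?thesis
      using clifford_act_relation[of x a y b q]
      by (simp add: linear_map_simps[OF lin] words.linear_extension_single)
  qed
  have Act_ideal: "?Act p 1 \<in> ext_ideal" if "p \<in> clifford_ideal" for p
    using that
  proof (induction rule: word_ideal.induct)
    case zero
    then show ?case by (simp add: linear_map_simps[OF lin] word_ideal.zero)
  next
    case (step p g a c b d)
    then show ?case
      by (simp add: linear_map_simps(1)[OF lin] Act word_ideal_add word_ideal_scale act_ideal gen)
  qed
  assume "1 \<in> clifford_ideal"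
  from Act_ideal[OF this] have "(1 :: 'v list \<Rightarrow>\<^sub>0 'k) \<in> ext_ideal"
    by (simp add: words.linear_extension_single flip: single_Nil_one)
  moreover have "Poly_Mapping.lookup p [] = 0" if "p \<in> ext_ideal" for p
    using that
  proof (induction rule: word_ideal.induct)
    case (step p g a c b d)
    then show ?case
      by (auto simp: basis_exterior_relations_def lookup_add distrib_left distrib_right
          single_mult_list lookup_single)
  qed simp
  ultimately have "Poly_Mapping.lookup (1 :: 'v list \<Rightarrow>\<^sub>0 'k) [] = 0" by blast
  then show False by (simp add: lookup_single flip: single_Nil_one)
qed

lemma clifford_model_quotient_endo:
  assumes "(2::'k) \<noteq> 0" "(3::'k) \<noteq> 0"
  defines "S \<equiv> linear_relations scale \<union> clifford_relations eps V form"
  shows "clifford_model eps scale V form E endo_scale (quotient_endo S 1)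
    (\<lambda>v. quotient_endo S (Poly_Mapping.single [v] 1))"
proof (rule clifford_model.intro[OF eps_symmetric_basis_axioms clifford_model_axioms.intro])
  interpret e: vector_space endo_scale by (rule vector_space_endo_scale)
  note lin = linear_map_simps[OF linear_quotient_endo]
  show "vector_space endo_scale" by (rule vector_space_endo_scale)
  show "Vector_Spaces.linear scale endo_scale (\<lambda>v. quotient_endo S (Poly_Mapping.single [v] 1))"
    unfolding S_def by (rule linear_quotient_endo_generator[OF vector_space_axioms])
  show "quotient_endo S (Poly_Mapping.single [v] 1) * quotient_endo S (Poly_Mapping.single [w] 1) +
      endo_scale (eps a b) (quotient_endo S (Poly_Mapping.single [w] 1) * quotient_endo S
          (Poly_Mapping.single [v] 1)) =
      endo_scale (2 * form v w) (quotient_endo S 1)" if "v \<in> V a" "w \<in> V b" for v w a b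
  proof -
    have "Poly_Mapping.single [v, w] 1 + Poly_Mapping.single [w, v] (eps a b) -
        Poly_Mapping.single [] (2 * form v w)
        \<in> word_ideal S"
      by (rule word_ideal_base) (use that in \<open>auto simp: S_def clifford_relations_def\<close>)
    then have "quotient_endo S (Poly_Mapping.single [v, w] 1 + word_scale (eps a b)
        (Poly_Mapping.single [w, v] 1)) =
        quotient_endo S (word_scale (2 * form v w) 1)"
      by (simp add: quotient_endo_eq_iff word_scale_one)
    then show ?thesis
      by (simp only: lin) (simp add: single_mult_list flip: quotient_endo_mult)
  qed
qed (use assms in \<open>simp_all add: endo_scale_mult flip: quotient_endo_mult\<close>)

end

section \<open>The morphism from the enveloping algebra\<close>

definition word_hom :: "('x \<Rightarrow> ('v list \<Rightarrow>\<^sub>0 'k::field)) \<Rightarrow> ('x list \<Rightarrow>\<^sub>0 'k) \<Rightarrow> ('v list \<Rightarrow>\<^sub>0 'k)" where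
  "word_hom g = linear_extension word_scale (\<lambda>w. foldr (\<lambda>x q. g x * q) w 1)"

lemma linear_word_hom: "Vector_Spaces.linear word_scale word_scale (word_hom g)"
  unfolding word_hom_def by (rule words.linear_linear_extension)

lemmas word_hom = linear_map_simps[OF linear_word_hom]

lemma word_hom_single:
  "word_hom g (Poly_Mapping.single w c) = word_scale c (foldr (\<lambda>x q. g x * q) w 1)"
  by (simp add: word_hom_def words.linear_extension_single)

lemma word_hom_mult: "word_hom g (p * q) = word_hom g p * word_hom g q"
proof -
  have app: "foldr (\<lambda>x q. g x * q) (v @ w) 1 = foldr (\<lambda>x q. g x * q) v 1 * foldr (\<lambda>x q. g x * q) w
      1" for v w
    by (induction v) (simp_all add: mult.assoc)
  have single: "word_hom g (Poly_Mapping.single w c * q) = word_hom g (Poly_Mapping.single w c) *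
      word_hom g q" for w c
    by (induction q rule: poly_mapping_induct_single)
      (simp_all add: distrib_left word_hom single_mult_list word_hom_single app
        word_scale_mult_left word_scale_mult_right mult.commute del: foldr_append)
  show ?thesis
    by (induction p rule: poly_mapping_induct_single)
      (simp_all add: distrib_right word_hom single)
qed

lemma word_hom_word_ideal:
  assumes "\<And>g. g \<in> S \<Longrightarrow> word_hom f g \<in> word_ideal T" and "p \<in> word_ideal S"
  shows "word_hom f p \<in> word_ideal T"
  using assms(2)
  by induction
    (simp_all add: word_hom word_ideal.zero word_ideal_add word_hom_mult word_ideal_mult_left
      word_ideal_mult_right assms(1))

lemma quotient_ring_hom_exists:
  assumes f: "\<And>g. g \<in> linear_relations s \<union> R \<Longrightarrow> word_hom f g \<in> word_ideal (linear_relations t \<union> T)"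
  shows "\<exists>h\<in>ring_hom (quotient_algebra s R) (quotient_algebra t T).
    \<forall>p. h (quotient_class s R p) = quotient_class t T (word_hom f p)"
proof
  let ?h = "\<lambda>c. quotient_class t T (word_hom f (SOME p. c = quotient_class s R p))"
  have h: "?h (quotient_class s R p) = quotient_class t T (word_hom f p)" for p
  proof -
    let ?q = "SOME q. quotient_class s R p = quotient_class s R q"
    have "quotient_class s R p = quotient_class s R ?q" by (rule someI) (rule refl)
    then have "word_hom f (p - ?q) \<in> word_ideal (linear_relations t \<union> T)"
      by (intro word_hom_word_ideal[OF f]) (simp_all add: quotient_class_eq_iff)
    then have "quotient_class t T (word_hom f p) = quotient_class t T (word_hom f ?q)"
      by (simp add: quotient_class_eq_iff word_hom)
    then show ?thesis by simp
  qed
  show "\<forall>p. ?h (quotient_class s R p) = quotient_class t T (word_hom f p)" using h by blast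
  show "?h \<in> ring_hom (quotient_algebra s R) (quotient_algebra t T)"
  proof (rule ring_hom_memI)
    fix x y
    assume "x \<in> carrier (quotient_algebra s R)" "y \<in> carrier (quotient_algebra s R)"
    then obtain p q where pq: "x = quotient_class s R p" "y = quotient_class s R q"
      by (auto simp: carrier_quotient_algebra)
    show "?h x \<in> carrier (quotient_algebra t T)" by (auto simp: carrier_quotient_algebra)
    show "?h (x \<otimes>\<^bsub>quotient_algebra s R\<^esub> y) = ?h x \<otimes>\<^bsub>quotient_algebra t T\<^esub> ?h y"
      unfolding pq quotient_class_mult[symmetric] h word_hom_mult ..
    show "?h (x \<oplus>\<^bsub>quotient_algebra s R\<^esub> y) = ?h x \<oplus>\<^bsub>quotient_algebra t T\<^esub> ?h y"
      unfolding pq quotient_class_add[symmetric] h word_hom ..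
  next
    have "word_hom f 1 = 1"
      using word_hom_single[of f "[]" 1] by (simp add: single_Nil_one)
    then show "?h \<one>\<^bsub>quotient_algebra s R\<^esub> = \<one>\<^bsub>quotient_algebra t T\<^esub>"
      unfolding quotient_class_one[symmetric] h by simp
  qed
qed

text \<open>\<open>pi_star\<close> is a choice by \<open>SOME\<close>; this uniqueness makes its
  values on classes independent of the choice.\<close>

lemma ring_hom_determined_by_generators:
  assumes h: "h \<in> ring_hom (quotient_algebra s R) (quotient_algebra t T)"
    and scalar: "\<And>c. h (quotient_class s R (Poly_Mapping.single [] c)) = quotient_class t T
        (Poly_Mapping.single [] c)"
    and gen: "\<And>x. h (quotient_class s R (Poly_Mapping.single [x] 1)) = quotient_class t T (f x)"
  shows "h (quotient_class s R p) = quotient_class t T (word_hom f p)"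
proof -
  have car: "quotient_class s R p \<in> carrier (quotient_algebra s R)" for p
    by (simp add: carrier_quotient_algebra)
  have mult: "h (quotient_class s R (p * q)) = h (quotient_class s R p) \<otimes>\<^bsub>quotient_algebra t T\<^esub> h
      (quotient_class s R q)" for p q
    by (simp add: quotient_class_mult ring_hom_mult[OF h car car])
  have hom_add: "h (quotient_class s R (p + q)) = h (quotient_class s R p) \<oplus>\<^bsub>quotient_algebra t T\<^esub>
      h (quotient_class s R q)" for p q
    by (simp add: quotient_class_add ring_hom_add[OF h car car])
  have word: "h (quotient_class s R (Poly_Mapping.single w 1)) = quotient_class t T (foldr (\<lambda>x q.
      f x * q) w 1)" for w
  proof (induction w)
    case Nil
    show ?case using scalar[of 1] by (simp add: single_Nil_one)
  next
    case (Cons x w)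
    have "Poly_Mapping.single (x # w) (1::'b) = Poly_Mapping.single [x] 1 * Poly_Mapping.single w 1"
      by (simp add: single_mult_list)
    then have "h (quotient_class s R (Poly_Mapping.single (x # w) 1)) =
        h (quotient_class s R (Poly_Mapping.single [x] 1)) \<otimes>\<^bsub>quotient_algebra t T\<^esub>
        h (quotient_class s R (Poly_Mapping.single w 1))"
      by (simp only: mult)
    then show ?case using Cons by (simp add: gen quotient_class_mult)
  qed
  have single: "h (quotient_class s R (Poly_Mapping.single w c)) = quotient_class t T (word_hom f
      (Poly_Mapping.single w c))" for w c
  proof -
    have "Poly_Mapping.single w c = Poly_Mapping.single [] c * Poly_Mapping.single w 1"
      by (simp add: single_mult_list)
    then have "h (quotient_class s R (Poly_Mapping.single w c)) =
        h (quotient_class s R (Poly_Mapping.single [] c)) \<otimes>\<^bsub>quotient_algebra t T\<^esub>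
        h (quotient_class s R (Poly_Mapping.single w 1))"
      by (simp only: mult)
    then show ?thesis
      by (simp add: scalar word word_hom_single word_scale_def quotient_class_mult)
  qed
  show ?thesis
  proof (induction p rule: poly_mapping_induct_single)
    case zero
    show ?case using single[of "[]" 0] by simp
  next
    case (add p w c)
    then show ?case unfolding hom_add word_hom(1) quotient_class_add[of t T] single by simp
  qed
qed

section \<open>Colour antisymmetrisation of three vectors\<close>

text \<open>The permutations are enumerated as products
  \<open>transpose 1 b \<circ> transpose 2 c\<close>, whose inverses are the reversed products;
  \<open>colour_sign\<close> is defined through the inverse. The last argument of \<open>H\<close>
  receives the sign.\<close>

lemma sum_permutes_three:
  fixes H :: "nat \<Rightarrow> nat \<Rightarrow> nat \<Rightarrow> 'k::field \<Rightarrow> 'm::ab_group_add"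
  shows "(\<Sum>\<sigma> | \<sigma> permutes {1..3::nat}. H (\<sigma> 1) (\<sigma> 2) (\<sigma> 3) (colour_sign eps 3 \<sigma> d)) =
    H 1 2 3 1 + H 2 1 3 (- eps (d 1) (d 2)) + H 1 3 2 (- eps (d 2) (d 3))
    + H 2 3 1 (eps (d 1) (d 2) * eps (d 1) (d 3)) + H 3 1 2 (eps (d 1) (d 3) * eps (d 2) (d 3))
    + H 3 2 1 (- (eps (d 1) (d 2) * eps (d 1) (d 3) * eps (d 2) (d 3)))"
proof -
  have set3: "{1..3::nat} = insert 1 (insert 2 (insert 3 {}))" by auto
  have sgn: "colour_sign eps 3 \<sigma> d = of_int (sign \<sigma>) *
      ((if \<tau> 1 > \<tau> 2 then eps (d 1) (d 2) else 1) * (if \<tau> 1 > \<tau> 3 then eps (d 1) (d 3) else 1)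
       * (if \<tau> 2 > \<tau> 3 then eps (d 2) (d 3) else 1))"
    if "inv_into UNIV \<sigma> = \<tau>" for \<sigma> \<tau> :: "nat \<Rightarrow> nat"
  proof -
    let ?P = "{(1, 2), (1, 3), (2, 3::nat)} :: (nat \<times> nat) set"
    have eq: "{(i, j). i \<in> {1..3} \<and> j \<in> {1..3} \<and> i < j \<and> inv_into UNIV \<sigma> i > inv_into UNIV \<sigma> j} =
        {x \<in> ?P. \<tau> (fst x) > \<tau> (snd x)}"
      unfolding that set3 by auto
    show ?thesis
      unfolding colour_sign_def eq
      by (subst prod.inter_filter) (simp_all add: mult.assoc)
  qed
  have inv1: "inv_into UNIV (transpose a b) = transpose a b" for a b :: nat
    by simp
  have inv2: "inv_into UNIV (transpose a b \<circ> transpose c e) = transpose c e \<circ> transpose a b" for a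
      b c e :: nat
    by (simp add: o_inv_distrib)
  have sgn2: "sign (transpose a b \<circ> transpose c e) = (if a = b then 1 else -1) * (if c = e then 1
      else -1)" for a b c e :: nat
    by (simp add: sign_compose permutation_swap_id sign_swap_id)
  have "(\<Sum>\<sigma> | \<sigma> permutes {1..3::nat}. H (\<sigma> 1) (\<sigma> 2) (\<sigma> 3) (colour_sign eps 3 \<sigma> d)) =
     (\<Sum>b\<in>{1,2,3}. \<Sum>c\<in>{2,3}. let \<sigma> = transpose 1 b \<circ> transpose 2 c in H (\<sigma> 1) (\<sigma> 2) (\<sigma> 3)
         (colour_sign eps 3 \<sigma> d))"
    unfolding set3
    by (subst sum_over_permutations_insert, simp, simp, intro sum.cong refl,
        subst sum_over_permutations_insert, simp, simp, intro sum.cong refl,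
        subst sum_over_permutations_insert, simp, simp) (simp add: Let_def)
  also have "\<dots> = H 1 2 3 1 + H 2 1 3 (- eps (d 1) (d 2)) + H 1 3 2 (- eps (d 2) (d 3))
    + H 2 3 1 (eps (d 1) (d 2) * eps (d 1) (d 3)) + H 3 1 2 (eps (d 1) (d 3) * eps (d 2) (d 3))
    + H 3 2 1 (- (eps (d 1) (d 2) * eps (d 1) (d 3) * eps (d 2) (d 3)))"
    by (simp add: Let_def sgn[OF inv2] sgn2 transpose_def)
  finally show ?thesis .
qed

definition trilinear ::
  "('k::field \<Rightarrow> 'v::ab_group_add \<Rightarrow> 'v) \<Rightarrow> ('k \<Rightarrow> 'm::ab_group_add \<Rightarrow> 'm) \<Rightarrow> ('v \<Rightarrow> 'v \<Rightarrow> 'v \<Rightarrow> 'm) \<Rightarrow>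
      bool" where
  "trilinear s t \<mu> \<longleftrightarrow> (\<forall>y z. Vector_Spaces.linear s t (\<lambda>x. \<mu> x y z)) \<and>
     (\<forall>x z. Vector_Spaces.linear s t (\<lambda>y. \<mu> x y z)) \<and> (\<forall>x y. Vector_Spaces.linear s t (\<mu> x y))"

lemma trilinearD:
  assumes "trilinear s t \<mu>"
  shows "Vector_Spaces.linear s t (\<lambda>x. \<mu> x y z)" "Vector_Spaces.linear s t (\<lambda>y. \<mu> x y z)"
    "Vector_Spaces.linear s t (\<mu> x y)"
  using assms by (simp_all add: trilinear_def)

lemma trilinearI:
  assumes "vector_space s" "vector_space t"
    and "\<And>x x' y z. \<mu> (x + x') y z = \<mu> x y z + \<mu> x' y z" "\<And>c x y z. \<mu> (s c x) y z = t c (\<mu> x y z)"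
    and "\<And>x y y' z. \<mu> x (y + y') z = \<mu> x y z + \<mu> x y' z" "\<And>c x y z. \<mu> x (s c y) z = t c (\<mu> x y z)"
    and "\<And>x y z z'. \<mu> x y (z + z') = \<mu> x y z + \<mu> x y z'" "\<And>c x y z. \<mu> x y (s c z) = t c (\<mu> x y z)"
  shows "trilinear s t \<mu>"
  unfolding trilinear_def Vector_Spaces.linear_iff using assms by simp

text \<open>The value 0 on words of other lengths lets the linear extension live on the whole free
  algebra, where it can be tested on ideals.\<close>

fun cubic_word :: "('v \<Rightarrow> 'v \<Rightarrow> 'v \<Rightarrow> 'm::zero) \<Rightarrow> 'v list \<Rightarrow> 'm" where
  "cubic_word h [x, y, z] = h x y z"
| "cubic_word h [] = 0"
| "cubic_word h [x] = 0"
| "cubic_word h [x, y] = 0"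
| "cubic_word h (x # y # z # v # w) = 0"

lemma cubic_word_length: "length w \<noteq> 3 \<Longrightarrow> cubic_word h w = 0"
  by (cases "(h, w)" rule: cubic_word.cases) auto

lemma length_3E:
  assumes "length w = 3"
  obtains x y z where "w = [x, y, z]"
  using assms by (auto simp: numeral_3_eq_3 length_Suc_conv)

lemma sum_closed:
  assumes "P 0" "\<And>x y. P x \<Longrightarrow> P y \<Longrightarrow> P (x + y)" "\<And>i. i \<in> A \<Longrightarrow> P (f i)"
  shows "P (sum f A)"
  using assms(3) by (induction A rule: infinite_finite_induct) (simp_all add: assms(1,2))

context vector_space
begin

lemma linear_extension_add:
  "linear_extension scale (\<lambda>w. h w + h' w) p = linear_extension scale h p + linear_extension scale h' p"
  by (simp add: linear_extension_def scale_right_distrib sum.distrib)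

lemma linear_extension_scale:
  "linear_extension scale (\<lambda>w. scale c (h w)) p = scale c (linear_extension scale h p)"
  by (simp add: linear_extension_def scale_sum_right mult.commute)

end

context eps_symmetric_basis
begin

text \<open>
  \<open>\<Sum>\<^sub>\<sigma> p(\<sigma>; x, y, z) \<mu>(\<sigma>(x, y, z))\<close> for \<open>x\<close>, \<open>y\<close>, \<open>z\<close> of degrees \<open>a\<close>, \<open>b\<close>, \<open>c\<close>.
\<close>

definition six_terms :: "('k \<Rightarrow> 'm::ab_group_add \<Rightarrow> 'm) \<Rightarrow> ('v \<Rightarrow> 'v \<Rightarrow> 'v \<Rightarrow> 'm) \<Rightarrow> 'c \<Rightarrow> 'c \<Rightarrow> 'c \<Rightarrow> 'v \<Rightarrow>
    'v \<Rightarrow> 'v \<Rightarrow> 'm" where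
  "six_terms t \<mu> a b c x y z = \<mu> x y z - t (eps a b) (\<mu> y x z) - t (eps b c) (\<mu> x z y)
     + t (eps a b * eps a c) (\<mu> y z x) + t (eps a c * eps b c) (\<mu> z x y)
     - t (eps a b * eps a c * eps b c) (\<mu> z y x)"

text \<open>The signs in \<open>six_terms\<close> need degrees, which a general vector does not
  have; the extension by coordinates in \<open>E\<close> is trilinear and agrees with
  \<open>six_terms\<close> on homogeneous vectors.\<close>

definition antisymmetrise :: "('k \<Rightarrow> 'm::ab_group_add \<Rightarrow> 'm) \<Rightarrow> ('v \<Rightarrow> 'v \<Rightarrow> 'v \<Rightarrow> 'm) \<Rightarrow> 'v \<Rightarrow> 'v \<Rightarrow> 'v \<Rightarrow>
    'm" where
  "antisymmetrise t \<mu> x y z = (\<Sum>e\<in>E. \<Sum>f\<in>E. \<Sum>g\<in>E.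
     t (form x (dual e) * form y (dual f) * form z (dual g)) (six_terms t \<mu> (dg e) (dg f) (dg g) e
         f g))"

definition colour_alternating :: "('k \<Rightarrow> 'm::ab_group_add \<Rightarrow> 'm) \<Rightarrow> ('v \<Rightarrow> 'v \<Rightarrow> 'v \<Rightarrow> 'm) \<Rightarrow> bool" where
  "colour_alternating t \<mu> \<longleftrightarrow> (\<forall>a b c. \<forall>x\<in>V a. \<forall>y\<in>V b. \<forall>z\<in>V c.
     \<mu> x y z = - t (eps a b) (\<mu> y x z) \<and> \<mu> x y z = - t (eps b c) (\<mu> x z y))"

lemma trilinear_expand:
  assumes \<mu>: "trilinear scale t \<mu>"
  shows "(\<Sum>e\<in>E. \<Sum>f\<in>E. \<Sum>g\<in>E. t (form x (dual e) * form y (dual f) * form z (dual g)) (\<mu> e f g)) = \<mu>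
      x y z"
proof -
  interpret t: vector_space t using Vector_Spaces.linear.axioms(2)[OF trilinearD(3)[OF \<mu>]] .
  have 1: "(\<Sum>g\<in>E. t (form z (dual g)) (\<mu> x' y' g)) = \<mu> x' y' z" for x' y'
    by (subst (2) expand_basis[of z, symmetric]) (simp add: linear_map_simps[OF trilinearD(3)[OF \<mu>]])
  have 2: "(\<Sum>f\<in>E. t (form y (dual f)) (\<mu> x' f z)) = \<mu> x' y z" for x'
    by (subst (2) expand_basis[of y, symmetric]) (simp add: linear_map_simps[OF trilinearD(2)[OF \<mu>]])
  have 3: "(\<Sum>e\<in>E. t (form x (dual e)) (\<mu> e y z)) = \<mu> x y z"
    by (subst (2) expand_basis[of x, symmetric]) (simp add: linear_map_simps[OF trilinearD(1)[OF \<mu>]])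
  have "(\<Sum>e\<in>E. \<Sum>f\<in>E. \<Sum>g\<in>E. t (form x (dual e) * form y (dual f) * form z (dual g)) (\<mu> e f g)) =
      (\<Sum>e\<in>E. t (form x (dual e)) (\<Sum>f\<in>E. t (form y (dual f)) (\<Sum>g\<in>E. t (form z (dual g)) (\<mu> e f g))))"
    by (simp add: t.scale_sum_right mult.assoc)
  then show ?thesis unfolding 1 2 3 .
qed

lemma trilinear_six_terms:
  assumes \<mu>: "trilinear scale t \<mu>"
  shows "trilinear scale t (six_terms t \<mu> a b c)"
proof -
  interpret t: vector_space t using Vector_Spaces.linear.axioms(2)[OF trilinearD(3)[OF \<mu>]] .
  note lin = linear_map_simps[OF trilinearD(1)[OF \<mu>]] linear_map_simps[OF trilinearD(2)[OF \<mu>]]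
    linear_map_simps[OF trilinearD(3)[OF \<mu>]]
  show ?thesis
    by (rule trilinearI[OF vector_space_axioms t.vector_space_axioms])
      (simp_all add: six_terms_def lin t.scale_right_distrib t.scale_right_diff_distrib mult_ac)
qed

lemma trilinear_antisymmetrise:
  assumes "vector_space t"
  shows "trilinear scale t (antisymmetrise t \<mu>)"
proof -
  interpret t: vector_space t by fact
  show ?thesis
    by (rule trilinearI[OF vector_space_axioms t.vector_space_axioms])
      (simp_all add: antisymmetrise_def form_left t.scale_left_distrib distrib_left distrib_right
          sum.distrib
        t.scale_sum_right mult_ac)
qed

lemma antisymmetrise_homogeneous:
  assumes \<mu>: "trilinear scale t \<mu>" and x: "x \<in> V a" and y: "y \<in> V b" and z: "z \<in> V c"
  shows "antisymmetrise t \<mu> x y z = six_terms t \<mu> a b c x y z"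
proof -
  interpret t: vector_space t using Vector_Spaces.linear.axioms(2)[OF trilinearD(3)[OF \<mu>]] .
  have d: "form v (dual e) = 0 \<or> dg e = d" if "v \<in> V d" "e \<in> E" for v d e
    using form_degree[OF that(1) dual_degree[OF that(2)]] by auto
  have "t (form x (dual e) * form y (dual f) * form z (dual g)) (six_terms t \<mu> (dg e) (dg f) (dg
      g) e f g) =
      t (form x (dual e) * form y (dual f) * form z (dual g)) (six_terms t \<mu> a b c e f g)"
    if "e \<in> E" "f \<in> E" "g \<in> E" for e f g
    using d[OF x that(1)] d[OF y that(2)] d[OF z that(3)] by auto
  then have "antisymmetrise t \<mu> x y z = (\<Sum>e\<in>E. \<Sum>f\<in>E. \<Sum>g\<in>E.
     t (form x (dual e) * form y (dual f) * form z (dual g)) (six_terms t \<mu> a b c e f g))"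
    unfolding antisymmetrise_def by (intro sum.cong refl)
  then show ?thesis unfolding trilinear_expand[OF trilinear_six_terms[OF \<mu>]] .
qed

lemma colour_alternating_antisymmetrise:
  assumes \<mu>: "trilinear scale t \<mu>"
  shows "colour_alternating t (antisymmetrise t \<mu>)"
  unfolding colour_alternating_def
proof (intro allI ballI conjI)
  interpret t: vector_space t using Vector_Spaces.linear.axioms(2)[OF trilinearD(3)[OF \<mu>]] .
  fix a b c x y z assume x: "x \<in> V a" and y: "y \<in> V b" and z: "z \<in> V c"
  note hom = antisymmetrise_homogeneous[OF \<mu>]
  show "antisymmetrise t \<mu> x y z = - t (eps a b) (antisymmetrise t \<mu> y x z)"
    unfolding hom[OF x y z] hom[OF y x z] six_terms_def
    by (simp add: t.scale_right_distrib t.scale_right_diff_distrib eps_inverse eps_cancel mult_ac)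
  show "antisymmetrise t \<mu> x y z = - t (eps b c) (antisymmetrise t \<mu> x z y)"
    unfolding hom[OF x y z] hom[OF x z y] six_terms_def
    by (simp add: t.scale_right_distrib t.scale_right_diff_distrib eps_inverse eps_cancel mult_ac)
qed

abbreviation "exterior_ideal \<equiv> word_ideal (linear_relations scale \<union> exterior_relations eps V)"

text \<open>The universal property of the third exterior power. A relation \<open>a g b\<close>
  meets words of length three only if one more letter surrounds an exterior relation, or two
  surround a linear one.\<close>

lemma cubic_word_exterior_ideal:
  assumes tri: "trilinear scale t \<mu>" and alt: "colour_alternating t \<mu>" and p: "p \<in> exterior_ideal"
  shows "linear_extension t (cubic_word \<mu>) p = 0"
proof -
  interpret t: vector_space t using Vector_Spaces.linear.axioms(2)[OF trilinearD(3)[OF tri]] .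
  let ?L = "linear_extension t (cubic_word \<mu>)"
  note lin = linear_map_simps[OF trilinearD(1)[OF tri]] linear_map_simps[OF trilinearD(2)[OF tri]]
    linear_map_simps[OF trilinearD(3)[OF tri]]
  note L = t.linear_linear_extension[of "cubic_word \<mu>"]
  show ?thesis
  proof (rule linear_vanishes_on_word_ideal[OF L _ p])
    fix g and a b :: "'v list"
    assume "g \<in> linear_relations scale \<union> exterior_relations eps V"
    then show "?L (Poly_Mapping.single a 1 * g * Poly_Mapping.single b 1) = 0"
    proof
      assume g: "g \<in> linear_relations scale"
      show ?thesis
      proof (cases "length a + length b = 2")
        case False
        then have "cubic_word \<mu> (a @ v # b) = 0" for v by (intro cubic_word_length) simp
        then show ?thesis
          using g by (auto simp: linear_relations_def left_diff_distrib right_diff_distrib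
              single_mult_list
              linear_map_simps[OF L] t.linear_extension_single)
      next
        case True
        then consider x y where "a = []" "b = [x, y]" | x y where "a = [x]" "b = [y]"
          | x y where "a = [x, y]" "b = []"
          by (cases a; cases b; auto simp: numeral_2_eq_2 length_Suc_conv)
        then show ?thesis
          using g by cases (auto simp: linear_relations_def left_diff_distrib right_diff_distrib
              single_mult_list
              linear_map_simps[OF L] t.linear_extension_single lin)
      qed
    next
      assume "g \<in> exterior_relations eps V"
      then obtain x y c d where xy: "x \<in> V c" "y \<in> V d"
        and g: "g = Poly_Mapping.single [x, y] 1 + Poly_Mapping.single [y, x] (eps c d)"
        by (auto simp: exterior_relations_def)
      have eq: "?L (Poly_Mapping.single a 1 * g * Poly_Mapping.single b 1) =
          cubic_word \<mu> (a @ [x, y] @ b) + t (eps c d) (cubic_word \<mu> (a @ [y, x] @ b))"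
        by (simp add: g distrib_left distrib_right single_mult_list linear_map_simps[OF L]
            t.linear_extension_single)
      \<comment> \<open>The remaining letter need not be homogeneous, so alternation is extended to
        it by expansion in \<open>E\<close>.\<close>
      have alt1: "\<mu> x y z = - t (eps c d) (\<mu> y x z)" and alt2: "\<mu> z x y = - t (eps c d) (\<mu> z y x)" for z
      proof -
        have l1: "Vector_Spaces.linear scale t (\<lambda>z. \<mu> x y z + t (eps c d) (\<mu> y x z))"
          and l2: "Vector_Spaces.linear scale t (\<lambda>z. \<mu> z x y + t (eps c d) (\<mu> z y x))"
          by (unfold_locales, simp_all add: lin t.scale_right_distrib mult.commute)+
        have "\<mu> x y e + t (eps c d) (\<mu> y x e) = 0" "\<mu> e x y + t (eps c d) (\<mu> e y x) = 0" if "e \<in>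
            E" for e
          using alt xy dg[OF that] unfolding colour_alternating_def by (metis ab_left_minus)+
        then have "(\<lambda>z. \<mu> x y z + t (eps c d) (\<mu> y x z)) (\<Sum>e\<in>E. scale (form z (dual e)) e) = 0"
          "(\<lambda>z. \<mu> z x y + t (eps c d) (\<mu> z y x)) (\<Sum>e\<in>E. scale (form z (dual e)) e) = 0"
          unfolding linear_map_sum[OF l1] linear_map_sum[OF l2] linear_map_scale[OF l1]
              linear_map_scale[OF l2]
          by simp_all
        then show "\<mu> x y z = - t (eps c d) (\<mu> y x z)" "\<mu> z x y = - t (eps c d) (\<mu> z y x)"
          by (simp_all add: expand_basis eq_neg_iff_add_eq_0)
      qed
      show ?thesis
      proof (cases "length a + length b = 1")
        case False
        then have "cubic_word \<mu> (a @ [v, w] @ b) = 0" for v w by (intro cubic_word_length) simp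
        then show ?thesis by (simp only: eq) simp
      next
        case True
        then consider z where "a = []" "b = [z]" | z where "a = [z]" "b = []"
          by (cases a; cases b; auto simp: length_Suc_conv)
        then show ?thesis
          unfolding eq by cases (simp_all add: alt1[of "_"] alt2[of "_"])
      qed
    qed
  qed
qed

subsection \<open>Elements of degree three of the exterior algebra\<close>

abbreviation "len3 \<equiv> {p :: 'v list \<Rightarrow>\<^sub>0 'k. \<forall>w\<in>Poly_Mapping.keys p. length w = 3}"

lemma subspace_len3: "words.subspace len3"
  unfolding words.subspace_def
  using Poly_Mapping.keys_add by (fastforce simp: in_keys_iff lookup_word_scale)

lemma single_len3: "Poly_Mapping.single [x, y, z] c \<in> len3"
  by simp

abbreviation "eclass \<equiv> exterior_class eps scale V"

lemma single_expand:
  "quotient_class scale R (Poly_Mapping.single [x, y, z] c) = quotient_class scale R (\<Sum>e\<in>E. \<Sum>f\<in>E. \<Sum>g\<in>E.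
     word_scale (c * (form x (dual e) * form y (dual f) * form z (dual g))) (Poly_Mapping.single
         [e, f, g] 1))"
proof -
  let ?q = "quotient_endo (linear_relations scale \<union> R)"
  let ?i = "\<lambda>v. ?q (Poly_Mapping.single [v] 1)"
  interpret e: vector_space endo_scale by (rule vector_space_endo_scale)
  note lin = linear_map_simps[OF linear_quotient_endo]
  note li = linear_map_simps[OF linear_quotient_endo_generator[OF vector_space_axioms, of R]]
  have prod: "?q (Poly_Mapping.single [x, y, z] 1) = ?i x * ?i y * ?i z" for x y z
    unfolding quotient_endo_mult[symmetric] by (simp add: single_mult_list)
  have tri: "trilinear scale endo_scale (\<lambda>x y z. ?i x * ?i y * ?i z)"
    by (rule trilinearI[OF vector_space_axioms e.vector_space_axioms])
      (simp_all add: li distrib_left distrib_right endo_scale_mult)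
  have "?q (Poly_Mapping.single [x, y, z] c) = ?q (word_scale c (Poly_Mapping.single [x, y, z]
      1))" by simp
  also have "\<dots> = endo_scale c (?i x * ?i y * ?i z)" by (simp only: lin prod)
  also have "\<dots> = ?q (\<Sum>e\<in>E. \<Sum>f\<in>E. \<Sum>g\<in>E.
     word_scale (c * (form x (dual e) * form y (dual f) * form z (dual g))) (Poly_Mapping.single
         [e, f, g] 1))"
    unfolding lin(6) lin(2) prod
    by (subst trilinear_expand[OF tri, symmetric]) (simp add: e.scale_sum_right)
  finally show ?thesis by (simp only: quotient_class_eq_iff_endo)
qed

text \<open>A word in arbitrary vectors reduces to words in \<open>E\<close> only modulo the
  relations; this is the reason for the case \<open>cong\<close>.\<close>

lemma len3_induct [consumes 1, case_names add scale cong base zero]: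
  assumes p: "p \<in> len3"
    and add: "\<And>p q. p \<in> len3 \<Longrightarrow> q \<in> len3 \<Longrightarrow> P p \<Longrightarrow> P q \<Longrightarrow> P (p + q)"
    and scale: "\<And>p c. p \<in> len3 \<Longrightarrow> P p \<Longrightarrow> P (word_scale c p)"
    and cong: "\<And>p q. p \<in> len3 \<Longrightarrow> q \<in> len3 \<Longrightarrow> P p \<Longrightarrow> eclass p = eclass q \<Longrightarrow> P q"
    and base: "\<And>x y z. x \<in> E \<Longrightarrow> y \<in> E \<Longrightarrow> z \<in> E \<Longrightarrow> P (Poly_Mapping.single [x, y, z] 1)"
    and zero: "P 0"
  shows "P p"
proof -
  define Q where "Q p \<longleftrightarrow> p \<in> len3 \<and> P p" for p
  have Q0: "Q 0" and Qadd: "\<And>p q. Q p \<Longrightarrow> Q q \<Longrightarrow> Q (p + q)"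
    and Qscale: "\<And>p c. Q p \<Longrightarrow> Q (word_scale c p)"
    using words.subspace_0[OF subspace_len3] words.subspace_add[OF subspace_len3]
      words.subspace_scale[OF subspace_len3] zero add scale
    unfolding Q_def by blast+
  have Qbase: "Q (Poly_Mapping.single [x, y, z] 1)" if "x \<in> E" "y \<in> E" "z \<in> E" for x y z
    unfolding Q_def using base[OF that] single_len3 by blast
  have "Q (Poly_Mapping.single w c)" if w: "length w = 3" for w c
  proof -
    from w obtain x y z where xyz: "w = [x, y, z]" by (rule length_3E)
    let ?s = "\<Sum>e\<in>E. \<Sum>f\<in>E. \<Sum>g\<in>E.
     word_scale (c * (form x (dual e) * form y (dual f) * form z (dual g))) (Poly_Mapping.single
         [e, f, g] 1)"
    have "Q ?s"
      by (intro sum_closed[where P = Q, OF Q0 Qadd] Qscale Qbase)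
    then have "?s \<in> len3" "P ?s" unfolding Q_def by blast+
    from cong[OF this(1) single_len3 this(2) single_expand[symmetric]]
    show ?thesis unfolding xyz Q_def using single_len3 by blast
  qed
  then have "Q (\<Sum>w\<in>Poly_Mapping.keys p. Poly_Mapping.single w (Poly_Mapping.lookup p w))"
    using p by (intro sum_closed[where P = Q, OF Q0 Qadd]) blast+
  then show ?thesis by (simp add: poly_mapping_sum_single Q_def)
qed

end

lemma vector_space_field: "vector_space ((*) :: 'k::field \<Rightarrow> 'k \<Rightarrow> 'k)"
  by unfold_locales (simp_all add: algebra_simps)

lemma cubic_word_add: "cubic_word (\<lambda>x y z. f x y z + g x y z) w = cubic_word f w + (cubic_word g w
    :: 'm::monoid_add)"
  by (cases "(f, w)" rule: cubic_word.cases) auto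

lemma cubic_word_mult: "cubic_word (\<lambda>x y z. c * f x y z) w = c * (cubic_word f w :: 'm::mult_zero)"
  by (cases "(f, w)" rule: cubic_word.cases) auto

lemma word_three: "word 3 v = [v 1, v 2, v 3]"
  by (simp add: upt_rec eval_nat_numeral)

text \<open>The scalar identity behind the first half of \<open>colour_alternating_pairing\<close>.
  There \<open>ef\<close> is \<open>eps (dg e) (dg f)\<close> and so on, \<eta> is the sign of the
  swapped vectors \<open>v1\<close>, \<open>v2\<close>, \<open>Pbc\<close> is
  \<open>form f v1 * form g v2\<close>, and \<open>A\<close>, \<open>B\<close>, \<open>C\<close> are
  the pairings of \<open>e\<close>, \<open>f\<close>, \<open>g\<close> with \<open>v3\<close>. The
  next lemma does the same for \<open>v2\<close> and \<open>v3\<close>.\<close>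

lemma swap_first_identity:
  fixes \<eta> ef fe eg ge fg gf :: "'k::field"
  assumes inv: "ef * fe = 1" "eg * ge = 1" "fg * gf = 1"
    and "\<eta> * Pbc = fg * Pbc" "\<eta> * Pcb = gf * Pcb" "\<eta> * Pac = eg * Pac" "\<eta> * Pca = ge * Pca"
      "\<eta> * Pab = ef * Pab" "\<eta> * Pba = fe * Pba"
  shows "Pcb * A - ef * (Pca * B) - fg * (Pbc * A) + ef * eg * (Pac * B) + eg * fg * (Pba * C) -
      ef * eg * fg * (Pab * C) =
    - \<eta> * (Pbc * A - ef * (Pac * B) - fg * (Pcb * A) + ef * eg * (Pca * B) + eg * fg * (Pab * C) -
        ef * eg * fg * (Pba * C))"
proof -
  have "- \<eta> * (Pbc * A - ef * (Pac * B) - fg * (Pcb * A) + ef * eg * (Pca * B) + eg * fg * (Pab *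
      C) - ef * eg * fg * (Pba * C)) =
      - ((\<eta> * Pbc) * A) + ef * ((\<eta> * Pac) * B) + fg * ((\<eta> * Pcb) * A) - ef * eg * ((\<eta> * Pca) * B)
      - eg * fg * ((\<eta> * Pab) * C) + ef * eg * fg * ((\<eta> * Pba) * C)"
    by (simp add: algebra_simps)
  also have "\<dots> = - (fg * (Pbc * A)) + ef * eg * (Pac * B) + (fg * gf) * (Pcb * A) - ef * (eg * ge)
      * (Pca * B)
      - ef * eg * fg * (Pab * C) + (ef * fe) * (eg * fg * (Pba * C))"
    unfolding assms(4-9) by (simp add: mult_ac)
  finally show ?thesis unfolding inv by simp
qed

lemma swap_second_identity:
  fixes \<eta> ef fe eg ge fg gf :: "'k::field"
  assumes inv: "ef * fe = 1" "eg * ge = 1" "fg * gf = 1"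
    and "\<eta> * Qba = fe * Qba" "\<eta> * Qab = ef * Qab" "\<eta> * Qca = ge * Qca" "\<eta> * Qac = eg * Qac"
      "\<eta> * Qcb = gf * Qcb" "\<eta> * Qbc = fg * Qbc"
  shows "C * Qba - ef * (C * Qab) - fg * (B * Qca) + ef * eg * (A * Qcb) + eg * fg * (B * Qac) -
      ef * eg * fg * (A * Qbc) =
    - \<eta> * (C * Qab - ef * (C * Qba) - fg * (B * Qac) + ef * eg * (A * Qbc) + eg * fg * (B * Qca) -
        ef * eg * fg * (A * Qcb))"
proof -
  have "- \<eta> * (C * Qab - ef * (C * Qba) - fg * (B * Qac) + ef * eg * (A * Qbc) + eg * fg * (B *
      Qca) - ef * eg * fg * (A * Qcb)) =
      - (C * (\<eta> * Qab)) + ef * (C * (\<eta> * Qba)) + fg * (B * (\<eta> * Qac)) - ef * eg * (A * (\<eta> * Qbc))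
      - eg * fg * (B * (\<eta> * Qca)) + ef * eg * fg * (A * (\<eta> * Qcb))"
    by (simp add: algebra_simps)
  also have "\<dots> = - (ef * (C * Qab)) + (ef * fe) * (C * Qba) + eg * fg * (B * Qac) - ef * eg * fg *
      (A * Qbc)
      - (eg * ge) * (fg * (B * Qca)) + (fg * gf) * (ef * eg * (A * Qcb))"
    unfolding assms(4-9) by (simp add: mult_ac)
  finally show ?thesis unfolding inv by simp
qed

context eps_symmetric_basis
begin

interpretation K: vector_space "(*) :: 'k \<Rightarrow> 'k \<Rightarrow> 'k"
  by (rule vector_space_field)

text \<open>For a field over itself this rule is associativity from right to left and would loop
  with \<open>mult.assoc\<close>.\<close>

declare K.scale_scale [simp del]

subsection \<open>The form on the exterior algebra\<close>

text \<open>One summand of the form on the third exterior power; the left word is read backwards,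
  \<open>z\<close> against \<open>v1\<close>, as the index \<open>\<sigma> (n - i)\<close>
  prescribes.\<close>

definition mu3 :: "'v \<Rightarrow> 'v \<Rightarrow> 'v \<Rightarrow> 'v \<Rightarrow> 'v \<Rightarrow> 'v \<Rightarrow> 'k" where
  "mu3 v1 v2 v3 x y z = form z v1 * form y v2 * form x v3"

lemma trilinear_mu3: "trilinear scale (*) (mu3 v1 v2 v3)"
  by (rule trilinearI[OF vector_space_axioms K.vector_space_axioms])
    (simp_all add: mu3_def form_left algebra_simps)

definition pairing :: "('v list \<Rightarrow>\<^sub>0 'k) \<Rightarrow> 'v \<Rightarrow> 'v \<Rightarrow> 'v \<Rightarrow> 'k" where
  "pairing p v1 v2 v3 = linear_extension (*) (cubic_word (antisymmetrise (*) (mu3 v1 v2 v3))) p"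

lemma linear_pairing: "Vector_Spaces.linear word_scale (*) (\<lambda>p. pairing p v1 v2 v3)"
  unfolding pairing_def by (rule K.linear_linear_extension)

lemma pairing_single: "pairing (Poly_Mapping.single [x, y, z] c) v1 v2 v3 = c * antisymmetrise (*)
    (mu3 v1 v2 v3) x y z"
  by (simp add: pairing_def)

lemma pairing_ideal: "p \<in> exterior_ideal \<Longrightarrow> pairing p v1 v2 v3 = 0"
  unfolding pairing_def
  by (rule cubic_word_exterior_ideal[OF trilinear_antisymmetrise[OF vector_space_field]
        colour_alternating_antisymmetrise[OF trilinear_mu3]])

lemma trilinear_pairing: "trilinear scale (*) (pairing p)"
proof -
  have add: "antisymmetrise (*) (mu3 (v1 + w) v2 v3) = (\<lambda>x y z. antisymmetrise (*) (mu3 v1 v2 v3)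
      x y z + antisymmetrise (*) (mu3 w v2 v3) x y z)"
    "antisymmetrise (*) (mu3 v1 (v2 + w) v3) = (\<lambda>x y z. antisymmetrise (*) (mu3 v1 v2 v3) x y z +
        antisymmetrise (*) (mu3 v1 w v3) x y z)"
    "antisymmetrise (*) (mu3 v1 v2 (v3 + w)) = (\<lambda>x y z. antisymmetrise (*) (mu3 v1 v2 v3) x y z +
        antisymmetrise (*) (mu3 v1 v2 w) x y z)" for v1 v2 v3 w
    by (simp_all add: fun_eq_iff antisymmetrise_def six_terms_def mu3_def form_right algebra_simps
        flip: sum.distrib)
  have scl: "antisymmetrise (*) (mu3 (scale c v1) v2 v3) = (\<lambda>x y z. c * antisymmetrise (*) (mu3 v1
      v2 v3) x y z)"
    "antisymmetrise (*) (mu3 v1 (scale c v2) v3) = (\<lambda>x y z. c * antisymmetrise (*) (mu3 v1 v2 v3)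
        x y z)"
    "antisymmetrise (*) (mu3 v1 v2 (scale c v3)) = (\<lambda>x y z. c * antisymmetrise (*) (mu3 v1 v2 v3)
        x y z)" for v1 v2 v3 c
    by (simp_all add: fun_eq_iff antisymmetrise_def six_terms_def mu3_def form_right algebra_simps
        sum_distrib_left)
  show ?thesis
    by (rule trilinearI[OF vector_space_axioms vector_space_field])
      (simp_all add: pairing_def add scl cubic_word_add[abs_def] cubic_word_mult[abs_def]
        K.linear_extension_add K.linear_extension_scale)
qed

lemma form_pair_eps:
  assumes "e \<in> E" "f \<in> E" "v \<in> V a" "w \<in> V b"
  shows "eps a b * (form e v * form f w) = eps (dg e) (dg f) * (form e v * form f w)"
proof (cases "form e v = 0 \<or> form f w = 0")
  case False
  then have "dg e + a = 0" "dg f + b = 0"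
    using form_degree[OF dg[OF assms(1)] assms(3)] form_degree[OF dg[OF assms(2)] assms(4)] by auto
  then have "dg e = - a" "dg f = - b" by (simp_all add: add_eq_0_iff2)
  then show ?thesis by simp
qed auto

text \<open>The antisymmetrisation runs over the left vectors only. It also alternates the right
  ones because a non-zero product of pairings forces opposite degrees, so that both sides see the
  same signs.\<close>

lemma colour_alternating_pairing: "colour_alternating (*) (pairing p)"
  unfolding colour_alternating_def
proof (intro allI ballI conjI)
  fix a b c v1 v2 v3 assume v: "v1 \<in> V a" "v2 \<in> V b" "v3 \<in> V c"
  have 1: "antisymmetrise (*) (mu3 v1 v2 v3) = (\<lambda>x y z. - eps a b * antisymmetrise (*) (mu3 v2 v1
      v3) x y z)"
  proof -
    have "six_terms (*) (mu3 v1 v2 v3) (dg e) (dg f) (dg g) e f g =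
        - eps a b * six_terms (*) (mu3 v2 v1 v3) (dg e) (dg f) (dg g) e f g"
      if efg: "e \<in> E" "f \<in> E" "g \<in> E" for e f g
    proof -
      note pe = form_pair_eps[OF _ _ v(1,2)]
      show ?thesis
        unfolding six_terms_def mu3_def
        using swap_first_identity[OF eps_inverse[of "dg e" "dg f"] eps_inverse[of "dg e" "dg g"]
            eps_inverse[of "dg f" "dg g"]
            pe[OF efg(2,3)] pe[OF efg(3,2)] pe[OF efg(1,3)] pe[OF efg(3,1)] pe[OF efg(1,2)] pe[OF
                efg(2,1)],
            of "form e v3" "form f v3" "form g v3"]
        by (simp only: mult_ac)
    qed
    then show ?thesis
      by (simp add: fun_eq_iff antisymmetrise_def sum_distrib_left mult_ac sum_negf[symmetric])
  qed
  have 2: "antisymmetrise (*) (mu3 v1 v2 v3) = (\<lambda>x y z. - eps b c * antisymmetrise (*) (mu3 v1 v3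
      v2) x y z)"
  proof -
    have "six_terms (*) (mu3 v1 v2 v3) (dg e) (dg f) (dg g) e f g =
        - eps b c * six_terms (*) (mu3 v1 v3 v2) (dg e) (dg f) (dg g) e f g"
      if efg: "e \<in> E" "f \<in> E" "g \<in> E" for e f g
    proof -
      note pe = form_pair_eps[OF _ _ v(2,3)]
      show ?thesis
        unfolding six_terms_def mu3_def
        using swap_second_identity[OF eps_inverse[of "dg e" "dg f"] eps_inverse[of "dg e" "dg g"]
            eps_inverse[of "dg f" "dg g"]
            pe[OF efg(2,1)] pe[OF efg(1,2)] pe[OF efg(3,1)] pe[OF efg(1,3)] pe[OF efg(3,2)] pe[OF
                efg(2,3)],
            of "form g v1" "form f v1" "form e v1"]
        by (simp only: mult_ac)
    qed
    then show ?thesis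
      by (simp add: fun_eq_iff antisymmetrise_def sum_distrib_left mult_ac sum_negf[symmetric])
  qed
  show "pairing p v1 v2 v3 = - (eps a b * pairing p v2 v1 v3)"
    unfolding pairing_def 1 cubic_word_mult[abs_def] K.linear_extension_scale by simp
  show "pairing p v1 v2 v3 = - (eps b c * pairing p v1 v3 v2)"
    unfolding pairing_def 2 cubic_word_mult[abs_def] K.linear_extension_scale by simp
qed

definition ext_form :: "('v list \<Rightarrow>\<^sub>0 'k) \<Rightarrow> ('v list \<Rightarrow>\<^sub>0 'k) \<Rightarrow> 'k" where
  "ext_form p q = linear_extension (*) (cubic_word (pairing p)) q"

lemma linear_ext_form_right: "Vector_Spaces.linear word_scale (*) (ext_form p)"
  unfolding ext_form_def[abs_def] by (rule K.linear_linear_extension)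

lemma linear_ext_form_left: "Vector_Spaces.linear word_scale (*) (\<lambda>p. ext_form p q)"
proof -
  have "pairing (p + p') = (\<lambda>x y z. pairing p x y z + pairing p' x y z)"
    "pairing (word_scale c p) = (\<lambda>x y z. c * pairing p x y z)" for p p' c
    by (simp_all add: fun_eq_iff linear_map_simps[OF linear_pairing])
  then show ?thesis
    by unfold_locales
      (simp_all add: ext_form_def cubic_word_add[abs_def] cubic_word_mult[abs_def]
        K.linear_extension_add K.linear_extension_scale)
qed

lemma ext_form_single: "ext_form p (Poly_Mapping.single [x, y, z] c) = c * pairing p x y z"
  by (simp add: ext_form_def)

lemma ext_form_cong:
  assumes "eclass p = eclass p'" "eclass q = eclass q'"
  shows "ext_form p q = ext_form p' q'"
proof -
  have "pairing (p - p') = (\<lambda>x y z. 0)"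
    using assms(1) pairing_ideal[of "p - p'"] by (simp add: quotient_class_eq_iff fun_eq_iff)
  then have "pairing p = pairing p'"
    by (simp add: fun_eq_iff linear_map_simps[OF linear_pairing])
  moreover have "ext_form p' (q - q') = 0"
    unfolding ext_form_def
    by (rule cubic_word_exterior_ideal[OF trilinear_pairing colour_alternating_pairing])
      (use assms(2) in \<open>simp add: quotient_class_eq_iff\<close>)
  ultimately show ?thesis
    by (simp add: linear_map_simps[OF linear_ext_form_right] ext_form_def[of p] ext_form_def[of
        p', symmetric])
qed

lemma sum_permutes_form:
  "(\<Sum>\<sigma> | \<sigma> permutes {1..3}. colour_sign eps 3 \<sigma> d * (\<Prod>i<3. form (w (\<sigma> (3 - i))) (v (1 + i)))) =
    six_terms (*) (mu3 (v 1) (v 2) (v 3)) (d 1) (d 2) (d 3) (w 1) (w 2) (w 3)"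
proof -
  have p: "(\<Prod>i<3. form (w (\<sigma> (3 - i))) (v (1 + i))) = form (w (\<sigma> 3)) (v 1) * form (w (\<sigma> 2)) (v 2)
      * form (w (\<sigma> 1)) (v 3)" for \<sigma>
    by (simp add: numeral_3_eq_3 numeral_2_eq_2 lessThan_Suc mult_ac)
  show ?thesis
    unfolding p
    using sum_permutes_three[of "\<lambda>i j k c. c * (form (w k) (v 1) * form (w j) (v 2) * form (w i)
        (v 3))" eps d]
    by (simp add: six_terms_def mu3_def)
qed

lemma exterior_power_three: "exterior_power eps scale V 3 = eclass ` len3"
  by (simp add: exterior_power_def)

text \<open>As \<open>exterior_form\<close> is chosen by \<open>SOME\<close>, existence gives it its
  defining properties, and uniqueness below gives its values.\<close>

lemma is_exterior_form_exists: "\<exists>F. is_exterior_form eps scale V form 3 F"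
proof
  let ?F = "\<lambda>X Y. ext_form (SOME p. X = eclass p) (SOME q. Y = eclass q)"
  have F: "?F (eclass p) (eclass q) = ext_form p q" for p q
  proof (rule ext_form_cong)
    show "eclass (SOME p'. eclass p = eclass p') = eclass p"
      by (rule sym, rule someI[of "\<lambda>p'. eclass p = eclass p'"], rule refl)
    show "eclass (SOME p'. eclass q = eclass p') = eclass q"
      by (rule sym, rule someI[of "\<lambda>p'. eclass q = eclass p'"], rule refl)
  qed
  show "is_exterior_form eps scale V form 3 ?F"
    unfolding is_exterior_form_def exterior_power_three
  proof (intro conjI ballI allI impI)
    fix t u u' assume "t \<in> eclass ` len3" "u \<in> eclass ` len3" "u' \<in> eclass ` len3"
    then obtain p q q' where "t = eclass p" "u = eclass q" "u' = eclass q'" by blast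
    then show "?F (u \<oplus>\<^bsub>exterior_algebra eps scale V\<^esub> u') t = ?F u t + ?F u' t"
      "?F t (u \<oplus>\<^bsub>exterior_algebra eps scale V\<^esub> u') = ?F t u + ?F t u'"
      by (simp_all only: quotient_class_add[symmetric] F linear_map_simps[OF linear_ext_form_left]
          linear_map_simps[OF linear_ext_form_right])
  next
    fix c t u assume "t \<in> eclass ` len3" "u \<in> eclass ` len3"
    then obtain p q where "t = eclass p" "u = eclass q" by blast
    then show "?F (quotient_scale scale (exterior_relations eps V) c u) t = c * ?F u t"
      "?F t (quotient_scale scale (exterior_relations eps V) c u) = c * ?F t u"
      by (simp_all only: quotient_scale_class F linear_map_simps[OF linear_ext_form_left]
          linear_map_simps[OF linear_ext_form_right])
  next
    fix w v :: "nat \<Rightarrow> 'v" and d d' assume "\<forall>i\<in>{1..3}. w i \<in> V (d i)"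
    then have w: "w 1 \<in> V (d 1)" "w 2 \<in> V (d 2)" "w 3 \<in> V (d 3)" by auto
    show "?F (eclass (Poly_Mapping.single (word 3 w) 1)) (eclass (Poly_Mapping.single (word 3 v) 1)) =
        (\<Sum>\<sigma> | \<sigma> permutes {1..3}. colour_sign eps 3 \<sigma> d * (\<Prod>i<3. form (w (\<sigma> (3 - i))) (v (1 + i))))"
      unfolding F sum_permutes_form word_three
      using antisymmetrise_homogeneous[OF trilinear_mu3 w] by (simp add: ext_form_single pairing_single)
  qed
qed

definition vec3 :: "'v \<Rightarrow> 'v \<Rightarrow> 'v \<Rightarrow> nat \<Rightarrow> 'v" where
  "vec3 x y z i = (if i = 1 then x else if i = 2 then y else z)"

lemma vec3: "vec3 x y z 1 = x" "vec3 x y z 2 = y" "vec3 x y z 3 = z"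
  by (simp_all add: vec3_def)

lemma vec3_degree: "x \<in> E \<Longrightarrow> y \<in> E \<Longrightarrow> z \<in> E \<Longrightarrow> \<forall>i\<in>{1..3}. vec3 x y z i \<in> V (dg (vec3 x y z i))"
  by (simp add: vec3_def dg)

lemma is_exterior_form_unique:
  assumes F: "is_exterior_form eps scale V form 3 F" and p: "p \<in> len3" and q: "q \<in> len3"
  shows "F (eclass p) (eclass q) = ext_form p q"
proof -
  have addl: "F (eclass (p + p')) (eclass q) = F (eclass p) (eclass q) + F (eclass p') (eclass q)"
    and addr: "F (eclass q) (eclass (p + p')) = F (eclass q) (eclass p) + F (eclass q) (eclass p')"
    if "p \<in> len3" "p' \<in> len3" "q \<in> len3" for p p' q
    using F that unfolding is_exterior_form_def exterior_power_three quotient_class_add by blast+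
  have scl: "F (eclass (word_scale c p)) (eclass q) = c * F (eclass p) (eclass q)"
    and scr: "F (eclass q) (eclass (word_scale c p)) = c * F (eclass q) (eclass p)"
    if "p \<in> len3" "q \<in> len3" for p q c
    using F that unfolding is_exterior_form_def exterior_power_three
        quotient_scale_class[symmetric] by blast+
  have F_zero: "F (eclass 0) (eclass q) = 0" "F (eclass q) (eclass 0) = 0" if "q \<in> len3" for q
    using scl[OF _ that, of 0 0] scr[OF _ that, of 0 0] by simp_all
  have word_base: "F (eclass (Poly_Mapping.single [x, y, z] 1)) (eclass (Poly_Mapping.single [x',
      y', z'] 1)) =
      ext_form (Poly_Mapping.single [x, y, z] 1) (Poly_Mapping.single [x', y', z'] 1)"
    if e: "x \<in> E" "y \<in> E" "z \<in> E" and e': "x' \<in> E" "y' \<in> E" "z' \<in> E" for x y z x' y' z'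
  proof -
    have "F (eclass (Poly_Mapping.single (word 3 (vec3 x y z)) 1)) (eclass (Poly_Mapping.single
        (word 3 (vec3 x' y' z')) 1)) =
        (\<Sum>\<sigma> | \<sigma> permutes {1..3}. colour_sign eps 3 \<sigma> (\<lambda>i. dg (vec3 x y z i)) *
           (\<Prod>i<3. form (vec3 x y z (\<sigma> (3 - i))) (vec3 x' y' z' (1 + i))))"
      using F vec3_degree[OF e] vec3_degree[OF e'] unfolding is_exterior_form_def
      by (elim conjE) (erule allE, erule allE, erule allE, erule allE, erule impE, assumption,
          erule impE, assumption)
    then show ?thesis
      unfolding sum_permutes_form word_three vec3
      using antisymmetrise_homogeneous[OF trilinear_mu3 dg[OF e(1)] dg[OF e(2)] dg[OF e(3)]]
      by (simp add: ext_form_single pairing_single)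
  qed
  note ll = linear_map_simps[OF linear_ext_form_left] and lr = linear_map_simps[OF
      linear_ext_form_right]
  show ?thesis
    using p
  proof (induction p rule: len3_induct)
    case (base x y z)
    note e = base
    show ?case
      using q
    proof (induction q rule: len3_induct)
      case (base x' y' z')
      show ?case by (rule word_base[OF e base])
    next
      case (cong q q')
      then show ?case using ext_form_cong[OF refl cong.hyps(3)] by simp
    next
      case zero
      show ?case using F_zero(2)[OF single_len3] by (simp add: lr)
    qed (simp_all add: addr scr lr single_len3)
  next
    case (cong p p')
    then show ?case using ext_form_cong[OF cong.hyps(3) refl] by simp
  next
    case zero
    show ?case using F_zero(1)[OF q] by (simp add: ll)
  next
    case (add p p')
    then show ?case using addl[OF add.hyps q] by (simp add: ll)
  next
    case (scale p c)
    then show ?case using scl[OF scale.hyps q] by (simp add: ll)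
  qed
qed

end

context eps_symmetric_basis
begin

subsection \<open>Quantisation in degree three\<close>

interpretation e: vector_space endo_scale
  by (rule vector_space_endo_scale)

abbreviation "cclass \<equiv> clifford_class eps scale V form"

text \<open>A one-letter word is linear in its letter only modulo the relations. This replacement,
  equal to it in every quotient, is linear already in the free algebra, so that
  \<open>quantise\<close> can be obtained from the universal property there.\<close>

definition generator_expansion :: "'v \<Rightarrow> ('v list \<Rightarrow>\<^sub>0 'k)" where
  "generator_expansion v = (\<Sum>e\<in>E. word_scale (form v (dual e)) (Poly_Mapping.single [e] 1))"

lemma generator_expansion_linear:
  "generator_expansion (v + w) = generator_expansion v + generator_expansion w"
  "generator_expansion (scale c v) = word_scale c (generator_expansion v)"
  by (simp_all add: generator_expansion_def form_left words.scale_left_distrib sum.distrib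
      words.scale_sum_right
      del: word_scale_single)

lemma quotient_endo_generator_expansion:
  "quotient_endo (linear_relations scale \<union> R) (generator_expansion v) =
    quotient_endo (linear_relations scale \<union> R) (Poly_Mapping.single [v] 1)"
proof -
  let ?q = "quotient_endo (linear_relations scale \<union> R)"
  note lin = linear_map_simps[OF linear_quotient_endo]
  note li = linear_map_simps[OF linear_quotient_endo_generator[OF vector_space_axioms, of R]]
  have "?q (generator_expansion v) = (\<Sum>e\<in>E. endo_scale (form v (dual e)) (?q (Poly_Mapping.single
      [e] 1)))"
    unfolding generator_expansion_def lin(6) lin(2) ..
  also have "\<dots> = ?q (Poly_Mapping.single [\<Sum>e\<in>E. scale (form v (dual e)) e] 1)"
    unfolding li(6) li(2) ..
  finally show ?thesis by (simp only: expand_basis)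
qed

definition mu_word :: "'v \<Rightarrow> 'v \<Rightarrow> 'v \<Rightarrow> ('v list \<Rightarrow>\<^sub>0 'k)" where
  "mu_word x y z = word_scale (1 / 6) (generator_expansion x * generator_expansion y *
      generator_expansion z)"

lemma trilinear_mu_word: "trilinear scale word_scale mu_word"
  by (rule trilinearI[OF vector_space_axioms vector_space_word_scale])
    (simp_all add: mu_word_def generator_expansion_linear distrib_left distrib_right
        words.scale_right_distrib
      word_scale_mult_left word_scale_mult_right mult_ac)

definition quantise :: "('v list \<Rightarrow>\<^sub>0 'k) \<Rightarrow> ('v list \<Rightarrow>\<^sub>0 'k)" where
  "quantise = linear_extension word_scale (cubic_word (antisymmetrise word_scale mu_word))"

lemma linear_quantise: "Vector_Spaces.linear word_scale word_scale quantise"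
  unfolding quantise_def by (rule words.linear_linear_extension)

lemma quantise_single: "quantise (Poly_Mapping.single [x, y, z] c) = word_scale c (antisymmetrise
    word_scale mu_word x y z)"
  by (simp add: quantise_def words.linear_extension_single)

lemma quantise_cong:
  assumes "eclass p = eclass q"
  shows "quantise p = quantise q"
proof -
  have "quantise (p - q) = 0"
    unfolding quantise_def
    by (rule cubic_word_exterior_ideal[OF trilinear_antisymmetrise[OF vector_space_word_scale]
          colour_alternating_antisymmetrise[OF trilinear_mu_word]])
      (use assms in \<open>simp add: quotient_class_eq_iff\<close>)
  then show ?thesis by (simp add: linear_map_simps[OF linear_quantise])
qed

lemma quantise_homogeneous:
  assumes v: "v 1 \<in> V (d 1)" "v 2 \<in> V (d 2)" "v 3 \<in> V (d (3::nat))"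
  shows "cclass (quantise (Poly_Mapping.single (word 3 v) 1)) = cclass
    (\<Sum>\<sigma> | \<sigma> permutes {1..3}. Poly_Mapping.single (word 3 (\<lambda>i. v (\<sigma> i))) (colour_sign eps 3 \<sigma> d /
        of_nat (fact 3)))"
proof -
  let ?q = "quotient_endo (linear_relations scale \<union> clifford_relations eps V form)"
  let ?i = "\<lambda>v. ?q (Poly_Mapping.single [v] 1)"
  note lin = linear_map_simps[OF linear_quotient_endo]
  have mu: "?q (mu_word x y z) = endo_scale (1 / 6) (?i x * ?i y * ?i z)" for x y z
    by (simp add: mu_word_def lin quotient_endo_mult quotient_endo_generator_expansion)
  have monomial: "?q (Poly_Mapping.single [x, y, z] (c / of_nat (fact 3))) = endo_scale c
      (endo_scale (1 / 6) (?i x * ?i y * ?i z))" for x y z c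
  proof -
    have "Poly_Mapping.single [x, y, z] (c / of_nat (fact 3)) =
        word_scale c (word_scale (1 / 6) (Poly_Mapping.single [x] 1 * Poly_Mapping.single [y] 1 *
            Poly_Mapping.single [z] 1))"
      by (simp add: single_mult_list fact_numeral)
    then show ?thesis by (simp only: lin quotient_endo_mult)
  qed
  have "?q (\<Sum>\<sigma> | \<sigma> permutes {1..3}. Poly_Mapping.single (word 3 (\<lambda>i. v (\<sigma> i))) (colour_sign eps 3
      \<sigma> d / of_nat (fact 3)))
     = (\<Sum>\<sigma> | \<sigma> permutes {1..3}. endo_scale (colour_sign eps 3 \<sigma> d) (endo_scale (1 / 6) (?i (v (\<sigma>
         1)) * ?i (v (\<sigma> 2)) * ?i (v (\<sigma> 3)))))"
    by (simp only: linear_map_sum[OF linear_quotient_endo] word_three monomial)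
  also have "\<dots> = ?q (six_terms word_scale mu_word (d 1) (d 2) (d 3) (v 1) (v 2) (v 3))"
    unfolding sum_permutes_three[of "\<lambda>i j k c. endo_scale c (endo_scale (1 / 6) (?i (v i) * ?i (v
        j) * ?i (v k)))" eps d]
    by (simp only: six_terms_def lin mu e.scale_minus_left e.scale_one) simp
  also have "six_terms word_scale mu_word (d 1) (d 2) (d 3) (v 1) (v 2) (v 3) = quantise
      (Poly_Mapping.single (word 3 v) 1)"
    unfolding word_three quantise_single using antisymmetrise_homogeneous[OF trilinear_mu_word v]
        by simp
  finally show ?thesis unfolding quotient_class_eq_iff_endo by simp
qed

lemma is_quantisation_map_exists: "\<exists>Q. is_quantisation_map eps scale V form 3 Q"
proof
  let ?Q = "\<lambda>X. cclass (quantise (SOME p. X = eclass p))"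
  have Q: "?Q (eclass p) = cclass (quantise p)" for p
  proof -
    have "eclass (SOME p'. eclass p = eclass p') = eclass p"
      by (rule sym, rule someI[of "\<lambda>p'. eclass p = eclass p'"], rule refl)
    from quantise_cong[OF this] show ?thesis by (rule arg_cong)
  qed
  show "is_quantisation_map eps scale V form 3 ?Q"
    unfolding is_quantisation_map_def exterior_power_three
  proof (intro conjI ballI allI impI)
    show "?Q \<in> eclass ` len3 \<rightarrow> carrier (clifford_algebra eps scale V form)"
      by (auto simp: carrier_quotient_algebra)
  next
    fix u u' assume "u \<in> eclass ` len3" "u' \<in> eclass ` len3"
    then obtain p p' where "u = eclass p" "u' = eclass p'" by blast
    then show "?Q (u \<oplus>\<^bsub>exterior_algebra eps scale V\<^esub> u') = ?Q u \<oplus>\<^bsub>clifford_algebra eps scale V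
        form\<^esub> ?Q u'"
      by (simp only: quotient_class_add[of _ "exterior_relations eps V", symmetric] Q)
        (simp only: linear_map_simps[OF linear_quantise] quotient_class_add)
  next
    fix c u assume "u \<in> eclass ` len3"
    then obtain p where "u = eclass p" by blast
    then show "?Q (quotient_scale scale (exterior_relations eps V) c u) =
        quotient_scale scale (clifford_relations eps V form) c (?Q u)"
      by (simp only: quotient_scale_class Q linear_map_simps[OF linear_quantise])
  next
    fix v :: "nat \<Rightarrow> 'v" and d assume "\<forall>i\<in>{1..3}. v i \<in> V (d i)"
    then have "v 1 \<in> V (d 1)" "v 2 \<in> V (d 2)" "v 3 \<in> V (d 3)" by auto
    then show "?Q (eclass (Poly_Mapping.single (word 3 v) 1)) = cclass
       (\<Sum>\<sigma> | \<sigma> permutes {1..3}. Poly_Mapping.single (word 3 (\<lambda>i. v (\<sigma> i))) (colour_sign eps 3 \<sigma> d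
           / of_nat (fact 3)))"
      unfolding Q by (rule quantise_homogeneous)
  qed
qed

lemma quantisation_class:
  assumes "p \<in> len3"
  shows "quantisation eps scale V form 3 (eclass p) = cclass (quantise p)"
proof -
  let ?Q = "quantisation eps scale V form 3"
  have Q: "is_quantisation_map eps scale V form 3 ?Q"
    unfolding quantisation_def by (rule someI_ex[OF is_quantisation_map_exists])
  have add: "?Q (eclass (p + p')) = ?Q (eclass p) \<oplus>\<^bsub>clifford_algebra eps scale V form\<^esub> ?Q (eclass p')"
    if "p \<in> len3" "p' \<in> len3" for p p'
    using Q that unfolding is_quantisation_map_def exterior_power_three quotient_class_add by blast
  have scl: "?Q (eclass (word_scale c p)) = quotient_scale scale (clifford_relations eps V form) c
      (?Q (eclass p))"
    if "p \<in> len3" for p c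
    using Q that unfolding is_quantisation_map_def exterior_power_three
        quotient_scale_class[symmetric] by blast
  note lq = linear_map_simps[OF linear_quantise]
  have single: "?Q (eclass (Poly_Mapping.single [x, y, z] 1)) = cclass (quantise
      (Poly_Mapping.single [x, y, z] 1))"
    if "x \<in> E" "y \<in> E" "z \<in> E" for x y z
  proof -
    let ?v = "vec3 x y z" and ?d = "\<lambda>i. dg (vec3 x y z i)"
    have d: "\<forall>i\<in>{1..3}. ?v i \<in> V (?d i)" by (rule vec3_degree[OF that])
    then have d': "?v 1 \<in> V (?d 1)" "?v 2 \<in> V (?d 2)" "?v 3 \<in> V (?d 3)" by auto
    have "?Q (eclass (Poly_Mapping.single (word 3 ?v) 1)) = cclass
       (\<Sum>\<sigma> | \<sigma> permutes {1..3}. Poly_Mapping.single (word 3 (\<lambda>i. ?v (\<sigma> i))) (colour_sign eps 3 \<sigma>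
           ?d / of_nat (fact 3)))"
      using Q d unfolding is_quantisation_map_def
      by (elim conjE) (erule allE, erule allE, erule impE, assumption, assumption)
    also have "\<dots> = cclass (quantise (Poly_Mapping.single (word 3 ?v) 1))"
      using quantise_homogeneous[of ?v ?d, OF d'] by (rule sym)
    finally show ?thesis unfolding word_three vec3 .
  qed
  show ?thesis
    using assms
  proof (induction p rule: len3_induct)
    case (add p q)
    then show ?case
      by (simp only: \<open>\<And>p' p. p \<in> len3 \<Longrightarrow> p' \<in> len3 \<Longrightarrow> ?Q (eclass (p + p')) = _\<close>[OF add.hyps])
        (simp only: add.IH lq quotient_class_add)
  next
    case (scale p c)
    then show ?case using scl[OF scale.hyps] by (simp add: quotient_scale_class lq)
  next
    case (cong p q)
    then show ?case using quantise_cong[OF cong.hyps(3)] by simp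
  next
    case (base x y z)
    then show ?case by (rule single)
  next
    case zero
    show ?case using scl[of 0 0] single_len3 carrier_quotient_algebra
    proof -
      \<comment> \<open>The value at 0 is a multiple by 0 of itself; that it is the class of some
        \<open>r\<close>, needed to compute this multiple, follows from the carrier condition on
        \<open>?Q\<close>.\<close>
      have z: "0 \<in> len3" by simp
      have "?Q (eclass 0) \<in> carrier (clifford_algebra eps scale V form)"
        using Q z unfolding is_quantisation_map_def exterior_power_three by blast
      then obtain r where r: "?Q (eclass 0) = cclass r" by (auto simp: carrier_quotient_algebra)
      have "?Q (eclass 0) = quotient_scale scale (clifford_relations eps V form) 0 (cclass r)"
        using scl[OF z, of 0] r by simp
      then show ?thesis by (simp add: quotient_scale_class lq)
    qed
  qed
qed

subsection \<open>Non-degeneracy of the form on the third exterior power\<close>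

text \<open>Six times the class of \<open>p\<close> is recovered from its pairings as the
  combination \<open>?S p\<close> of words in \<open>E\<close>. For a basis word, expansion turns
  \<open>?S\<close> into its six signed permutations, which all agree in the exterior
  algebra.\<close>

lemma pairing_determines:
  assumes "(6::'k) \<noteq> 0" and p: "p \<in> len3" and q: "q \<in> len3"
    and eq: "\<And>e f g. e \<in> E \<Longrightarrow> f \<in> E \<Longrightarrow> g \<in> E \<Longrightarrow>
      pairing p (dual e) (dual f) (dual g) = pairing q (dual e) (dual f) (dual g)"
  shows "eclass p = eclass q"
proof -
  let ?q = "quotient_endo (linear_relations scale \<union> exterior_relations eps V)"
  let ?i = "\<lambda>v. ?q (Poly_Mapping.single [v] 1)"
  let ?S = "\<lambda>p. \<Sum>e\<in>E. \<Sum>f\<in>E. \<Sum>g\<in>E. endo_scale (pairing p (dual e) (dual f) (dual g)) (?i g * ?i f *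
      ?i e)"
  note lin = linear_map_simps[OF linear_quotient_endo]
  note li = linear_map_simps[OF linear_quotient_endo_generator[OF vector_space_axioms, of
      "exterior_relations eps V"]]
  note lp = linear_map_simps[OF linear_pairing]
  let ?m = "\<lambda>x y z. ?i x * ?i y * ?i z"
  have tri: "trilinear scale endo_scale ?m"
    by (rule trilinearI[OF vector_space_axioms e.vector_space_axioms])
      (simp_all add: li distrib_left distrib_right endo_scale_mult)
  have word: "?q (Poly_Mapping.single [x, y, z] 1) = ?m x y z" for x y z
    unfolding quotient_endo_mult[symmetric] by (simp add: single_mult_list)
  have ext: "?m x y z = (\<Sum>e\<in>E. \<Sum>f\<in>E. \<Sum>g\<in>E. endo_scale (mu3 (dual e) (dual f) (dual g) x y z) (?m g
      f e))" for x y z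
  proof -
    have "?m x y z = (\<Sum>g\<in>E. \<Sum>f\<in>E. \<Sum>e\<in>E. endo_scale (mu3 (dual e) (dual f) (dual g) x y z) (?m g f e))"
      by (subst trilinear_expand[OF tri, symmetric]) (simp add: mu3_def mult_ac)
    also have "\<dots> = (\<Sum>g\<in>E. \<Sum>e\<in>E. \<Sum>f\<in>E. endo_scale (mu3 (dual e) (dual f) (dual g) x y z) (?m g f e))"
      by (intro sum.cong refl sum.swap)
    also have "\<dots> = (\<Sum>e\<in>E. \<Sum>g\<in>E. \<Sum>f\<in>E. endo_scale (mu3 (dual e) (dual f) (dual g) x y z) (?m g f e))"
      by (rule sum.swap)
    also have "\<dots> = (\<Sum>e\<in>E. \<Sum>f\<in>E. \<Sum>g\<in>E. endo_scale (mu3 (dual e) (dual f) (dual g) x y z) (?m g f e))"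
      by (intro sum.cong refl sum.swap)
    finally show ?thesis .
  qed
  have swap: "?i x * ?i y = - endo_scale (eps (dg x) (dg y)) (?i y * ?i x)" if "x \<in> E" "y \<in> E" for x y
  proof -
    have "Poly_Mapping.single [x, y] 1 + Poly_Mapping.single [y, x] (eps (dg x) (dg y)) \<in>
        exterior_ideal"
      by (rule word_ideal_base, rule UnI2, unfold exterior_relations_def)
        (use dg[OF that(1)] dg[OF that(2)] in blast)
    then have "?q (Poly_Mapping.single [x, y] 1 + word_scale (eps (dg x) (dg y))
        (Poly_Mapping.single [y, x] 1)) = 0"
      by (simp add: quotient_endo_zero_iff)
    then have "?q (Poly_Mapping.single [x, y] 1) = - endo_scale (eps (dg x) (dg y)) (?q
        (Poly_Mapping.single [y, x] 1))"
      by (simp only: lin eq_neg_iff_add_eq_0)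
    then show ?thesis
      unfolding quotient_endo_mult[symmetric] by (simp add: single_mult_list)
  qed
  have six: "six_terms endo_scale ?m (dg x) (dg y) (dg z) x y z = endo_scale 6 (?m x y z)"
    if x: "x \<in> E" and y: "y \<in> E" and z: "z \<in> E" for x y z
  proof -
    have s1: "endo_scale (eps (dg x) (dg y)) (?m y x w) = - ?m x y w" if "x \<in> E" "y \<in> E" for x y w
      using swap[OF that] by (simp add: endo_scale_mult flip: minus_mult_left)
    have s2: "endo_scale (eps (dg x) (dg y)) (?m w y x) = - ?m w x y" if "x \<in> E" "y \<in> E" for x y w
      using swap[OF that] by (simp add: endo_scale_mult mult.assoc flip: minus_mult_right)
    have a: "endo_scale (eps (dg x) (dg y) * eps (dg x) (dg z)) (?m y z x) = ?m x y z"
      using s2[OF x z, of y] s1[OF x y, of z]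
      by (simp only: e.scale_scale[symmetric] e.scale_minus_right minus_minus)
    have b: "endo_scale (eps (dg x) (dg z) * eps (dg y) (dg z)) (?m z x y) = ?m x y z"
      using s1[OF x z, of y] s2[OF y z, of x]
      by (simp only: mult.commute[of "eps (dg x) (dg z)"] e.scale_scale[symmetric]
          e.scale_minus_right minus_minus)
    have c: "endo_scale (eps (dg x) (dg y) * eps (dg x) (dg z) * eps (dg y) (dg z)) (?m z y x) = -
        ?m x y z"
      using s1[OF y z, of x] a
      by (simp only: e.scale_scale[symmetric] e.scale_minus_right)
    have "six_terms endo_scale ?m (dg x) (dg y) (dg z) x y z = ?m x y z + ?m x y z + ?m x y z + ?m
        x y z + ?m x y z + ?m x y z"
      unfolding six_terms_def a b c s1[OF x y] s2[OF y z] by simp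
    also have "\<dots> = endo_scale (1 + 1 + 1 + 1 + 1 + 1) (?m x y z)"
      by (simp only: e.scale_left_distrib e.scale_one)
    finally show ?thesis by simp
  qed
  have key: "endo_scale 6 (?q p) = ?S p" if "p \<in> len3" for p
    using that
  proof (induction p rule: len3_induct)
    case (add p p')
    then show ?case by (simp add: lin lp e.scale_right_distrib e.scale_left_distrib sum.distrib)
  next
    case (scale p c)
    have "endo_scale 6 (?q (word_scale c p)) = endo_scale c (endo_scale 6 (?q p))"
      by (simp add: lin mult.commute)
    also have "\<dots> = ?S (word_scale c p)"
      unfolding scale.IH by (simp add: lp e.scale_sum_right)
    finally show ?case .
  next
    case (cong p p')
    have "pairing p = pairing p'"
      using pairing_ideal[of "p - p'"] cong.hyps(3) by (simp add: quotient_class_eq_iff fun_eq_iff lp)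
    moreover have "?q p = ?q p'" using cong.hyps(3) by (simp add: quotient_class_eq_iff_endo)
    ultimately show ?case using cong.IH by simp
  next
    case (base x y z)
    have "pairing (Poly_Mapping.single [x, y, z] 1) v1 v2 v3 = six_terms (*) (mu3 v1 v2 v3) (dg x)
        (dg y) (dg z) x y z" for v1 v2 v3
      using antisymmetrise_homogeneous[OF trilinear_mu3 dg[OF base(1)] dg[OF base(2)] dg[OF base(3)]]
      by (simp add: pairing_single)
    then have "?S (Poly_Mapping.single [x, y, z] 1) =
        (\<Sum>e\<in>E. \<Sum>f\<in>E. \<Sum>g\<in>E. endo_scale (six_terms (*) (mu3 (dual e) (dual f) (dual g)) (dg x) (dg
            y) (dg z) x y z) (?m g f e))"
      by simp
    also have "\<dots> = six_terms endo_scale ?m (dg x) (dg y) (dg z) x y z"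
      unfolding six_terms_def[of endo_scale] ext[of x y z] ext[of y x z] ext[of x z y] ext[of y z
          x] ext[of z x y] ext[of z y x]
        e.scale_sum_right sum.distrib[symmetric] sum_subtractf[symmetric] e.scale_scale
      by (intro sum.cong refl) (simp only: six_terms_def e.scale_left_distrib e.scale_left_diff_distrib)
    finally show ?case unfolding six[OF base] word by simp
  next
    case zero
    show ?case by (simp add: lin lp)
  qed
  have "?S p = ?S q" by (intro sum.cong refl) (simp only: eq)
  then have "endo_scale 6 (?q p) = endo_scale 6 (?q q)" unfolding key[OF p] key[OF q] .
  then have "?q p = ?q q" using assms(1) by (simp only: e.scale_cancel_left) simp
  then show ?thesis by (simp only: quotient_class_eq_iff_endo)
qed

end

section \<open>The cubic term\<close>

context cubic_space
begin

definition cphi :: "'v \<Rightarrow> 'v \<Rightarrow> 'v \<Rightarrow> 'k" where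
  "cphi e g l = form (dual e) (phi (dual g) (dual l))"

lemma form_phi_shift:
  assumes x: "x \<in> V a" and y: "y \<in> V b"
  shows "form x (phi y z) = form (phi x y) z"
proof -
  have "form (phi x y) z = - eps a b * form (phi y x) z"
    using phi_swap[OF x y] by (simp add: form_left)
  also have "\<dots> = eps a b * (eps b a * form x (phi y z))"
    using phi_invariant[OF y x] by simp
  finally show ?thesis by (simp add: eps_cancel)
qed

lemma cphi_swap:
  assumes "e \<in> E" "g \<in> E" "l \<in> E"
  shows "cphi e g l = - (eps (dg g) (dg l) * cphi e l g)" "cphi e g l = - (eps (dg e) (dg g) *
      cphi g e l)"
proof -
  note d = dual_degree[OF assms(1)] dual_degree[OF assms(2)] dual_degree[OF assms(3)]
  show "cphi e g l = - (eps (dg g) (dg l) * cphi e l g)"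
    unfolding cphi_def using phi_swap[OF d(2,3)] by (simp add: form_right)
  show "cphi e g l = - (eps (dg e) (dg g) * cphi g e l)"
    unfolding cphi_def form_phi_shift[OF d(1,2)] using phi_invariant[OF d(1,2)] by simp
qed

text \<open>The coefficients \<open>cphi\<close> change under permutations by the same signs as the
  terms of \<open>six_terms\<close>, so after renaming the indices all six sums coincide. It serves
  both the form (\<open>mu3\<close>) and the quantisation (\<open>mu_word\<close>).\<close>

lemma cphi_six_terms:
  fixes t :: "'k \<Rightarrow> 'm::ab_group_add \<Rightarrow> 'm"
  assumes \<mu>: "trilinear sv t \<mu>"
  shows "(\<Sum>e\<in>E. \<Sum>g\<in>E. \<Sum>l\<in>E. t (cphi e g l) (antisymmetrise t \<mu> l g e)) =
    t 6 (\<Sum>e\<in>E. \<Sum>g\<in>E. \<Sum>l\<in>E. t (cphi e g l) (\<mu> l g e))"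
proof -
  interpret t: vector_space t using Vector_Spaces.linear.axioms(2)[OF trilinearD(3)[OF \<mu>]] .
  let ?S = "\<lambda>F. \<Sum>e\<in>E. \<Sum>g\<in>E. \<Sum>l\<in>E. F e g l"
  let ?H = "\<lambda>e g l. t (cphi e g l) (\<mu> l g e)"
  have s12: "?S F = ?S (\<lambda>e g l. F g e l)" for F :: "'v \<Rightarrow> 'v \<Rightarrow> 'v \<Rightarrow> 'm"
    by (rule sum.swap)
  have s23: "?S F = ?S (\<lambda>e g l. F e l g)" for F :: "'v \<Rightarrow> 'v \<Rightarrow> 'v \<Rightarrow> 'm"
    by (intro sum.cong refl sum.swap)
  have r1: "?S (\<lambda>e g l. ?H e l g) = ?S ?H" by (rule s23[symmetric])
  have r2: "?S (\<lambda>e g l. ?H g e l) = ?S ?H" by (rule s12[symmetric])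
  have r3: "?S (\<lambda>e g l. ?H l e g) = ?S ?H" using s23[of "\<lambda>e g l. ?H l e g"] r2 by simp
  have r4: "?S (\<lambda>e g l. ?H g l e) = ?S ?H" using s12[of "\<lambda>e g l. ?H g l e"] r1 by simp
  have r5: "?S (\<lambda>e g l. ?H l g e) = ?S ?H" using s23[of "\<lambda>e g l. ?H l g e"] r4 by simp
  have six: "t (cphi e g l) (antisymmetrise t \<mu> l g e) =
     ?H e g l + ?H e l g + ?H g e l + ?H l e g + ?H g l e + ?H l g e"
    if e: "e \<in> E" and g: "g \<in> E" and l: "l \<in> E" for e g l
  proof -
    have 1: "cphi e g l * eps (dg l) (dg g) = - cphi e l g"
      using cphi_swap(1)[OF e g l] by (simp add: eps_inverse)
    have 2: "cphi e g l * eps (dg g) (dg e) = - cphi g e l"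
      using cphi_swap(2)[OF e g l] by (simp add: eps_inverse)
    have 3: "cphi e g l * (eps (dg l) (dg g) * eps (dg l) (dg e)) = cphi l e g"
      unfolding mult.assoc[symmetric] 1 using cphi_swap(2)[OF e l g] by (simp add: eps_inverse)
    have 4: "cphi e g l * (eps (dg l) (dg e) * eps (dg g) (dg e)) = cphi g l e"
      unfolding mult.commute[of "eps (dg l) (dg e)"] mult.assoc[symmetric] 2
      using cphi_swap(1)[OF g e l] by (simp add: eps_inverse)
    have 5: "cphi e g l * (eps (dg l) (dg g) * eps (dg l) (dg e) * eps (dg g) (dg e)) = - cphi l g e"
      unfolding mult.assoc[symmetric, of "cphi e g l"] 3[unfolded mult.assoc[symmetric, of "cphi e
          g l"]]
      using cphi_swap(1)[OF l e g] by (simp add: eps_inverse)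
    show ?thesis
      unfolding antisymmetrise_homogeneous[OF \<mu> dg[OF l] dg[OF g] dg[OF e]] six_terms_def
        t.scale_right_distrib t.scale_right_diff_distrib t.scale_scale 1 2 3 4 5
      by simp
  qed
  have "?S (\<lambda>e g l. t (cphi e g l) (antisymmetrise t \<mu> l g e)) =
      ?S (\<lambda>e g l. ?H e g l + ?H e l g + ?H g e l + ?H l e g + ?H g l e + ?H l g e)"
    by (intro sum.cong refl six)
  also have "\<dots> = ?S ?H + ?S ?H + ?S ?H + ?S ?H + ?S ?H + ?S ?H"
    unfolding sum.distrib r1 r2 r3 r4 r5 ..
  also have "\<dots> = t (1 + 1 + 1 + 1 + 1 + 1) (?S ?H)"
    by (simp only: t.scale_left_distrib t.scale_one)
  finally show ?thesis by simp
qed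

text \<open>A representative of the cubic tensor. Here \<open>1 / 12\<close> is
  \<open>1 / 2 * 1 / 6\<close>: the first factor belongs to the trilinear map, the second offsets
  the 6 of \<open>cphi_six_terms\<close>.\<close>

definition cubic_poly :: "'v list \<Rightarrow>\<^sub>0 'k" where
  "cubic_poly = (\<Sum>e\<in>E. \<Sum>g\<in>E. \<Sum>l\<in>E. word_scale (1 / 12 * cphi e g l) (Poly_Mapping.single [l, g, e] 1))"

lemma cubic_poly_len3: "cubic_poly \<in> len3"
  unfolding cubic_poly_def
  by (intro words.subspace_sum[OF subspace_len3] words.subspace_scale[OF subspace_len3] single_len3)

lemma sum_dual_trilinear:
  "(\<Sum>e\<in>E. \<Sum>g\<in>E. \<Sum>l\<in>E. cphi e g l * (form e u * form g v * form l w)) = form u (phi v w)"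
proof -
  have 1: "(\<Sum>l\<in>E. cphi e g l * form l w) = form (dual e) (phi (dual g) w)" for e g
    unfolding cphi_def
    by (subst (2) expand_dual[of w, symmetric]) (simp add: phi_right form_right mult.commute)
  have 2: "(\<Sum>g\<in>E. form (dual e) (phi (dual g) w) * form g v) = form (dual e) (phi v w)" for e
    by (subst (2) expand_dual[of v, symmetric]) (simp add: phi_left form_right mult.commute)
  have 3: "(\<Sum>e\<in>E. form (dual e) (phi v w) * form e u) = form u (phi v w)"
    by (subst (2) expand_dual[of u, symmetric]) (simp add: form_left mult.commute)
  have "(\<Sum>e\<in>E. \<Sum>g\<in>E. \<Sum>l\<in>E. cphi e g l * (form e u * form g v * form l w)) =
      (\<Sum>e\<in>E. (\<Sum>g\<in>E. (\<Sum>l\<in>E. cphi e g l * form l w) * form g v) * form e u)"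
    by (simp add: sum_distrib_right sum_distrib_left mult_ac)
  then show ?thesis unfolding 1 2 3 .
qed

lemma pairing_cubic_poly:
  assumes "(6::'k) \<noteq> 0"
  shows "pairing cubic_poly u v w = 1 / 2 * form u (phi v w)"
proof -
  note lp = linear_map_simps[OF linear_pairing]
  have "pairing cubic_poly u v w =
      1 / 12 * (\<Sum>e\<in>E. \<Sum>g\<in>E. \<Sum>l\<in>E. cphi e g l * antisymmetrise (*) (mu3 u v w) l g e)"
    by (simp add: cubic_poly_def lp pairing_single sum_distrib_left mult.assoc del: word_scale_single)
  also have "\<dots> = 1 / 12 * (6 * form u (phi v w))"
    unfolding cphi_six_terms[OF trilinear_mu3] by (simp add: mu3_def sum_dual_trilinear)
  also have "\<dots> = 1 / 2 * form u (phi v w)"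
  proof -
    have cancel: "1 / (x * y) * (x * z) = 1 / y * z" if "x \<noteq> 0" for x y z :: 'k
      using that by simp
    note cancel[OF assms, of 2 "form u (phi v w)"]
    moreover have "(6::'k) * 2 = 12" by simp
    ultimately show ?thesis by (simp only:)
  qed
  finally show ?thesis .
qed

lemma cubic_tensor_eq:
  assumes six: "(6::'k) \<noteq> 0"
  shows "cubic_tensor eps sv V form phi = eclass cubic_poly"
  unfolding cubic_tensor_def exterior_power_three
proof (rule the_equality)
  let ?F = "exterior_form eps sv V form 3"
  have F: "is_exterior_form eps sv V form 3 ?F"
    unfolding exterior_form_def by (rule someI_ex[OF is_exterior_form_exists])
  have Fp: "?F (eclass p) (eclass (Poly_Mapping.single [x, y, z] 1)) = pairing p x y z" if "p \<in>
      len3" for p x y z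
    using is_exterior_form_unique[OF F that single_len3] by (simp add: ext_form_single)
  show "eclass cubic_poly \<in> eclass ` len3 \<and>
    (\<forall>u v w. ?F (eclass cubic_poly) (eclass (Poly_Mapping.single [u, v, w] 1)) = 1 / 2 * form u
        (phi v w))"
    using cubic_poly_len3 Fp[OF cubic_poly_len3] pairing_cubic_poly[OF six] by simp
  fix f assume f: "f \<in> eclass ` len3 \<and>
    (\<forall>u v w. ?F f (eclass (Poly_Mapping.single [u, v, w] 1)) = 1 / 2 * form u (phi v w))"
  then obtain p where p: "p \<in> len3" "f = eclass p" by blast
  have "pairing p x y z = pairing cubic_poly x y z" for x y z
    using f unfolding p(2) Fp[OF p(1)] pairing_cubic_poly[OF six] by blast
  then have "eclass p = eclass cubic_poly"
    by (intro pairing_determines[OF six p(1) cubic_poly_len3])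
  then show "f = eclass cubic_poly" unfolding p(2) .
qed

lemma cubic_term_eq:
  assumes "(6::'k) \<noteq> 0"
  shows "cubic_term eps sv V form phi = cclass (quantise cubic_poly)"
  unfolding cubic_term_def cubic_tensor_eq[OF assms] by (rule quantisation_class[OF cubic_poly_len3])

text \<open>The coefficients being antisymmetric already, quantisation changes nothing: the 6 of
  \<open>cphi_six_terms\<close> cancels the \<open>1 / 6\<close> of \<open>mu_word\<close>. Summing
  over \<open>l\<close> then collects the vector \<open>phi (dual e) (dual g)\<close>.\<close>

lemma quotient_endo_cubic:
  assumes six: "(6::'k) \<noteq> 0"
  defines "q \<equiv> quotient_endo (linear_relations sv \<union> clifford_relations eps V form)"
  shows "q (quantise cubic_poly) = endo_scale (1 / 12) (\<Sum>e\<in>E. \<Sum>g\<in>E.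
    q (Poly_Mapping.single [phi (dual e) (dual g)] 1) * q (Poly_Mapping.single [g] 1) * q
        (Poly_Mapping.single [e] 1))"
proof -
  interpret e: vector_space endo_scale by (rule vector_space_endo_scale)
  let ?i = "\<lambda>v. q (Poly_Mapping.single [v] 1)"
  note lin = linear_map_simps[OF linear_quotient_endo, of "linear_relations sv \<union>
      clifford_relations eps V form", folded q_def]
  note li = linear_map_simps[OF linear_quotient_endo_generator[OF vector_space_axioms, of
      "clifford_relations eps V form"], folded q_def]
  note lq = linear_map_simps[OF linear_quantise]
  have mu: "q (mu_word x y z) = endo_scale (1 / 6) (?i x * ?i y * ?i z)" for x y z
    unfolding mu_word_def q_def
    by (simp only: linear_map_scale[OF linear_quotient_endo] quotient_endo_mult
        quotient_endo_generator_expansion)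
  have "quantise cubic_poly = word_scale (1 / 12)
      (\<Sum>e\<in>E. \<Sum>g\<in>E. \<Sum>l\<in>E. word_scale (cphi e g l) (antisymmetrise word_scale mu_word l g e))"
    by (simp add: cubic_poly_def lq quantise_single words.scale_sum_right del: word_scale_single)
  then have "q (quantise cubic_poly) =
      endo_scale (1 / 12) (endo_scale 6 (\<Sum>e\<in>E. \<Sum>g\<in>E. \<Sum>l\<in>E. endo_scale (cphi e g l) (endo_scale (1
          / 6) (?i l * ?i g * ?i e))))"
    unfolding cphi_six_terms[OF trilinear_mu_word] by (simp only: lin mu)
  also have "\<dots> = endo_scale (1 / 12) (\<Sum>e\<in>E. \<Sum>g\<in>E. \<Sum>l\<in>E. endo_scale (cphi e g l) (?i l * ?i g * ?i e))"
  proof -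
    have "endo_scale 6 (endo_scale c (endo_scale (1 / 6) x)) = endo_scale c x" for c and x ::
        "('v, 'k) word_endo"
      using six by simp
    then show ?thesis by (simp only: e.scale_sum_right)
  qed
  finally have main: "q (quantise cubic_poly) =
      endo_scale (1 / 12) (\<Sum>e\<in>E. \<Sum>g\<in>E. \<Sum>l\<in>E. endo_scale (cphi e g l) (?i l * ?i g * ?i e))" .
  have "(\<Sum>l\<in>E. endo_scale (cphi e g l) (?i l * ?i g * ?i e)) = ?i (phi (dual e) (dual g)) * ?i g * ?i e"
    if "e \<in> E" "g \<in> E" for e g
  proof -
    have "?i (phi (dual e) (dual g)) = ?i (\<Sum>l\<in>E. sv (form (phi (dual e) (dual g)) (dual l)) l)"
      by (simp only: expand_basis)
    also have "\<dots> = (\<Sum>l\<in>E. endo_scale (cphi e g l) (?i l))"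
      unfolding li cphi_def form_phi_shift[OF dual_degree[OF that(1)] dual_degree[OF that(2)]] ..
    finally show ?thesis by (simp only: sum_distrib_right endo_scale_mult)
  qed
  then have "(\<Sum>e\<in>E. \<Sum>g\<in>E. \<Sum>l\<in>E. endo_scale (cphi e g l) (?i l * ?i g * ?i e)) =
      (\<Sum>e\<in>E. \<Sum>g\<in>E. ?i (phi (dual e) (dual g)) * ?i g * ?i e)"
    by (intro sum.cong refl)
  then show ?thesis unfolding main by simp
qed

end

section \<open>The extended bracket\<close>

lemma bilinear_mapD:
  assumes "bilinear_map s1 s2 s3 f"
  shows "Vector_Spaces.linear s2 s3 (f x)" "Vector_Spaces.linear s1 s3 (\<lambda>x. f x y)"
  using assms by (simp_all add: bilinear_map_def)

lemma bilinear_mapI: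
  assumes "vector_space s1" "vector_space s2" "vector_space s3"
    and "\<And>x x' y. f (x + x') y = f x y + f x' y" "\<And>c x y. f (s1 c x) y = s3 c (f x y)"
    and "\<And>x y y'. f x (y + y') = f x y + f x y'" "\<And>c x y. f x (s2 c y) = s3 c (f x y)"
  shows "bilinear_map s1 s2 s3 f"
  unfolding bilinear_map_def Vector_Spaces.linear_iff using assms by simp

lemma vector_space_prod_scale:
  assumes "vector_space s1" "vector_space s2"
  shows "vector_space (prod_scale s1 s2)"
proof -
  interpret s1: vector_space s1 by fact
  interpret s2: vector_space s2 by fact
  show ?thesis
    by unfold_locales (simp_all add: prod_scale_def algebra_simps prod_eq_iff)
qed

lemma graded_vector_space_prod:
  fixes s1 :: "'k::field \<Rightarrow> 'x::ab_group_add \<Rightarrow> 'x" and s2 :: "'k \<Rightarrow> 'v::ab_group_add \<Rightarrow> 'v"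
    and G :: "'c::ab_group_add \<Rightarrow> 'x set" and V :: "'c \<Rightarrow> 'v set"
  assumes "graded_vector_space s1 G" "graded_vector_space s2 V"
  shows "graded_vector_space (prod_scale s1 s2) (\<lambda>a. G a \<times> V a)"
proof -
  interpret s1: graded_vector_space s1 G by fact
  interpret s2: graded_vector_space s2 V by fact
  interpret p: vector_space "prod_scale s1 s2"
    by (rule vector_space_prod_scale[OF s1.vector_space_axioms s2.vector_space_axioms])
  show ?thesis
  proof unfold_locales
    fix a
    show "p.subspace (G a \<times> V a)"
      using s1.subspace_comp[of a] s2.subspace_comp[of a]
      by (auto simp: p.subspace_def s1.subspace_def s2.subspace_def prod_scale_def zero_prod_def)
  next
    fix v :: "'x \<times> 'v"
    let ?P = "\<lambda>(f :: 'c \<Rightarrow> 'x \<times> 'v) v. finite {a. f a \<noteq> 0} \<and> (\<forall>a. f a \<in> G a \<times> V a) \<and> v = (\<Sum>a | f a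
        \<noteq> 0. f a)"
    let ?P1 = "\<lambda>(f :: 'c \<Rightarrow> 'x) v. finite {a. f a \<noteq> 0} \<and> (\<forall>a. f a \<in> G a) \<and> v = (\<Sum>a | f a \<noteq> 0. f a)"
    let ?P2 = "\<lambda>(f :: 'c \<Rightarrow> 'v) v. finite {a. f a \<noteq> 0} \<and> (\<forall>a. f a \<in> V a) \<and> v = (\<Sum>a | f a \<noteq> 0. f a)"
    from ex1_implies_ex[OF s1.direct_sum[of "fst v"]] obtain f1 where f1: "?P1 f1 (fst v)" ..
    from ex1_implies_ex[OF s2.direct_sum[of "snd v"]] obtain f2 where f2: "?P2 f2 (snd v)" ..
    show "\<exists>!f. ?P f v"
    proof (rule ex1I)
      let ?f = "\<lambda>a. (f1 a, f2 a)"
      have set: "{a. ?f a \<noteq> 0} = {a. f1 a \<noteq> 0} \<union> {a. f2 a \<noteq> 0}" by (auto simp: zero_prod_def)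
      have fin: "finite {a. ?f a \<noteq> 0}" unfolding set using f1 f2 by blast
      have "(\<Sum>a | ?f a \<noteq> 0. ?f a) = (\<Sum>a | ?f a \<noteq> 0. f1 a, \<Sum>a | ?f a \<noteq> 0. f2 a)"
        by (simp add: prod_eq_iff fst_sum snd_sum)
      also have "(\<Sum>a | ?f a \<noteq> 0. f1 a) = (\<Sum>a | f1 a \<noteq> 0. f1 a)"
        by (rule sum.mono_neutral_right[OF fin]) (auto simp: zero_prod_def)
      also have "(\<Sum>a | ?f a \<noteq> 0. f2 a) = (\<Sum>a | f2 a \<noteq> 0. f2 a)"
        by (rule sum.mono_neutral_right[OF fin]) (auto simp: zero_prod_def)
      finally show "?P ?f v" using f1 f2 fin by (simp add: prod_eq_iff)
    next
      fix f assume f: "?P f v"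
      have fin: "finite {a. f a \<noteq> 0}" using f by blast
      have 1: "?P1 (\<lambda>a. fst (f a)) (fst v)"
      proof (intro conjI)
        show "finite {a. fst (f a) \<noteq> 0}" by (rule finite_subset[OF _ fin]) auto
        show "\<forall>a. fst (f a) \<in> G a" using f by (simp add: mem_Times_iff)
        have "fst v = (\<Sum>a | f a \<noteq> 0. fst (f a))" using f by (simp add: fst_sum)
        also have "\<dots> = (\<Sum>a | fst (f a) \<noteq> 0. fst (f a))"
          by (rule sum.mono_neutral_right[OF fin]) auto
        finally show "fst v = (\<Sum>a | fst (f a) \<noteq> 0. fst (f a))" .
      qed
      have 2: "?P2 (\<lambda>a. snd (f a)) (snd v)"
      proof (intro conjI)
        show "finite {a. snd (f a) \<noteq> 0}" by (rule finite_subset[OF _ fin]) auto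
        show "\<forall>a. snd (f a) \<in> V a" using f by (simp add: mem_Times_iff)
        have "snd v = (\<Sum>a | f a \<noteq> 0. snd (f a))" using f by (simp add: snd_sum)
        also have "\<dots> = (\<Sum>a | snd (f a) \<noteq> 0. snd (f a))"
          by (rule sum.mono_neutral_right[OF fin]) auto
        finally show "snd v = (\<Sum>a | snd (f a) \<noteq> 0. snd (f a))" .
      qed
      have "(\<lambda>a. fst (f a)) = f1"
        by (rule Uniq_D[of "\<lambda>f. ?P1 f (fst v)" "\<lambda>a. fst (f a)" f1,
              OF ex1_iff_ex_Uniq[THEN iffD1, OF s1.direct_sum[of "fst v"], THEN conjunct2] 1 f1])
      moreover have "(\<lambda>a. snd (f a)) = f2"
        by (rule Uniq_D[of "\<lambda>f. ?P2 f (snd v)" "\<lambda>a. snd (f a)" f2,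
              OF ex1_iff_ex_Uniq[THEN iffD1, OF s2.direct_sum[of "snd v"], THEN conjunct2] 2 f2])
      ultimately show "f = (\<lambda>a. (f1 a, f2 a))" by (auto simp: fun_eq_iff prod_eq_iff)
    qed
  qed
qed

locale cubic_extension =
  quadratic_colour_lie_algebra eps sg G br B + orthogonal_representation eps sg G br sv V form rep
  for eps :: "'c::ab_group_add \<Rightarrow> 'c \<Rightarrow> 'k::field"
    and sg :: "'k \<Rightarrow> 'x::ab_group_add \<Rightarrow> 'x" and G :: "'c \<Rightarrow> 'x set"
    and br :: "'x \<Rightarrow> 'x \<Rightarrow> 'x" and B :: "'x \<Rightarrow> 'x \<Rightarrow> 'k"
    and sv :: "'k \<Rightarrow> 'v::ab_group_add \<Rightarrow> 'v" and V :: "'c \<Rightarrow> 'v set"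
    and form :: "'v \<Rightarrow> 'v \<Rightarrow> 'k" and rep :: "'x \<Rightarrow> 'v \<Rightarrow> 'v" +
  fixes mu :: "'v \<Rightarrow> 'v \<Rightarrow> 'x" and phi :: "'v \<Rightarrow> 'v \<Rightarrow> 'v"
    and brt :: "'x \<times> 'v \<Rightarrow> 'x \<times> 'v \<Rightarrow> 'x \<times> 'v"
    and X :: "'x set" and E :: "'v set"
  assumes char: "CHAR('k) \<noteq> 2" "CHAR('k) \<noteq> 3"
    and finite_dim: "finite_dim sg" "finite_dim sv"
    and mu: "moment_map eps sg G B sv V form rep mu"
    and phi: "bilinear_map sv sv sv phi" "degree_zero V V phi" "eps_antisymmetric eps V sv phi"
    and phi_equivariant: "\<lbrakk>x \<in> G a; v \<in> V b\<rbrakk> \<Longrightarrow>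
        rep x (phi v w) = phi (rep x v) w + sv (eps a b) (phi v (rep x w))"
    and phi_invariant': "\<lbrakk>u \<in> V a; v \<in> V b\<rbrakk> \<Longrightarrow>
        form (phi u v) w = - eps a b * form v (phi u w)"
    and brt: "extended_bracket eps sg G br sv V rep mu phi brt"
    and bases: "homogeneous_basis sg G X" "homogeneous_basis sv V E"
begin

lemma numeral_nonzero: "(2::'k) \<noteq> 0" "(3::'k) \<noteq> 0" "(6::'k) \<noteq> 0"
proof -
  have char1: "CHAR('k) \<noteq> 1" by simp
  show 2: "(2::'k) \<noteq> 0"
  proof
    assume "(2::'k) = 0"
    then have "of_nat 2 = (0::'k)" by simp
    then have "CHAR('k) dvd 2" by (simp only: of_nat_eq_0_iff_char_dvd)
    then have "CHAR('k) \<le> 2" "CHAR('k) \<noteq> 0"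
      by (simp add: dvd_imp_le) (metis \<open>CHAR('k) dvd 2\<close> dvd_0_left_iff zero_neq_numeral)
    then have "CHAR('k) = 1 \<or> CHAR('k) = 2" by linarith
    then show False using char char1 by blast
  qed
  show 3: "(3::'k) \<noteq> 0"
  proof
    assume "(3::'k) = 0"
    then have "of_nat 3 = (0::'k)" by simp
    then have d: "CHAR('k) dvd 3" by (simp only: of_nat_eq_0_iff_char_dvd)
    then have "CHAR('k) \<le> 3" "CHAR('k) \<noteq> 0"
      by (simp add: dvd_imp_le) (metis d dvd_0_left_iff zero_neq_numeral)
    then have "CHAR('k) = 1 \<or> CHAR('k) = 2 \<or> CHAR('k) = 3" by linarith
    then show False using char char1 by blast
  qed
  have "(2::'k) * 3 \<noteq> 0" using 2 3 by (simp only: mult_eq_0_iff) simp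
  then show "(6::'k) \<noteq> 0" by simp
qed

abbreviation "cl_relations \<equiv> linear_relations sv \<union> clifford_relations eps V form"
abbreviation "cl_endo \<equiv> quotient_endo cl_relations"
abbreviation "cl_gen \<equiv> \<lambda>v. cl_endo (Poly_Mapping.single [v] 1)"

sublocale M: moment_model eps sv V form E endo_scale "cl_endo 1" cl_gen phi sg G B X rep mu
proof -
  interpret E: eps_symmetric_basis eps sv V form E
    by unfold_locales (simp_all add: finite_dim bases)
  interpret X: eps_symmetric_basis eps sg G B X
    by unfold_locales (simp_all add: finite_dim bases)
  interpret C: clifford_model eps sv V form E endo_scale "cl_endo 1" cl_gen
    by (rule E.clifford_model_quotient_endo[OF numeral_nonzero(1,2)])
  show "moment_model eps sv V form E endo_scale (cl_endo 1) cl_gen phi sg G B X rep mu"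
  proof (intro moment_model.intro cubic_model.intro so_family.intro cubic_space.intro)
    show "clifford_model eps sv V form E endo_scale (cl_endo 1) cl_gen" by (rule
        C.clifford_model_axioms)
    show "eps_symmetric_basis eps sv V form E" by (rule E.eps_symmetric_basis_axioms)
    show "eps_symmetric_basis eps sg G B X" by (rule X.eps_symmetric_basis_axioms)
    show "cubic_space_axioms eps sv V form phi"
      by (rule cubic_space_axioms.intro, rule phi(1), rule phi(2), rule phi(3), rule phi_invariant')
    show "so_family_axioms eps sv V form sg G rep"
      by (rule so_family_axioms.intro, rule rep_linear, rule rep_so)
    show "moment_model_axioms sv V form sg G B rep mu"
      by (rule moment_model_axioms.intro) (use mu in \<open>simp_all add: moment_map_def\<close>)
  qed (rule C.clifford_model_axioms)
qed

lemma mu_swap: "v \<in> V a \<Longrightarrow> w \<in> V b \<Longrightarrow> mu v w = - sg (eps a b) (mu w v)"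
  using mu unfolding moment_map_def eps_antisymmetric_def by blast

lemma mu_linear: "Vector_Spaces.linear sv sg (mu v)" "Vector_Spaces.linear sv sg (\<lambda>v. mu v w)"
  using mu unfolding moment_map_def bilinear_map_def by blast+

subsection \<open>The image of the Casimir element\<close>

definition pi_poly :: "'x \<Rightarrow> ('v list \<Rightarrow>\<^sub>0 'k)" where
  "pi_poly x = (\<Sum>e\<in>E. Poly_Mapping.single [rep x (M.dual e), e] (1 / 4))"

lemma cl_endo_pi_poly: "cl_endo (pi_poly x) = M.star (rep x)"
proof -
  note lin = linear_map_simps[OF linear_quotient_endo]
  have "pi_poly x = word_scale (1 / 4) (\<Sum>e\<in>E. Poly_Mapping.single [rep x (M.dual e)] 1 *
      Poly_Mapping.single [e] 1)"
    by (simp add: pi_poly_def single_mult_list words.scale_sum_right)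
  then show ?thesis by (simp only: lin quotient_endo_mult M.star_def)
qed

text \<open>The bracket relations are respected because \<open>rep\<close> and, by
  \<open>star_star\<close>, \<open>star\<close> are morphisms; this provides the map that
  \<open>pi_star\<close> chooses.\<close>

lemma word_hom_pi_poly_relations:
  assumes "r \<in> linear_relations sg \<union> enveloping_relations eps G br"
  shows "word_hom pi_poly r \<in> word_ideal cl_relations"
proof -
  note lin = linear_map_simps[OF linear_quotient_endo]
  have wh: "cl_endo (word_hom pi_poly (Poly_Mapping.single [x] c)) = endo_scale c (M.star (rep x))"
    "cl_endo (word_hom pi_poly (Poly_Mapping.single [x, y] c)) = endo_scale c (M.star (rep x) *
        M.star (rep y))" for x y c
    by (simp_all add: word_hom_single lin quotient_endo_mult cl_endo_pi_poly)
  note ls = linear_map_simps[OF M.linear_star[where f = rep, OF rep_linear]]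
  from assms have "cl_endo (word_hom pi_poly r) = 0"
  proof
    assume "r \<in> linear_relations sg"
    then consider x y where "r = Poly_Mapping.single [x + y] 1 - Poly_Mapping.single [x] 1 -
        Poly_Mapping.single [y] 1"
      | c x where "r = Poly_Mapping.single [sg c x] 1 - Poly_Mapping.single [x] c"
      by (auto simp: linear_relations_def)
    then show ?thesis by cases (simp_all add: word_hom lin wh ls)
  next
    assume "r \<in> enveloping_relations eps G br"
    then obtain x y a b where xy: "x \<in> G a" "y \<in> G b"
      and r: "r = Poly_Mapping.single [x, y] 1 - Poly_Mapping.single [y, x] (eps a b) -
          Poly_Mapping.single [br x y] 1"
      by (auto simp: enveloping_relations_def)
    have "rep (br x y) = (\<lambda>v. rep x (rep y v) - sv (eps a b) (rep y (rep x v)))"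
      using rep_bracket[OF xy] by (simp add: fun_eq_iff)
    then show ?thesis
      using M.star_star[OF rep_so[OF xy(1)] rep_so[OF xy(2)]] by (simp add: r word_hom lin wh)
  qed
  then show ?thesis by (simp only: quotient_endo_zero_iff)
qed

lemma pi_star_class:
  "pi_star eps sg G br sv V form rep E (enveloping_class eps sg G br p) = clifford_class eps sv V
      form (word_hom pi_poly p)"
proof -
  let ?P = "\<lambda>h. h \<in> ring_hom (enveloping_algebra eps sg G br) (clifford_algebra eps sv V form) \<and>
        (\<forall>c. h (enveloping_class eps sg G br (Poly_Mapping.single [] c)) =
             clifford_class eps sv V form (Poly_Mapping.single [] c)) \<and>
        (\<forall>x. h (enveloping_class eps sg G br (Poly_Mapping.single [x] 1)) =
             pi_star_generator eps sv V form rep E x)"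
  obtain h where h: "h \<in> ring_hom (enveloping_algebra eps sg G br) (clifford_algebra eps sv V form)"
    and hp: "\<And>p. h (enveloping_class eps sg G br p) = clifford_class eps sv V form (word_hom pi_poly p)"
    using quotient_ring_hom_exists[OF word_hom_pi_poly_relations] by blast
  have "?P h"
    using h by (simp add: hp word_hom_single word_scale_one pi_star_generator_def pi_poly_def)
  then have "?P (pi_star eps sg G br sv V form rep E)"
    unfolding pi_star_def by (rule someI[of ?P])
  then show ?thesis
    by (intro ring_hom_determined_by_generators) (simp_all add: pi_star_generator_def pi_poly_def)
qed

lemma scalar_condition_iff:
  "(\<exists>c. pi_star eps sg G br sv V form rep E (casimir eps sg G br B X)
        \<oplus>\<^bsub>clifford_algebra eps sv V form\<^esub>
      cubic_term eps sv V form phi [^]\<^bsub>clifford_algebra eps sv V form\<^esub> (2::nat)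
      = clifford_class eps sv V form (Poly_Mapping.single [] c)) \<longleftrightarrow> M.jacobi_V"
proof -
  let ?cas = "\<Sum>x\<in>X. Poly_Mapping.single [M.Y.dual x, x] (1::'k)"
  note lin = linear_map_simps[OF linear_quotient_endo]
  let ?q = "M.quantise M.cubic_poly"
  interpret Cl: ring "clifford_algebra eps sv V form" by (rule ring_quotient_algebra)
  have "cubic_term eps sv V form phi [^]\<^bsub>clifford_algebra eps sv V form\<^esub> (2::nat) = clifford_class
      eps sv V form (?q * ?q)"
    unfolding M.cubic_term_eq[OF numeral_nonzero(3)] quotient_class_mult numeral_2_eq_2
    by (simp add: carrier_quotient_algebra)
  moreover have "pi_star eps sg G br sv V form rep E (casimir eps sg G br B X) = clifford_class
      eps sv V form (word_hom pi_poly ?cas)"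
    unfolding casimir_def by (rule pi_star_class)
  moreover have "cl_endo (word_hom pi_poly ?cas) = M.casimir_element"
    by (simp add: word_hom word_hom_single lin quotient_endo_mult cl_endo_pi_poly M.casimir_element_def)
  moreover have "cl_endo ?q = M.psi"
    unfolding M.quotient_endo_cubic[OF numeral_nonzero(3)] M.psi_def ..
  moreover have "cl_endo (Poly_Mapping.single [] c) = endo_scale c (cl_endo 1)" for c
    by (simp add: word_scale_one[symmetric] lin)
  ultimately have "(\<exists>c. pi_star eps sg G br sv V form rep E (casimir eps sg G br B X)
        \<oplus>\<^bsub>clifford_algebra eps sv V form\<^esub>
      cubic_term eps sv V form phi [^]\<^bsub>clifford_algebra eps sv V form\<^esub> (2::nat)
      = clifford_class eps sv V form (Poly_Mapping.single [] c)) \<longleftrightarrow> (\<exists>c. M.dirac_square =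
          endo_scale c (cl_endo 1))"
    by (simp only: quotient_class_add[symmetric] quotient_class_eq_iff_endo lin quotient_endo_mult)
  also have "\<dots> \<longleftrightarrow> M.jacobi_V"
    by (rule M.scalar_iff_jacobi_V) (simp add: quotient_endo_zero_iff M.one_notin_clifford_ideal)
  finally show ?thesis .
qed

subsection \<open>The Jacobi identity\<close>

abbreviation "ps \<equiv> prod_scale sg sv"

lemma ps_vector_space: "vector_space ps"
  by (rule vector_space_prod_scale[OF vector_space_axioms VS.vector_space_axioms])

interpretation P: vector_space ps
  by (rule ps_vector_space)

lemma brt_facts:
  shows brt_bilinear: "bilinear_map ps ps ps brt"
    and brt_antisymmetric: "eps_antisymmetric eps (\<lambda>a. G a \<times> V a) ps brt"
    and brt_GG: "brt (x, 0) (y, 0) = (br x y, 0)"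
    and brt_GV: "brt (x, 0) (0, v) = (0, rep x v)"
    and brt_VV: "brt (0, v) (0, w) = (mu v w, phi v w)"
  using brt unfolding extended_bracket_def by blast+

lemmas brt_right = linear_map_simps[OF bilinear_mapD(1)[OF brt_bilinear]]
lemmas brt_left = linear_map_simps[OF bilinear_mapD(2)[OF brt_bilinear]]

lemma comp_zero: "0 \<in> G a" "0 \<in> V a"
  by (simp_all add: subspace_0[OF subspace_comp] VS.subspace_0[OF VS.subspace_comp])

lemma brt_VG:
  assumes v: "v \<in> V a" and x: "x \<in> G b"
  shows "brt (0, v) (x, 0) = (0, - sv (eps a b) (rep x v))"
proof -
  have "(0, v) \<in> G a \<times> V a" "(x, 0) \<in> G b \<times> V b" using v x by (simp_all add: comp_zero)
  then have "brt (0, v) (x, 0) = - ps (eps a b) (brt (x, 0) (0, v))"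
    using brt_antisymmetric unfolding eps_antisymmetric_def by blast
  then show ?thesis by (simp add: brt_GV prod_scale_def)
qed

lemma brt_split:
  "brt (x, v) q = brt (x, 0) q + brt (0, v) q" "brt p (x, v) = brt p (x, 0) + brt p (0, v)"
  using brt_left(1)[of "(x, 0)" "(0, v)" q] brt_right(1)[of p "(x, 0)" "(0, v)"] by simp_all

lemma brt_V:
  assumes v: "v \<in> V a" and x: "x \<in> G b"
  shows "brt (0, v) (x, w) = (mu v w, phi v w - sv (eps a b) (rep x v))"
  by (subst brt_split(2)) (simp add: brt_VG[OF v x] brt_VV)

lemma brt_G: "brt (x, 0) (y, w) = (br x y, rep x w)"
  by (subst brt_split(2)) (simp add: brt_GG brt_GV)

lemma brt_homogeneous:
  assumes v: "v \<in> V a" and y: "y \<in> G b"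
  shows "brt (x, v) (y, w) = (br x y + mu v w, rep x w + (phi v w - sv (eps a b) (rep y v)))"
  by (subst brt_split(1)) (simp add: brt_V[OF v y] brt_G)

lemma rep_degree: "x \<in> G a \<Longrightarrow> v \<in> V b \<Longrightarrow> rep x v \<in> V (a + b)"
  by (rule M.so_degree[OF rep_so])

lemma rep_form: "x \<in> G a \<Longrightarrow> v \<in> V b \<Longrightarrow> form (rep x v) w = - eps a b * form v (rep x w)"
  by (rule M.so_form[OF rep_so])

lemma br_comp: "x \<in> G a \<Longrightarrow> y \<in> G b \<Longrightarrow> br x y \<in> G (a + b)"
  using br_degree unfolding degree_zero_def by blast

text \<open>The degrees are arguments of their own since 0 lies in every component and a vector does
  not determine its degree.\<close>

definition jacobiator :: "'c \<Rightarrow> 'c \<Rightarrow> 'c \<Rightarrow> 'x \<times> 'v \<Rightarrow> 'x \<times> 'v \<Rightarrow> 'x \<times> 'v \<Rightarrow> 'x \<times> 'v" where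
  "jacobiator a b c p q r = ps (eps c a) (brt p (brt q r)) + ps (eps a b) (brt q (brt r p))
     + ps (eps b c) (brt r (brt p q))"

text \<open>Rotation reduces the eight distributions of the arguments over \<open>G\<close> and
  \<open>V\<close> to the four types treated below.\<close>

lemma jacobiator_rotate: "jacobiator a b c p q r = jacobiator b c a q r p"
  by (simp add: jacobiator_def add_ac)

lemma jacobiator_add: "jacobiator a b c (p + p') q r = jacobiator a b c p q r + jacobiator a b c p' q r"
  by (simp add: jacobiator_def brt_left brt_right P.scale_right_distrib add_ac)

lemma jacobiator_GGG:
  assumes "x \<in> G a" "y \<in> G b" "z \<in> G c"
  shows "jacobiator a b c (x, 0) (y, 0) (z, 0) = 0"
  using br_jacobi[OF assms] by (simp add: jacobiator_def brt_GG prod_scale_def zero_prod_def)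

lemma jacobiator_GGV:
  assumes x: "x \<in> G a" and y: "y \<in> G b" and v: "v \<in> V c"
  shows "jacobiator a b c (x, 0) (y, 0) (0, v) = 0"
proof -
  have sign: "sv (eps b c) (sv (eps c (a + b)) w) = sv (eps c a) w" for w
    by (simp add: eps_simps eps_cancel)
  have "sv (eps b c) (sv (eps c (a + b)) (rep (br x y) v)) =
      sv (eps c a) (rep x (rep y v)) - sv (eps c a * eps a b) (rep y (rep x v))"
    unfolding sign rep_bracket[OF x y] by (simp add: VS.scale_right_diff_distrib)
  moreover have "rep y (- sv (eps c a) (rep x v)) = - sv (eps c a) (rep y (rep x v))"
    by (simp add: linear_map_simps[OF M.so_linear[OF rep_so[OF y]]])
  ultimately show ?thesis
    by (simp add: jacobiator_def brt_GV brt_GG brt_VG[OF v x] brt_VG[OF v br_comp[OF x y]]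
        prod_scale_def zero_prod_def mult.commute del: VS.scale_scale add: VS.scale_scale[of "eps a b"])
qed

text \<open>Paired with \<open>y\<close>, invariance of \<open>B\<close> moves \<open>x\<close> into
  a bracket with \<open>y\<close>, and the representation property resolves that bracket.\<close>

lemma mu_equivariant:
  assumes x: "x \<in> G a" and v: "v \<in> V b"
  shows "br x (mu v w) = mu (rep x v) w + sg (eps a b) (mu v (rep x w))"
proof (rule M.Y.form_determined)
  fix y assume "y \<in> X"
  then have y: "y \<in> G (M.Y.dg y)" by (rule M.Y.dg)
  let ?d = "M.Y.dg y"
  have "B y (br x (mu v w)) = - (eps ?d a * B (br x y) (mu v w))"
    using B_invariant[OF x y, of "mu v w"] by (simp add: eps_cancel)
  also have "B (br x y) (mu v w) = form (rep x (rep y v)) w - eps a ?d * form (rep y (rep x v)) w"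
    by (simp add: M.mu_moment rep_bracket[OF x y] M.form_left)
  also have "form (rep x (rep y v)) w = - eps a (?d + b) * form (rep y v) (rep x w)"
    by (rule rep_form[OF x rep_degree[OF y v]])
  finally have "B y (br x (mu v w)) = eps ?d a * (eps a ?d * (eps a b * form (rep y v) (rep x w)))
      + eps ?d a * (eps a ?d * form (rep y (rep x v)) w)"
    by (simp add: eps_simps algebra_simps)
  then show "B y (br x (mu v w)) = B y (mu (rep x v) w + sg (eps a b) (mu v (rep x w)))"
    by (simp add: eps_cancel M.mu_moment M.Y.form_right)
qed

lemma jacobiator_GVV:
  assumes x: "x \<in> G a" and v: "v \<in> V b" and w: "w \<in> V c"
  shows "jacobiator a b c (x, 0) (0, v) (0, w) = 0"
proof -
  have xv: "rep x v \<in> V (a + b)" by (rule rep_degree[OF x v])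
  have c: "eps b c * (eps c a * eps c b) = eps c a" by (simp add: eps_cancel)
  have "sg (eps b c) (mu w (rep x v)) = - sg (eps c a) (mu (rep x v) w)"
    using mu_swap[OF w xv] by (simp add: eps_simps c)
  moreover have "sv (eps b c) (phi w (rep x v)) = - sv (eps c a) (phi (rep x v) w)"
    using M.phi_swap[OF w xv] by (simp add: eps_simps c)
  ultimately show ?thesis
    by (simp add: jacobiator_def brt_VV brt_G brt_GV brt_VG[OF w x] prod_scale_def zero_prod_def
        mu_equivariant[OF x v] phi_equivariant[OF x v] linear_map_zero[OF bilinear_mapD(1)[OF
            br_bilinear]]
        linear_map_simps[OF mu_linear(1)] M.phi_right
        scale_right_distrib VS.scale_right_distrib mult.commute)
qed

text \<open>Paired with \<open>x\<close>, this is the invariance under \<open>x\<close> of the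
  trilinear form \<open>form v (phi w z)\<close>, a consequence of equivariance of
  \<open>phi\<close> and skewness of \<open>rep\<close>; antisymmetry brings the three terms into
  cyclic shape.\<close>

lemma jacobiator_VVV_fst:
  assumes v: "v \<in> V a" and w: "w \<in> V b" and z: "z \<in> V c"
  shows "sg (eps c a) (mu v (phi w z)) + sg (eps a b) (mu w (phi z v)) + sg (eps b c) (mu z (phi v
      w)) = 0"
proof (rule M.Y.form_determined)
  fix x assume "x \<in> X"
  then have x: "x \<in> G (M.Y.dg x)" by (rule M.Y.dg)
  let ?d = "M.Y.dg x"
  have "form (rep x v) (phi w z) = - eps ?d a * form v (phi (rep x w) z + sv (eps ?d b) (phi w
      (rep x z)))"
    unfolding rep_form[OF x v] phi_equivariant[OF x w] ..
  then have "form (rep x v) (phi w z) = - (eps ?d a * form v (phi (rep x w) z))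
      - eps ?d a * (eps ?d b * form v (phi w (rep x z)))"
    by (simp add: M.form_right algebra_simps)
  also have "form v (phi (rep x w) z) = eps a ?d * (eps a b * (eps a c * form (rep x w) (phi z v)))"
  proof -
    have "form v (phi (rep x w) z) = - eps a (?d + b) * form (rep x w) (phi v z)"
      unfolding M.form_phi_shift[OF v rep_degree[OF x w]]
      by (rule M.phi_invariant[OF v rep_degree[OF x w]])
    also have "phi v z = - sv (eps a c) (phi z v)" by (rule M.phi_swap[OF v z])
    finally show ?thesis by (simp add: M.form_right eps_simps)
  qed
  also have "form v (phi w (rep x z)) = eps (a + b) (?d + c) * form (rep x z) (phi v w)"
    unfolding M.form_phi_shift[OF v w]
    by (rule VS.form_symmetric[OF M.phi_degree[OF v w] rep_degree[OF x z]])
  finally have eq: "form (rep x v) (phi w z) = - (eps a c * (eps a b * form (rep x w) (phi z v)))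
      - eps a c * (eps b c * form (rep x z) (phi v w))"
    by (simp add: eps_simps algebra_simps eps_cancel)
  have "eps c a * form (rep x v) (phi w z) = - (eps a b * form (rep x w) (phi z v)) - eps b c *
      form (rep x z) (phi v w)"
    unfolding eq by (simp add: right_diff_distrib eps_cancel)
  then show "B x (sg (eps c a) (mu v (phi w z)) + sg (eps a b) (mu w (phi z v)) + sg (eps b c) (mu
      z (phi v w))) = B x 0"
    by (simp add: M.Y.form_right M.mu_moment)
qed

text \<open>The one instance that is not automatic: what remains in \<open>V\<close> is the defect
  in \<open>jacobi_V\<close>, up to the invertible sign \<open>eps c a\<close>.\<close>

lemma jacobiator_VVV:
  assumes v: "v \<in> V a" and w: "w \<in> V b" and z: "z \<in> V c"
  shows "jacobiator a b c (0, v) (0, w) (0, z) = (0, sv (eps c a) (M.dphi a b v w z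
    - (rep (mu v w) z + sv (eps a (b + c)) (rep (mu w z) v) - sv (eps b c) (rep (mu v z) w))))"
proof -
  have 1: "sv (eps a b) (phi w (phi z v)) = - sv (eps c a) (sv (eps a b) (phi w (phi v z)))"
    using M.phi_swap[OF z v] by (simp add: M.phi_right mult.commute)
  have 2: "sv (eps b c) (phi z (phi v w)) = - sv (eps c a) (phi (phi v w) z)"
    using M.phi_swap[OF z M.phi_degree[OF v w]] by (simp add: eps_simps eps_cancel)
  have 3: "sv (eps a b) (sv (eps b (c + a)) (rep (mu z v) w)) = - sv (eps c a) (sv (eps b c) (rep
      (mu v z) w))"
  proof -
    have "rep (mu z v) w = - sv (eps c a) (rep (mu v z) w)"
      using mu_swap[OF z v] by (simp add: linear_map_simps[OF rep_linear])
    then show ?thesis by (simp add: eps_simps eps_cancel mult_ac)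
  qed
  have 4: "sv (eps b c) (sv (eps c (a + b)) (rep (mu v w) z)) = sv (eps c a) (rep (mu v w) z)"
    by (simp add: eps_simps eps_cancel)
  have "snd (jacobiator a b c (0, v) (0, w) (0, z)) =
      sv (eps c a) (phi v (phi w z)) - sv (eps c a) (sv (eps a (b + c)) (rep (mu w z) v))
      + (sv (eps a b) (phi w (phi z v)) - sv (eps a b) (sv (eps b (c + a)) (rep (mu z v) w)))
      + (sv (eps b c) (phi z (phi v w)) - sv (eps b c) (sv (eps c (a + b)) (rep (mu v w) z)))"
    by (simp add: jacobiator_def brt_VV brt_V[OF v M.mu_degree[OF w z]] brt_V[OF w M.mu_degree[OF z v]]
        brt_V[OF z M.mu_degree[OF v w]] prod_scale_def VS.scale_right_diff_distrib)
  then have "snd (jacobiator a b c (0, v) (0, w) (0, z)) = sv (eps c a) (M.dphi a b v w z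
    - (rep (mu v w) z + sv (eps a (b + c)) (rep (mu w z) v) - sv (eps b c) (rep (mu v z) w)))"
    unfolding 1 2 3 4 M.dphi_def by (simp add: VS.scale_right_diff_distrib VS.scale_right_distrib)
  moreover have "fst (jacobiator a b c (0, v) (0, w) (0, z)) = 0"
    using jacobiator_VVV_fst[OF v w z]
    by (simp add: jacobiator_def brt_VV brt_V[OF v M.mu_degree[OF w z]] brt_V[OF w M.mu_degree[OF z v]]
        brt_V[OF z M.mu_degree[OF v w]] prod_scale_def)
  ultimately show ?thesis by (simp add: prod_eq_iff)
qed

lemma jacobiator_zero:
  assumes J: "M.jacobi_V" and p: "p \<in> G a \<times> V a" and q: "q \<in> G b \<times> V b" and r: "r \<in> G c \<times> V c"
  shows "jacobiator a b c p q r = 0"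
proof -
  obtain x v where xv: "p = (x, v)" "x \<in> G a" "v \<in> V a" using p by blast
  obtain y w where yw: "q = (y, w)" "y \<in> G b" "w \<in> V b" using q by blast
  obtain z t where zt: "r = (z, t)" "z \<in> G c" "t \<in> V c" using r by blast
  have VVV: "jacobiator a' b' c' (0, v') (0, w') (0, z') = 0"
    if "v' \<in> V a'" "w' \<in> V b'" "z' \<in> V c'" for v' w' z' a' b' c'
  proof -
    have "M.dphi a' b' v' w' z' = rep (mu v' w') z' + sv (eps a' (b' + c')) (rep (mu w' z') v')
        - sv (eps b' c') (rep (mu v' z') w')"
      using J that unfolding M.jacobi_V_def by blast
    then show ?thesis unfolding jacobiator_VVV[OF that] by (simp add: zero_prod_def)
  qed
  have split1: "jacobiator a' b' c' (x', v') q' r' = jacobiator a' b' c' (x', 0) q' r' +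
      jacobiator a' b' c' (0, v') q' r'"
    for a' b' c' x' v' q' r'
    using jacobiator_add[of a' b' c' "(x', 0)" "(0, v')"] by simp
  have split2: "jacobiator a' b' c' p' (x', v') r' = jacobiator a' b' c' p' (x', 0) r' +
      jacobiator a' b' c' p' (0, v') r'"
    for a' b' c' x' v' p' r'
    unfolding jacobiator_rotate[of a' b' c'] by (rule split1)
  have split3: "jacobiator a' b' c' p' q' (x', v') = jacobiator a' b' c' p' q' (x', 0) +
      jacobiator a' b' c' p' q' (0, v')"
    for a' b' c' x' v' p' q'
    unfolding jacobiator_rotate[of a' b' c'] by (rule split2)
  have "jacobiator a b c (x, 0) (0, w) (z, 0) = 0"
    using jacobiator_rotate[of c a b "(z, 0)" "(x, 0)" "(0, w)"] jacobiator_GGV[OF zt(2) xv(2)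
        yw(3)] by simp
  moreover have "jacobiator a b c (0, v) (y, 0) (z, 0) = 0"
    using jacobiator_rotate[of a b c "(0, v)" "(y, 0)" "(z, 0)"] jacobiator_GGV[OF yw(2) zt(2)
        xv(3)] by simp
  moreover have "jacobiator a b c (0, v) (y, 0) (0, t) = 0"
    using jacobiator_rotate[of a b c "(0, v)" "(y, 0)" "(0, t)"] jacobiator_GVV[OF yw(2) zt(3)
        xv(3)] by simp
  moreover have "jacobiator a b c (0, v) (0, w) (z, 0) = 0"
    using jacobiator_rotate[of c a b "(z, 0)" "(0, v)" "(0, w)"] jacobiator_GVV[OF zt(2) xv(3)
        yw(3)] by simp
  moreover note jacobiator_GGG[OF xv(2) yw(2) zt(2)] jacobiator_GGV[OF xv(2) yw(2) zt(3)]
    jacobiator_GVV[OF xv(2) yw(3) zt(3)] VVV[OF xv(3) yw(3) zt(3)]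
  ultimately show ?thesis
    unfolding xv(1) yw(1) zt(1) split1[of a b c x v] split2[of a b c _ y w] split3[of a b c _ _ z
        t] by simp
qed

lemma orthogonal_sum_simp: "orthogonal_sum B form (x, v) (y, w) = B x y + form v w"
  by (simp add: orthogonal_sum_def)

lemma brt_degree_zero: "degree_zero (\<lambda>a. G a \<times> V a) (\<lambda>a. G a \<times> V a) brt"
  unfolding degree_zero_def
proof (intro allI ballI)
  fix a b p q assume "p \<in> G a \<times> V a" "q \<in> G b \<times> V b"
  then obtain x v y w where pq: "p = (x, v)" "q = (y, w)" "x \<in> G a" "v \<in> V a" "y \<in> G b" "w \<in> V b"
      by blast
  have "br x y + mu v w \<in> G (a + b)"
    by (intro subspace_add[OF subspace_comp] br_comp M.mu_degree pq)
  moreover have "rep x w + (phi v w - sv (eps a b) (rep y v)) \<in> V (a + b)"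
    using rep_degree[OF pq(3,6)] M.phi_degree[OF pq(4,6)] rep_degree[OF pq(5,4)]
    by (simp add: VS.subspace_add[OF VS.subspace_comp] VS.subspace_diff[OF VS.subspace_comp]
        M.comp_scale add.commute)
  ultimately show "brt p q \<in> G (a + b) \<times> V (a + b)"
    unfolding pq(1,2) brt_homogeneous[OF pq(4,5)] by simp
qed

lemma brt_invariant_homogeneous:
  assumes p: "x \<in> G a" "v \<in> V a" and q: "y \<in> G b" "w \<in> V b" and r: "z \<in> G c" "t \<in> V c"
  shows "orthogonal_sum B form (brt (x, v) (y, w)) (z, t) = - eps a b * orthogonal_sum B form (y,
      w) (brt (x, v) (z, t))"
proof -
  have 1: "B (br x y) z = - eps a b * B y (br x z)" by (rule B_invariant[OF p(1) q(1)])
  have 2: "form (rep x w) t = - eps a b * form w (rep x t)" by (rule rep_form[OF p(1) q(2)])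
  have 3: "form (phi v w) t = - eps a b * form w (phi v t)" by (rule M.phi_invariant[OF p(2) q(2)])
  have 4: "B (mu v w) z = eps a b * (eps a c * form w (rep z v))"
  proof -
    have "B (mu v w) z = eps (a + b) c * form (rep z v) w"
      using form_symmetric[OF M.mu_degree[OF p(2) q(2)] r(1)] by (simp add: M.mu_moment)
    moreover have "form w (rep z v) = eps b (c + a) * form (rep z v) w"
      by (rule VS.form_symmetric[OF q(2) rep_degree[OF r(1) p(2)]])
    ultimately show ?thesis by (simp add: eps_simps mult_ac eps_cancel)
  qed
  have 5: "form (rep y v) t = B y (mu v t)" by (simp add: M.mu_moment)
  show ?thesis
    unfolding brt_homogeneous[OF p(2) q(1)] brt_homogeneous[OF p(2) r(1)] orthogonal_sum_simp
      M.Y.form_left M.Y.form_right M.form_left M.form_right 1 2 3 4 5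
    by (simp add: algebra_simps)
qed

lemma orthogonal_sum_bilinear: "bilinear_map ps ps (*) (orthogonal_sum B form)"
  by (rule bilinear_mapI[OF ps_vector_space ps_vector_space vector_space_field])
    (simp_all add: orthogonal_sum_def prod_scale_def M.Y.form_left M.Y.form_right M.form_left
        M.form_right algebra_simps)

text \<open>Invariance is required for an arbitrary third argument. Both sides being linear in it,
  it is split into its two components, which are expanded in the homogeneous bases.\<close>

lemma brt_invariant:
  assumes p: "p \<in> G a \<times> V a" and q: "q \<in> G b \<times> V b"
  shows "orthogonal_sum B form (brt p q) r = - eps a b * orthogonal_sum B form q (brt p r)"
proof -
  obtain x v where xv: "p = (x, v)" "x \<in> G a" "v \<in> V a" using p by blast
  obtain y w where yw: "q = (y, w)" "y \<in> G b" "w \<in> V b" using q by blast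
  let ?L = "\<lambda>r. orthogonal_sum B form (brt p q) r + eps a b * orthogonal_sum B form q (brt p r)"
  note os = linear_map_simps[OF bilinear_mapD(1)[OF orthogonal_sum_bilinear]]
  have add: "?L (r + r') = ?L r + ?L r'" for r r'
    by (simp add: os brt_right algebra_simps)
  have scl: "?L (ps c r) = c * ?L r" for c r
    by (simp add: os brt_right algebra_simps)
  have hom: "?L (z, t) = 0" if "z \<in> G c" "t \<in> V c" for z t c
    unfolding xv(1) yw(1) using brt_invariant_homogeneous[OF xv(2,3) yw(2,3) that] by simp
  have zero: "?L 0 = 0" using scl[of 0 0] by (simp add: prod_scale_def zero_prod_def)
  have G: "?L (z, 0) = 0" for z
  proof -
    have ind: "?L (\<Sum>i\<in>A. sg (k i) i, 0) = 0" if "A \<subseteq> X" "finite A" for A k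
      using that(2,1)
    proof (induction A)
      case empty
      then show ?case using zero by (simp add: zero_prod_def)
    next
      case (insert i A)
      have "?L (sg (k i) i, 0) = k i * ?L (i, 0)" using scl[of "k i" "(i, 0)"] by (simp add:
          prod_scale_def)
      moreover have "?L (i, 0) = 0" using insert M.Y.dg[of i] by (intro hom comp_zero) auto
      moreover have "?L (sg (k i) i + (\<Sum>i\<in>A. sg (k i) i), 0) = ?L (sg (k i) i, 0) + ?L (\<Sum>i\<in>A. sg
          (k i) i, 0)"
        using add[of "(sg (k i) i, 0)" "(\<Sum>i\<in>A. sg (k i) i, 0)"] by simp
      ultimately show ?case using insert by simp
    qed
    show ?thesis using ind[OF order_refl M.Y.finite_E, of "\<lambda>i. B z (M.Y.dual i)"] by (simp only:
        M.Y.expand_basis)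
  qed
  have V: "?L (0, t) = 0" for t
  proof -
    have ind: "?L (0, \<Sum>i\<in>A. sv (k i) i) = 0" if "A \<subseteq> E" "finite A" for A k
      using that(2,1)
    proof (induction A)
      case empty
      then show ?case using zero by (simp add: zero_prod_def)
    next
      case (insert i A)
      have "?L (0, sv (k i) i) = k i * ?L (0, i)" using scl[of "k i" "(0, i)"] by (simp add:
          prod_scale_def)
      moreover have "?L (0, i) = 0" using insert M.dg[of i] by (intro hom comp_zero) auto
      moreover have "?L (0, sv (k i) i + (\<Sum>i\<in>A. sv (k i) i)) = ?L (0, sv (k i) i) + ?L (0, \<Sum>i\<in>A.
          sv (k i) i)"
        using add[of "(0, sv (k i) i)" "(0, \<Sum>i\<in>A. sv (k i) i)"] by simp
      ultimately show ?case using insert by simp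
    qed
    show ?thesis using ind[OF order_refl M.finite_E, of "\<lambda>i. form t (M.dual i)"] by (simp only:
        M.expand_basis)
  qed
  have "?L r = ?L (fst r, 0) + ?L (0, snd r)" using add[of "(fst r, 0)" "(0, snd r)"] by simp
  then have "?L r = 0" by (simp only: G V) simp
  then show ?thesis by (simp add: eq_neg_iff_add_eq_0)
qed

lemma quadratic_iff_jacobi_V:
  "quadratic_colour_lie_algebra eps ps (\<lambda>a. G a \<times> V a) brt (orthogonal_sum B form) \<longleftrightarrow> M.jacobi_V"
proof
  assume "quadratic_colour_lie_algebra eps ps (\<lambda>a. G a \<times> V a) brt (orthogonal_sum B form)"
  then interpret Q: quadratic_colour_lie_algebra eps ps "\<lambda>a. G a \<times> V a" brt "orthogonal_sum B form" .
  show M.jacobi_V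
    unfolding M.jacobi_V_def
  proof (intro allI ballI)
    fix a b c v w z assume v: "v \<in> V a" and w: "w \<in> V b" and z: "z \<in> V c"
    have "(0, v) \<in> G a \<times> V a" "(0, w) \<in> G b \<times> V b" "(0, z) \<in> G c \<times> V c"
      using v w z by (simp_all add: comp_zero)
    from Q.br_jacobi[OF this] have "jacobiator a b c (0, v) (0, w) (0, z) = 0"
      by (simp only: jacobiator_def)
    then have "sv (eps c a) (M.dphi a b v w z
      - (rep (mu v w) z + sv (eps a (b + c)) (rep (mu w z) v) - sv (eps b c) (rep (mu v z) w))) = 0"
      unfolding jacobiator_VVV[OF v w z] by (simp add: zero_prod_def)
    then show "M.dphi a b v w z = rep (mu v w) z + sv (eps a (b + c)) (rep (mu w z) v) - sv (eps b
        c) (rep (mu v z) w)"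
      using eps_nonzero[of c a] by simp
  qed
next
  assume J: M.jacobi_V
  interpret gr: graded_vector_space ps "\<lambda>a. G a \<times> V a"
    by (rule graded_vector_space_prod[OF graded_vector_space_axioms VS.graded_vector_space_axioms])
  show "quadratic_colour_lie_algebra eps ps (\<lambda>a. G a \<times> V a) brt (orthogonal_sum B form)"
  proof (intro quadratic_colour_lie_algebra.intro colour_lie_algebra.intro eps_symmetric_space.intro)
    show "commutation_factor eps" by (rule commutation_factor_axioms)
    show "graded_vector_space ps (\<lambda>a. G a \<times> V a)" by (rule gr.graded_vector_space_axioms)
    show "colour_lie_algebra_axioms eps ps (\<lambda>a. G a \<times> V a) brt"
    proof (rule colour_lie_algebra_axioms.intro)
      show "bilinear_map ps ps ps brt" by (rule brt_bilinear)
      show "degree_zero (\<lambda>a. G a \<times> V a) (\<lambda>a. G a \<times> V a) brt" by (rule brt_degree_zero)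
      show "eps_antisymmetric eps (\<lambda>a. G a \<times> V a) ps brt" by (rule brt_antisymmetric)
      show "ps (eps c a) (brt x (brt y z)) + ps (eps a b) (brt y (brt z x)) + ps (eps b c) (brt z
          (brt x y)) = 0"
        if "x \<in> G a \<times> V a" "y \<in> G b \<times> V b" "z \<in> G c \<times> V c" for x y z a b c
        using jacobiator_zero[OF J that] by (simp only: jacobiator_def)
    qed
    show "eps_symmetric_space_axioms eps ps (\<lambda>a. G a \<times> V a) (orthogonal_sum B form)"
    proof (rule eps_symmetric_space_axioms.intro)
      show "bilinear_map ps ps (*) (orthogonal_sum B form)" by (rule orthogonal_sum_bilinear)
      show "orthogonal_sum B form v w = 0" if "v \<in> G a \<times> V a" "w \<in> G b \<times> V b" "a + b \<noteq> 0" for v w a b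
        using that form_degree[of "fst v" a "fst w" b] VS.form_degree[of "snd v" a "snd w" b]
        by (auto simp: orthogonal_sum_def)
      show "orthogonal_sum B form v w = eps a b * orthogonal_sum B form w v"
        if "v \<in> G a \<times> V a" "w \<in> G b \<times> V b" for v w a b
      proof -
        have "B (fst v) (fst w) = eps a b * B (fst w) (fst v)" "form (snd v) (snd w) = eps a b *
            form (snd w) (snd v)"
          using that by (auto intro: form_symmetric VS.form_symmetric)
        then show ?thesis by (simp only: orthogonal_sum_def distrib_left)
      qed
      show "v = 0" if z: "\<And>w. orthogonal_sum B form v w = 0" for v
      proof -
        have "B (fst v) y = 0" "form (snd v) w = 0" for y w
          using z[of "(y, 0)"] z[of "(0, w)"] by (simp_all add: orthogonal_sum_def M.Y.form_right
              M.form_right)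
        then have "fst v = 0" "snd v = 0"
          using form_nondegenerate_left VS.form_nondegenerate_left by blast+
        then show ?thesis by (simp add: prod_eq_iff)
      qed
      show "w = 0" if z: "\<And>v. orthogonal_sum B form v w = 0" for w
      proof -
        have "B y (fst w) = 0" "form v (snd w) = 0" for y v
          using z[of "(y, 0)"] z[of "(0, v)"] by (simp_all add: orthogonal_sum_def M.Y.form_left
              M.form_left)
        then have "fst w = 0" "snd w = 0"
          using form_nondegenerate_right VS.form_nondegenerate_right by blast+
        then show ?thesis by (simp add: prod_eq_iff)
      qed
    qed
    show "quadratic_colour_lie_algebra_axioms eps (\<lambda>a. G a \<times> V a) brt (orthogonal_sum B form)"
      by (rule quadratic_colour_lie_algebra_axioms.intro) (rule brt_invariant)
  qed (rule commutation_factor_axioms gr.graded_vector_space_axioms)+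
qed

end

theorem theorem3p1:
  fixes eps :: "'c::ab_group_add \<Rightarrow> 'c \<Rightarrow> 'k::field"
    and sg :: "'k \<Rightarrow> 'x::ab_group_add \<Rightarrow> 'x" and G :: "'c \<Rightarrow> 'x set"
    and br :: "'x \<Rightarrow> 'x \<Rightarrow> 'x" and B :: "'x \<Rightarrow> 'x \<Rightarrow> 'k"
    and sv :: "'k \<Rightarrow> 'v::ab_group_add \<Rightarrow> 'v" and V :: "'c \<Rightarrow> 'v set"
    and form :: "'v \<Rightarrow> 'v \<Rightarrow> 'k" and rep :: "'x \<Rightarrow> 'v \<Rightarrow> 'v"
    and mu :: "'v \<Rightarrow> 'v \<Rightarrow> 'x" and phi :: "'v \<Rightarrow> 'v \<Rightarrow> 'v"
    and brt :: "'x \<times> 'v \<Rightarrow> 'x \<times> 'v \<Rightarrow> 'x \<times> 'v"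
    and X :: "'x set" and E :: "'v set"
  assumes char: "CHAR('k) \<noteq> 2" "CHAR('k) \<noteq> 3"
    and quadratic: "quadratic_colour_lie_algebra eps sg G br B"
    and rep: "orthogonal_representation eps sg G br sv V form rep"
    and finite_dim: "finite_dim sg" "finite_dim sv"
    and dim: "vector_space.dim sv (UNIV :: 'v set) \<ge> 2"
    and mu: "moment_map eps sg G B sv V form rep mu"
    and phi: "bilinear_map sv sv sv phi" "degree_zero V V phi" "eps_antisymmetric eps V sv phi"
    and phi_equivariant: "\<And>a b x v w. x \<in> G a \<Longrightarrow> v \<in> V b \<Longrightarrow>
        rep x (phi v w) = phi (rep x v) w + sv (eps a b) (phi v (rep x w))"
    and phi_invariant: "\<And>a b u v w. u \<in> V a \<Longrightarrow> v \<in> V b \<Longrightarrow>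
        form (phi u v) w = - eps a b * form v (phi u w)"
    and brt: "extended_bracket eps sg G br sv V rep mu phi brt"
    and bases: "homogeneous_basis sg G X" "homogeneous_basis sv V E"
  shows "quadratic_colour_lie_algebra eps (prod_scale sg sv) (\<lambda>a. G a \<times> V a) brt
           (orthogonal_sum B form) \<longleftrightarrow>
         (\<exists>c. pi_star eps sg G br sv V form rep E (casimir eps sg G br B X)
                \<oplus>\<^bsub>clifford_algebra eps sv V form\<^esub>
              cubic_term eps sv V form phi [^]\<^bsub>clifford_algebra eps sv V form\<^esub> (2::nat)
              = clifford_class eps sv V form (Poly_Mapping.single [] c))"
proof -
  interpret cubic_extension eps sg G br B sv V form rep mu phi brt X E
    by (intro cubic_extension.intro cubic_extension_axioms.intro quadratic rep char finite_dim mu phi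
        phi_equivariant phi_invariant brt bases)
  show ?thesis unfolding quadratic_iff_jacobi_V scalar_condition_iff ..
qed

end
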